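(* There exists a universal constant $C>0$ such that the following holds. Let $d,n,s\in\mathbb{N}$, let $N=n^d$, and suppose $s\le N$. Let $\Omega=(0,1)^d$ and let $\eta\in C^1(\overline{\Omega})$ be a real-valued function satisfying $$\eta_{\min}:=\min_{z\in\overline{\Omega}}\eta(z)>0,\qquad \|\eta\|_{L^\infty(\Omega)}\sum_{k=1}^d\|(\nabla\eta)_k\|_{L^\infty(\Omega)}<\frac{\pi}{2}\,\eta_{\min}^2 .$$ Let $B\in\mathbb{R}^{N\times N}$ be the full spectral collocation matrix associated with $\eta$ (defined in the context). Then $$r\le\lambda_{\min}(B^TB)\le\lambda_{\max}(B^TB)\le R,$$ where $$r:=\eta_{\min}^2-\frac{2}{\pi}\|\eta\|_{L^\infty(\Omega)}\sum_{k=1}^d\|(\nabla\eta)_k\|_{L^\infty(\Omega)},\qquad R:=\left(\|\eta\|_{L^\infty(\Omega)}+\frac1\pi\sum_{k=1}^d\|(\nabla\eta)_k\|_{L^\infty(\Omega)}\right)^2 .$$ Moreover, given $\delta$ with $1-\frac{r}{R}<\delta<1$, set $$\widetilde{C}=C\cdot 2^d\left(\delta-\left(1-\frac rR\right)\right)^{-2}.$$ If $m\in\mathbb{N}$ satisfies $m\ge\widetilde{C}\,s\ln^3(s)\ln(N)$, and if $s\ge\widetilde{C}\ln(N)$, then the matrix $A/\sqrt{R}$, where $A\in\mathbb{R}^{m\times N}$ is the random compressive spectral collocation matrix obtained from $B$ (defined in the context), satisfies the restricted isometry property of order $s$ and constant $\delta$ with probability at least $1-N^{-\ln^3(s)}$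.
   Context: Notation: $[n]=\{1,\dots,n\}$; $\mathbb{N}=\{1,2,\dots\}$; $\ln^3(s)=(\ln s)^3$; $(\nabla\eta)_k$ is the $k$-th partial derivative of $\eta$; $\lambda_{\min},\lambda_{\max}$ denote the smallest and largest eigenvalues. A universal constant is an absolute constant, independent of all other quantities ($d,n,N,s,m,\delta,\eta$). Basis functions: for $j\in[n]^d$ and $z\in\overline{\Omega}=[0,1]^d$, $$\psi_j(z)=\frac{1}{(n+1)^{d/2}}\cdot\frac{2^{d/2}}{\pi^2\|j\|_2^2}\prod_{k=1}^d\sin(\pi j_kz_k).$$ Collocation points: $t_q=\frac{q}{n+1}\in\Omega$ for $q\in[n]^d$. Full spectral collocation matrix associated with a coefficient $\eta$: the matrix $B\in\mathbb{R}^{N\times N}$, $N=n^d$, with rows and columns indexed by $[n]^d$ (in some fixed ordering) and entries $$B_{qj}=[\nabla\cdot(\eta\nabla\psi_j)](t_q),\qquad q,j\in[n]^d.$$ Compressive spectral collocation matrix: draw $\tau_1,\dots,\tau_m$ independently and uniformly at random from $[n]^d$ and let $A\in\mathbb{R}^{m\times N}$ have entries $$A_{ij}=\sqrt{\frac{N}{m}}\,B_{\tau_i,j},\qquad i\in[m],\ j\in[n]^d.$$ Restricted isometry property: a matrix $M\in\mathbb{R}^{m\times N}$ satisfies the restricted isometry property of order $s$ and constant $0<\delta<1$ if $$(1-\delta)\|v\|_2^2\le\|Mv\|_2^2\le(1+\delta)\|v\|_2^2\quad\text{for all }v\in\mathbb{R}^N\text{ with }\|v\|_0\le s,$$ where $\|v\|_0$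 is the number of nonzero entries of $v$. *)

theory Defs
  imports
    "HOL-Analysis.Analysis"
    "HOL-Probability.Probability"
    "Jordan_Normal_Form.Spectral_Radius"
begin

text \<open>
  Since the dimension \<open>d\<close> is quantified below an absolute constant, it cannot be a type. A point of
  \<open>d\<close>-dimensional real space is an extensional function on \<open>{1..d}\<close>, so the points outside this
  index set carry no information. On these functions the product topology of \<open>nat \<Rightarrow> real\<close> is the
  Euclidean topology.
\<close>

definition open_cube :: "nat \<Rightarrow> (nat \<Rightarrow> real) set" where
  "open_cube d = ({1..d} \<rightarrow>\<^sub>E {0<..<1})"

definition closed_cube :: "nat \<Rightarrow> (nat \<Rightarrow> real) set" where
  "closed_cube d = ({1..d} \<rightarrow>\<^sub>E {0..1})"

definition grid :: "nat \<Rightarrow> nat \<Rightarrow> (nat \<Rightarrow> nat) set" where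
  "grid d n = ({1..d} \<rightarrow>\<^sub>E {1..n})"

definition partial_deriv :: "nat \<Rightarrow> ((nat \<Rightarrow> real) \<Rightarrow> real) \<Rightarrow> (nat \<Rightarrow> real) \<Rightarrow> real" where
  "partial_deriv k f z = deriv (\<lambda>t. f (z(k := t))) (z k)"

definition grad :: "nat \<Rightarrow> ((nat \<Rightarrow> real) \<Rightarrow> real) \<Rightarrow> (nat \<Rightarrow> real) \<Rightarrow> nat \<Rightarrow> real" where
  "grad d f z = (\<lambda>k\<in>{1..d}. partial_deriv k f z)"

definition divergence :: "nat \<Rightarrow> ((nat \<Rightarrow> real) \<Rightarrow> nat \<Rightarrow> real) \<Rightarrow> (nat \<Rightarrow> real) \<Rightarrow> real" where
  "divergence d F z = (\<Sum>k=1..d. partial_deriv k (\<lambda>x. F x k) z)"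

text \<open>
  Continuously differentiable up to the boundary: the partial derivatives exist in the open cube and
  extend continuously to the closed cube.
\<close>

definition C1_closed_cube :: "nat \<Rightarrow> ((nat \<Rightarrow> real) \<Rightarrow> real) \<Rightarrow> bool" where
  "C1_closed_cube d f \<longleftrightarrow>
     continuous_on (closed_cube d) f \<and>
     (\<forall>k\<in>{1..d}.
        (\<forall>z\<in>open_cube d. (\<lambda>t. f (z(k := t))) differentiable at (z k)) \<and>
        (\<exists>g. continuous_on (closed_cube d) g \<and> (\<forall>z\<in>open_cube d. g z = partial_deriv k f z)))"

text \<open>
  The library's essential supremum takes extended real values; for functions that are not measurable
  or not essentially bounded on the cube it is infinite and the conversion to a real returns \<open>0\<close>.
  The functions in \<^const>\<open>C1_closed_cube\<close> and their partial derivatives are measurable and bounded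
  there.
\<close>

definition Linf_norm :: "nat \<Rightarrow> ((nat \<Rightarrow> real) \<Rightarrow> real) \<Rightarrow> real" where
  "Linf_norm d f =
     real_of_ereal
       (esssup (restrict_space (Pi\<^sub>M {1..d} (\<lambda>_. lborel)) (open_cube d)) (\<lambda>z. ereal \<bar>f z\<bar>))"

text \<open>For continuous \<open>f\<close> the infimum is attained, by compactness of the closed cube.\<close>

definition cube_min :: "nat \<Rightarrow> ((nat \<Rightarrow> real) \<Rightarrow> real) \<Rightarrow> real" where
  "cube_min d f = (INF z\<in>closed_cube d. f z)"

definition sine_basis :: "nat \<Rightarrow> nat \<Rightarrow> (nat \<Rightarrow> nat) \<Rightarrow> (nat \<Rightarrow> real) \<Rightarrow> real" where
  "sine_basis d n j z =
     1 / (real n + 1) powr (real d / 2) *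
     (2 powr (real d / 2) / (pi\<^sup>2 * (\<Sum>k=1..d. (real (j k))\<^sup>2))) *
     (\<Prod>k=1..d. sin (pi * real (j k) * z k))"

definition colloc_point :: "nat \<Rightarrow> nat \<Rightarrow> (nat \<Rightarrow> nat) \<Rightarrow> nat \<Rightarrow> real" where
  "colloc_point d n q = (\<lambda>k\<in>{1..d}. real (q k) / (real n + 1))"

definition colloc_entry ::
  "nat \<Rightarrow> nat \<Rightarrow> ((nat \<Rightarrow> real) \<Rightarrow> real) \<Rightarrow> (nat \<Rightarrow> nat) \<Rightarrow> (nat \<Rightarrow> nat) \<Rightarrow> real" where
  "colloc_entry d n \<eta> q j =
     divergence d (\<lambda>z k. \<eta> z * grad d (sine_basis d n j) z k) (colloc_point d n q)"

text \<open>
  The argument \<open>e\<close> is the ordering of the multi-indices: an enumeration of \<^term>\<open>grid d n\<close> by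
  \<open>{0..<n ^ d}\<close>.
\<close>

definition full_colloc_mat ::
  "nat \<Rightarrow> nat \<Rightarrow> (nat \<Rightarrow> nat \<Rightarrow> nat) \<Rightarrow> ((nat \<Rightarrow> real) \<Rightarrow> real) \<Rightarrow> real mat" where
  "full_colloc_mat d n e \<eta> =
     mat (n ^ d) (n ^ d) (\<lambda>(a, b). colloc_entry d n \<eta> (e a) (e b))"

text \<open>Rows are numbered from \<open>0\<close>, so the drawn multi-indices are \<open>\<tau> 0, \<dots>, \<tau> (m - 1)\<close>.\<close>

definition compressive_colloc_mat ::
  "nat \<Rightarrow> nat \<Rightarrow> (nat \<Rightarrow> nat \<Rightarrow> nat) \<Rightarrow> ((nat \<Rightarrow> real) \<Rightarrow> real) \<Rightarrow> nat \<Rightarrow> (nat \<Rightarrow> nat \<Rightarrow> nat) \<Rightarrow> real mat" where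
  "compressive_colloc_mat d n e \<eta> m \<tau> =
     mat m (n ^ d)
       (\<lambda>(i, b). sqrt (real (n ^ d) / real m) * colloc_entry d n \<eta> (\<tau> i) (e b))"

definition draws :: "nat \<Rightarrow> nat \<Rightarrow> nat \<Rightarrow> (nat \<Rightarrow> nat \<Rightarrow> nat) pmf" where
  "draws d n m = Pi_pmf {..<m} undefined (\<lambda>_. pmf_of_set (grid d n))"

text \<open>Only meaningful for matrices with finitely many, and at least one, eigenvalues.\<close>

definition lambda_min :: "real mat \<Rightarrow> real" where
  "lambda_min M = Min (spectrum M)"

definition lambda_max :: "real mat \<Rightarrow> real" where
  "lambda_max M = Max (spectrum M)"

definition norm2_sq :: "real vec \<Rightarrow> real" where
  "norm2_sq v = (\<Sum>i<dim_vec v. (v $ i)\<^sup>2)"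

definition norm0 :: "real vec \<Rightarrow> nat" where
  "norm0 v = card {i. i < dim_vec v \<and> v $ i \<noteq> 0}"

definition RIP :: "nat \<Rightarrow> real \<Rightarrow> real mat \<Rightarrow> bool" where
  "RIP s \<delta> M \<longleftrightarrow>
     0 < \<delta> \<and> \<delta> < 1 \<and>
     (\<forall>v\<in>carrier_vec (dim_col M). norm0 v \<le> s \<longrightarrow>
        (1 - \<delta>) * norm2_sq v \<le> norm2_sq (M *\<^sub>v v) \<and>
        norm2_sq (M *\<^sub>v v) \<le> (1 + \<delta>) * norm2_sq v)"

end

theory Submission
  imports Defs
begin

text \<open>
  \<^bold>\<open>The eigenvalue bounds.\<close> At the collocation points the operator splits as
  \<open>- D(\<eta>) F + \<Sum>k. D(\<partial>k \<eta>) H k\<close> with diagonal matrices \<open>D\<close>. The matrix \<open>F\<close> is a tensor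
  product of discrete sine transforms, hence an isometry. In \<open>H k\<close> the sine transform of one
  direction is a cosine transform; without the end points of the interval this is only a
  contraction, and the derivative contributes a weight of at most \<open>1 / pi\<close>. The triangle inequality
  then encloses the norm of \<open>B v\<close> (\<open>colloc_norm_bounds\<close>), hence the Rayleigh quotients of the Gram
  matrix (\<open>gram_spectrum_bounds\<close>). The collocation points are interior and all functions involved
  are continuous, so their values there are bounded by the essential suprema
  (\<open>abs_le_Linf_norm\<close>).

  \<^bold>\<open>The restricted isometry property.\<close> After division by \<open>sqrt R\<close>, the expected square of the norm
  of the sampled image of \<open>v\<close> lies between \<open>r / R\<close> and 1 times the square of the norm of \<open>v\<close>. So it
  suffices that, uniformly over the sparse vectors of the unit ball, the sampled quadratic form
  deviates from its mean by at most \<open>\<epsilon> = \<delta> - (1 - r / R)\<close>. The rows that are sampled have entries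
  of size at most \<open>K = 2 powr (d / 2)\<close>, and the draws are uniform on a finite set, so that all
  probabilities can be counted (\<open>sparse_uniform_deviation\<close>).

  Comparison with a second independent sample reduces the deviation to sums with random signs
  (\<open>symmetrization\<close>). For a fixed sample these sums are controlled by chaining: the increments
  between two nets are subgaussian with a variance that is proportional to the squared distance of
  the nets, in the maximum norm over the sample (\<open>chaining\<close>). Sparse unit vectors lie in the \<open>l1\<close>
  ball of radius \<open>sqrt s\<close>, and Maurey's empirical method covers this ball at scale \<open>u\<close> by
  \<open>exp (c * s * K\<^sup>2 / u\<^sup>2 * ln m * ln N)\<close> points (\<open>l1_ball_net\<close>). The squared scale cancels between
  the entropy and the variance, so all levels cost the same. About \<open>ln s\<close> levels are needed, each
  with a share \<open>1 / ln s\<close> of the deviation; together they require \<open>m\<close> to be of the order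
  \<open>s * K\<^sup>2 / \<epsilon>\<^sup>2 * (ln s)\<^sup>2 * ln m * ln N\<close>. By the hypothesis \<open>s \<ge> Ct * ln N\<close>, the logarithms of
  \<open>1 / \<epsilon>\<close> and of the smallest admissible \<open>m\<close> are at most of the order \<open>ln s\<close>, which leads to the
  third power. The failure probability is that of the coarsest level,
  \<open>exp (- c * m * \<epsilon>\<^sup>2 / (s * K\<^sup>2))\<close>, a large power of \<open>N powr (- (ln s) ^ 3)\<close>
  (\<open>chaining_parameters\<close>).
\<close>

section \<open>Sums with random signs\<close>

definition signs :: "nat \<Rightarrow> (nat \<Rightarrow> real) set" where
  "signs m = ({..<m} \<rightarrow>\<^sub>E {-1, 1})"

lemma finite_signs [simp]: "finite (signs m)"
  by (auto simp: signs_def intro: finite_PiE)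

lemma card_signs: "card (signs m) = 2 ^ m"
  by (simp add: signs_def card_PiE numeral_2_eq_2)

lemma cosh_le_exp_half_square: "cosh (x::real) \<le> exp (x\<^sup>2 / 2)"
proof -
  have tanh_le: "tanh y \<le> y" if "y \<ge> 0" for y :: real
  proof -
    have "(\<lambda>y::real. y - tanh y) 0 \<le> (\<lambda>y. y - tanh y) y"
    proof (rule DERIV_nonneg_imp_nondecreasing[OF that])
      fix u :: real
      have "((\<lambda>y. y - tanh y) has_real_derivative (tanh u)\<^sup>2) (at u)"
        by (auto intro!: derivative_eq_intros simp: power2_eq_square)
      then show "\<exists>y. ((\<lambda>y. y - tanh y) has_real_derivative y) (at u) \<and> 0 \<le> y" by auto
    qed
    then show ?thesis by simp
  qed
  have "(\<lambda>y::real. y\<^sup>2 / 2 - ln (cosh y)) 0 \<le> (\<lambda>y. y\<^sup>2 / 2 - ln (cosh y)) \<bar>x\<bar>"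
  proof (rule DERIV_nonneg_imp_nondecreasing[OF abs_ge_zero])
    fix u :: real assume "0 \<le> u"
    have "((\<lambda>y. y\<^sup>2 / 2 - ln (cosh y)) has_real_derivative (u - tanh u)) (at u)"
      using cosh_real_pos[of u] by (auto intro!: derivative_eq_intros simp: tanh_def)
    then show "\<exists>y. ((\<lambda>y. y\<^sup>2 / 2 - ln (cosh y)) has_real_derivative y) (at u) \<and> 0 \<le> y"
      using tanh_le[OF \<open>0 \<le> u\<close>] by (intro exI[of _ "u - tanh u"]) auto
  qed
  then have "ln (cosh x) \<le> x\<^sup>2 / 2" by simp
  then show ?thesis using cosh_real_pos[of x] by (metis exp_le_cancel_iff exp_ln)
qed

lemma sum_signs_exp:
  "(\<Sum>\<sigma>\<in>signs m. exp (\<Sum>i<m. \<sigma> i * c i)) = (\<Prod>i<m. 2 * cosh (c i :: real))"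
proof -
  have "(\<Sum>\<sigma>\<in>signs m. exp (\<Sum>i<m. \<sigma> i * c i)) = (\<Sum>\<sigma>\<in>signs m. \<Prod>i<m. exp (\<sigma> i * c i))"
    by (simp add: exp_sum)
  also have "\<dots> = (\<Prod>i<m. \<Sum>\<sigma>\<in>{-1,1}. exp (\<sigma> * c i))"
    unfolding signs_def by (rule prod_sum_PiE[symmetric]) auto
  also have "\<dots> = (\<Prod>i<m. 2 * cosh (c i))"
    by (intro prod.cong refl) (simp add: cosh_field_def)
  finally show ?thesis .
qed

text \<open>
  Markov's inequality for the exponential moment. The sign vectors form a product, so the moment
  factorizes into hyperbolic cosines. All probabilities over signs are written as cardinalities.
\<close>

lemma rademacher_tail:
  fixes c :: "nat \<Rightarrow> real"
  assumes V: "(\<Sum>i<m. (c i)\<^sup>2) \<le> V" "V > 0" and t: "t \<ge> 0"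
  shows "real (card {\<sigma>\<in>signs m. \<bar>\<Sum>i<m. \<sigma> i * c i\<bar> \<ge> t}) \<le> 2 ^ m * (2 * exp (- t\<^sup>2 / (2 * V)))"
proof -
  \<comment> \<open>The minimizer of the exponent \<open>l\<^sup>2 * V / 2 - l * t\<close>.\<close>
  define l where "l = t / V"
  have l0: "l \<ge> 0" using V t by (simp add: l_def)
  have half: "real (card {\<sigma>\<in>signs m. (\<Sum>i<m. \<sigma> i * h * c i) \<ge> t}) \<le> 2 ^ m * exp (- t\<^sup>2 / (2 * V))"
    if h: "h \<in> {-1, 1}" for h :: real
  proof -
    define E where "E = {\<sigma>\<in>signs m. (\<Sum>i<m. \<sigma> i * h * c i) \<ge> t}"
    have fE: "finite E" by (simp add: E_def)
    have "real (card E) * exp (l * t) = (\<Sum>\<sigma>\<in>E. exp (l * t))" by simp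
    also have "\<dots> \<le> (\<Sum>\<sigma>\<in>E. exp (\<Sum>i<m. \<sigma> i * (l * h * c i)))"
    proof (rule sum_mono)
      fix \<sigma> assume "\<sigma> \<in> E"
      then have "l * t \<le> l * (\<Sum>i<m. \<sigma> i * h * c i)"
        using l0 by (intro mult_left_mono) (auto simp: E_def)
      also have "\<dots> = (\<Sum>i<m. \<sigma> i * (l * h * c i))" by (simp add: sum_distrib_left mult_ac)
      finally show "exp (l * t) \<le> exp (\<Sum>i<m. \<sigma> i * (l * h * c i))" by simp
    qed
    also have "\<dots> \<le> (\<Sum>\<sigma>\<in>signs m. exp (\<Sum>i<m. \<sigma> i * (l * h * c i)))"
      by (rule sum_mono2) (auto simp: E_def)
    also have "\<dots> = (\<Prod>i<m. 2 * cosh (l * h * c i))" by (rule sum_signs_exp)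
    also have "\<dots> \<le> (\<Prod>i<m. 2 * exp ((l * c i)\<^sup>2 / 2))"
    proof (rule prod_mono)
      fix i
      have "(l * h * c i)\<^sup>2 = (l * c i)\<^sup>2" using h by (auto simp: power_mult_distrib)
      then show "0 \<le> 2 * cosh (l * h * c i) \<and> 2 * cosh (l * h * c i) \<le> 2 * exp ((l * c i)\<^sup>2 / 2)"
        using cosh_le_exp_half_square[of "l * h * c i"] cosh_real_pos[of "l * h * c i"] by (simp add: less_imp_le)
    qed
    also have "\<dots> = 2 ^ m * exp (l\<^sup>2 * (\<Sum>i<m. (c i)\<^sup>2) / 2)"
      by (simp add: prod.distrib exp_sum[symmetric] sum_distrib_left sum_divide_distrib power_mult_distrib)
    also have "\<dots> \<le> 2 ^ m * exp (l\<^sup>2 * V / 2)"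
      using V by (simp add: divide_right_mono mult_left_mono)
    finally have "real (card E) \<le> 2 ^ m * exp (l\<^sup>2 * V / 2) / exp (l * t)"
      by (simp add: field_simps)
    also have "\<dots> = 2 ^ m * exp (l\<^sup>2 * V / 2 - l * t)" by (simp add: exp_diff)
    also have "l\<^sup>2 * V / 2 - l * t = - t\<^sup>2 / (2 * V)"
      using V by (simp add: l_def field_simps power2_eq_square)
    finally show ?thesis by (simp add: E_def)
  qed
  have "{\<sigma>\<in>signs m. \<bar>\<Sum>i<m. \<sigma> i * c i\<bar> \<ge> t} \<subseteq>
     {\<sigma>\<in>signs m. (\<Sum>i<m. \<sigma> i * 1 * c i) \<ge> t} \<union> {\<sigma>\<in>signs m. (\<Sum>i<m. \<sigma> i * (-1) * c i) \<ge> t}"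
    by (auto simp: abs_if sum_negf split: if_splits)
  then have "card {\<sigma>\<in>signs m. \<bar>\<Sum>i<m. \<sigma> i * c i\<bar> \<ge> t} \<le>
     card ({\<sigma>\<in>signs m. (\<Sum>i<m. \<sigma> i * 1 * c i) \<ge> t} \<union> {\<sigma>\<in>signs m. (\<Sum>i<m. \<sigma> i * (-1) * c i) \<ge> t})"
    by (intro card_mono) auto
  also have "\<dots> \<le> card {\<sigma>\<in>signs m. (\<Sum>i<m. \<sigma> i * 1 * c i) \<ge> t} + card {\<sigma>\<in>signs m. (\<Sum>i<m. \<sigma> i * (-1) * c i) \<ge> t}"
    by (rule card_Un_le)
  finally have "real (card {\<sigma>\<in>signs m. \<bar>\<Sum>i<m. \<sigma> i * c i\<bar> \<ge> t}) \<le>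
    real (card {\<sigma>\<in>signs m. (\<Sum>i<m. \<sigma> i * 1 * c i) \<ge> t}) + real (card {\<sigma>\<in>signs m. (\<Sum>i<m. \<sigma> i * (-1) * c i) \<ge> t})"
    by linarith
  also have "\<dots> \<le> 2 ^ m * exp (- t\<^sup>2 / (2 * V)) + 2 ^ m * exp (- t\<^sup>2 / (2 * V))"
    by (intro add_mono half) auto
  finally show ?thesis by simp
qed

section \<open>Chaining\<close>

lemma sum_abs_mult_le_sqrt:
  fixes a b :: "nat \<Rightarrow> real"
  assumes "(\<Sum>i<m. (a i)\<^sup>2) \<le> A" "(\<Sum>i<m. (b i)\<^sup>2) \<le> B"
  shows "(\<Sum>i<m. \<bar>a i\<bar> * \<bar>b i\<bar>) \<le> sqrt A * sqrt B"
proof -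
  have "(\<Sum>i<m. \<bar>a i\<bar> * \<bar>b i\<bar>) \<le> L2_set a {..<m} * L2_set b {..<m}"
    by (rule L2_set_mult_ineq)
  also have "\<dots> \<le> sqrt A * sqrt B"
  proof (rule mult_mono)
    show "0 \<le> sqrt A" using order_trans[OF sum_nonneg assms(1)] by simp
    show "L2_set a {..<m} \<le> sqrt A" "L2_set b {..<m} \<le> sqrt B"
      using assms by (simp_all add: L2_set_def)
  qed (rule L2_set_nonneg)
  finally show ?thesis .
qed

text \<open>
  The net at level \<open>l\<close> is the image of \<open>\<pi> l\<close>, and it lies inside \<open>T\<close>: then the sum of squares of
  every net point is at most \<open>m * M\<close>, so the increment of the squares between two levels has
  variance at most \<open>4 * (w l + w (Suc l))\<^sup>2 * m * M\<close>, which is proportional to the squared scale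
  even where the squares themselves are large. The union bound over the pairs of consecutive net
  points gives the sum on the right-hand side; behind the last level the Cauchy--Schwarz
  inequality replaces probability.
\<close>

lemma chaining:
  fixes T :: "'v set" and g :: "'v \<Rightarrow> nat \<Rightarrow> real" and \<pi> :: "nat \<Rightarrow> 'v \<Rightarrow> 'v"
    and c w \<tau> :: "nat \<Rightarrow> real" and L :: nat
  assumes M: "\<And>v. v \<in> T \<Longrightarrow> (\<Sum>i<m. (g v i)\<^sup>2) \<le> real m * M" and M0: "M > 0" and m: "m \<ge> 1"
    and \<pi>T: "\<And>l v. v \<in> T \<Longrightarrow> \<pi> l v \<in> T"
    and fin: "\<And>l. finite (\<pi> l ` T)" and card: "\<And>l. real (card (\<pi> l ` T)) \<le> c l"
    and net: "\<And>l v i. v \<in> T \<Longrightarrow> i < m \<Longrightarrow> \<bar>g v i - g (\<pi> l v) i\<bar> \<le> w l"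
    and w: "\<And>l. w l > 0" and \<tau>: "\<And>l. \<tau> l \<ge> 0"
    and start: "\<And>v i. v \<in> T \<Longrightarrow> i < m \<Longrightarrow> g (\<pi> 0 v) i = 0"
    and \<theta>: "(\<Sum>l<L. \<tau> l) + 2 * w L \<le> \<theta>"
  shows "real (card {\<sigma>\<in>signs m. \<exists>v\<in>T. \<bar>\<Sum>i<m. \<sigma> i * (g v i)\<^sup>2\<bar> > real m * \<theta> * sqrt M})
     \<le> 2 ^ m * (\<Sum>l<L. c l * c (Suc l) * (2 * exp (- real m * (\<tau> l)\<^sup>2 / (8 * (w l + w (Suc l))\<^sup>2))))"
proof -
  define inc where "inc p i = (g (snd p) i)\<^sup>2 - (g (fst p) i)\<^sup>2" for p :: "'v \<times> 'v" and i
  define pairs where "pairs l = (\<lambda>v. (\<pi> l v, \<pi> (Suc l) v)) ` T" for l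
  define Q where "Q l = 2 * exp (- real m * (\<tau> l)\<^sup>2 / (8 * (w l + w (Suc l))\<^sup>2))" for l
  define E where "E l p = {\<sigma>\<in>signs m. \<bar>\<Sum>i<m. \<sigma> i * inc p i\<bar> \<ge> real m * \<tau> l * sqrt M}" for l p
  have pairs_sub: "pairs l \<subseteq> (\<pi> l ` T) \<times> (\<pi> (Suc l) ` T)" for l by (auto simp: pairs_def)
  have fin_pairs: "finite (pairs l)" for l
    unfolding pairs_def by (rule finite_subset[OF pairs_sub[unfolded pairs_def]]) (intro finite_cartesian_product fin)
  have c0: "c l \<ge> 0" for l by (rule order_trans[OF of_nat_0_le_iff card])
  have card_pairs: "real (card (pairs l)) \<le> c l * c (Suc l)" for l
  proof -
    have "card (pairs l) \<le> card ((\<pi> l ` T) \<times> (\<pi> (Suc l) ` T))"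
      by (intro card_mono pairs_sub finite_cartesian_product fin)
    then have "real (card (pairs l)) \<le> real (card (\<pi> l ` T)) * real (card (\<pi> (Suc l) ` T))"
      by (simp add: card_cartesian_product flip: of_nat_mult)
    also have "\<dots> \<le> c l * c (Suc l)" by (intro mult_mono card c0) auto
    finally show ?thesis .
  qed
  have tail: "real (card (E l p)) \<le> 2 ^ m * (2 * exp (- real m * (\<tau> l)\<^sup>2 / (8 * (w l + w (Suc l))\<^sup>2)))"
    if p: "p \<in> pairs l" for l p
  proof -
    obtain v where v: "v \<in> T" "p = (\<pi> l v, \<pi> (Suc l) v)" using p by (auto simp: pairs_def)
    define a b where "a = \<pi> l v" and "b = \<pi> (Suc l) v"
    have ab: "a \<in> T" "b \<in> T" using v \<pi>T by (auto simp: a_def b_def)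
    define W where "W = w l + w (Suc l)"
    have W: "W > 0" using w[of l] w[of "Suc l"] by (simp add: W_def)
    have diff: "\<bar>g b i - g a i\<bar> \<le> W" if "i < m" for i
      using net[OF v(1) that, of l] net[OF v(1) that, of "Suc l"] by (auto simp: W_def a_def b_def)
    have "(\<Sum>i<m. (inc p i)\<^sup>2) \<le> (\<Sum>i<m. W\<^sup>2 * (2 * (g b i)\<^sup>2 + 2 * (g a i)\<^sup>2))"
    proof (rule sum_mono)
      fix i assume "i \<in> {..<m}"
      then have "\<bar>g b i - g a i\<bar> \<le> W" using diff by simp
      then have 1: "(g b i - g a i)\<^sup>2 \<le> W\<^sup>2" using abs_le_square_iff[of "g b i - g a i" W] W by simp
      have "0 \<le> (g b i - g a i)\<^sup>2" by simp
      then have 2: "(g b i + g a i)\<^sup>2 \<le> 2 * (g b i)\<^sup>2 + 2 * (g a i)\<^sup>2"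
        by (simp add: power2_eq_square algebra_simps)
      have "inc p i = (g b i - g a i) * (g b i + g a i)"
        by (simp add: inc_def v a_def b_def power2_eq_square algebra_simps)
      then have "(inc p i)\<^sup>2 = (g b i - g a i)\<^sup>2 * (g b i + g a i)\<^sup>2" by (simp add: power_mult_distrib)
      also have "\<dots> \<le> W\<^sup>2 * (2 * (g b i)\<^sup>2 + 2 * (g a i)\<^sup>2)" by (intro mult_mono 1 2) auto
      finally show "(inc p i)\<^sup>2 \<le> W\<^sup>2 * (2 * (g b i)\<^sup>2 + 2 * (g a i)\<^sup>2)" .
    qed
    also have "\<dots> = W\<^sup>2 * (2 * (\<Sum>i<m. (g b i)\<^sup>2) + 2 * (\<Sum>i<m. (g a i)\<^sup>2))"
      by (simp add: sum_distrib_left[symmetric] sum.distrib)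
    also have "\<dots> \<le> W\<^sup>2 * (2 * (real m * M) + 2 * (real m * M))"
      by (intro mult_left_mono add_mono M ab) auto
    finally have V: "(\<Sum>i<m. (inc p i)\<^sup>2) \<le> 4 * W\<^sup>2 * (real m * M)" by (simp add: mult_ac)
    have Vpos: "4 * W\<^sup>2 * (real m * M) > 0" using W M0 m by simp
    have "real (card (E l p)) \<le> 2 ^ m * (2 * exp (- (real m * \<tau> l * sqrt M)\<^sup>2 / (2 * (4 * W\<^sup>2 * (real m * M)))))"
      unfolding E_def by (rule rademacher_tail[OF V Vpos]) (use \<tau>[of l] M0 in simp)
    also have "- (real m * \<tau> l * sqrt M)\<^sup>2 / (2 * (4 * W\<^sup>2 * (real m * M))) = - real m * (\<tau> l)\<^sup>2 / (8 * W\<^sup>2)"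
      using M0 m W by (simp add: power_mult_distrib field_simps power2_eq_square)
    finally show ?thesis by (simp add: W_def)
  qed
  have "{\<sigma>\<in>signs m. \<exists>v\<in>T. \<bar>\<Sum>i<m. \<sigma> i * (g v i)\<^sup>2\<bar> > real m * \<theta> * sqrt M} \<subseteq> (\<Union>l<L. \<Union>p\<in>pairs l. E l p)"
  proof (rule subsetI, rule ccontr)
    fix \<sigma> assume "\<sigma> \<in> {\<sigma>\<in>signs m. \<exists>v\<in>T. \<bar>\<Sum>i<m. \<sigma> i * (g v i)\<^sup>2\<bar> > real m * \<theta> * sqrt M}"
    then obtain v where \<sigma>: "\<sigma> \<in> signs m" and v: "v \<in> T"
      and big: "\<bar>\<Sum>i<m. \<sigma> i * (g v i)\<^sup>2\<bar> > real m * \<theta> * sqrt M" by auto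
    assume no: "\<sigma> \<notin> (\<Union>l<L. \<Union>p\<in>pairs l. E l p)"
    have small: "\<bar>\<Sum>i<m. \<sigma> i * inc (\<pi> l v, \<pi> (Suc l) v) i\<bar> < real m * \<tau> l * sqrt M" if "l < L" for l
    proof -
      have "(\<pi> l v, \<pi> (Suc l) v) \<in> pairs l" using v by (auto simp: pairs_def)
      then have "\<sigma> \<notin> E l (\<pi> l v, \<pi> (Suc l) v)" using no that by auto
      then show ?thesis using \<sigma> by (auto simp: E_def)
    qed
    have \<sigma>1: "\<bar>\<sigma> i\<bar> = 1" if "i < m" for i
      using \<sigma> that by (force simp: signs_def PiE_def Pi_def)
    define S where "S l = (\<Sum>i<m. \<sigma> i * (g (\<pi> l v) i)\<^sup>2)" for l
    have "S L = (\<Sum>l<L. S (Suc l) - S l)"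
      unfolding sum_lessThan_telescope using start[OF v] by (simp add: S_def)
    also have "\<bar>\<dots>\<bar> \<le> (\<Sum>l<L. \<bar>S (Suc l) - S l\<bar>)" by (rule sum_abs)
    also have "\<dots> \<le> (\<Sum>l<L. real m * \<tau> l * sqrt M)"
    proof (rule sum_mono)
      fix l assume "l \<in> {..<L}"
      then have "l < L" by simp
      have "S (Suc l) - S l = (\<Sum>i<m. \<sigma> i * inc (\<pi> l v, \<pi> (Suc l) v) i)"
        by (simp add: S_def inc_def algebra_simps sum_subtractf)
      then show "\<bar>S (Suc l) - S l\<bar> \<le> real m * \<tau> l * sqrt M" using small[OF \<open>l < L\<close>] by simp
    qed
    also have "\<dots> = real m * (\<Sum>l<L. \<tau> l) * sqrt M" by (simp add: sum_distrib_left sum_distrib_right)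
    finally have SL: "\<bar>S L\<bar> \<le> real m * (\<Sum>l<L. \<tau> l) * sqrt M" .
    define b where "b = \<pi> L v"
    have b: "b \<in> T" using v \<pi>T by (simp add: b_def)
    have "\<bar>(\<Sum>i<m. \<sigma> i * (g v i)\<^sup>2) - S L\<bar> = \<bar>\<Sum>i<m. \<sigma> i * ((g v i)\<^sup>2 - (g b i)\<^sup>2)\<bar>"
      by (simp add: S_def b_def algebra_simps sum_subtractf)
    also have "\<dots> \<le> (\<Sum>i<m. \<bar>\<sigma> i * ((g v i)\<^sup>2 - (g b i)\<^sup>2)\<bar>)" by (rule sum_abs)
    also have "\<dots> \<le> (\<Sum>i<m. \<bar>w L\<bar> * \<bar>g v i\<bar> + \<bar>w L\<bar> * \<bar>g b i\<bar>)"
    proof (rule sum_mono)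
      fix i assume i: "i \<in> {..<m}"
      have "\<bar>\<sigma> i * ((g v i)\<^sup>2 - (g b i)\<^sup>2)\<bar> = \<bar>g v i - g b i\<bar> * \<bar>g v i + g b i\<bar>"
      proof -
        have "(g v i)\<^sup>2 - (g b i)\<^sup>2 = (g v i - g b i) * (g v i + g b i)"
          by (simp add: power2_eq_square algebra_simps)
        then show ?thesis using \<sigma>1 i by (simp add: abs_mult)
      qed
      also have "\<dots> \<le> w L * (\<bar>g v i\<bar> + \<bar>g b i\<bar>)"
        using net[OF v, of i L] i w[of L] by (intro mult_mono) (auto simp: b_def)
      finally show "\<bar>\<sigma> i * ((g v i)\<^sup>2 - (g b i)\<^sup>2)\<bar> \<le> \<bar>w L\<bar> * \<bar>g v i\<bar> + \<bar>w L\<bar> * \<bar>g b i\<bar>"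
        using w[of L] by (simp add: algebra_simps)
    qed
    also have "\<dots> = (\<Sum>i<m. \<bar>w L\<bar> * \<bar>g v i\<bar>) + (\<Sum>i<m. \<bar>w L\<bar> * \<bar>g b i\<bar>)" by (rule sum.distrib)
    also have "\<dots> \<le> sqrt (real m * (w L)\<^sup>2) * sqrt (real m * M) + sqrt (real m * (w L)\<^sup>2) * sqrt (real m * M)"
      by (intro add_mono sum_abs_mult_le_sqrt M v b) auto
    also have "\<dots> = real m * (2 * w L) * sqrt M"
      using w[of L] by (simp add: real_sqrt_mult)
    finally have "\<bar>\<Sum>i<m. \<sigma> i * (g v i)\<^sup>2\<bar> \<le> real m * (\<Sum>l<L. \<tau> l) * sqrt M + real m * (2 * w L) * sqrt M"
      using SL by linarith
    also have "\<dots> = real m * ((\<Sum>l<L. \<tau> l) + 2 * w L) * sqrt M" by (simp add: algebra_simps)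
    also have "\<dots> \<le> real m * \<theta> * sqrt M"
      using \<theta> M0 by (intro mult_right_mono mult_left_mono) auto
    finally show False using big by simp
  qed
  moreover have fE: "finite (E l p)" for l p by (simp add: E_def)
  ultimately have "card {\<sigma>\<in>signs m. \<exists>v\<in>T. \<bar>\<Sum>i<m. \<sigma> i * (g v i)\<^sup>2\<bar> > real m * \<theta> * sqrt M}
      \<le> card (\<Union>l<L. \<Union>p\<in>pairs l. E l p)"
    using fin_pairs by (intro card_mono) auto
  also have "\<dots> \<le> (\<Sum>l<L. card (\<Union>p\<in>pairs l. E l p))" by (rule card_UN_le) simp
  also have "\<dots> \<le> (\<Sum>l<L. \<Sum>p\<in>pairs l. card (E l p))" by (intro sum_mono card_UN_le fin_pairs)
  finally have union: "card {\<sigma>\<in>signs m. \<exists>v\<in>T. \<bar>\<Sum>i<m. \<sigma> i * (g v i)\<^sup>2\<bar> > real m * \<theta> * sqrt M}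
      \<le> (\<Sum>l<L. \<Sum>p\<in>pairs l. card (E l p))" .
  have levels: "(\<Sum>l<L. \<Sum>p\<in>pairs l. real (card (E l p))) \<le> (\<Sum>l<L. 2 ^ m * (c l * c (Suc l) * Q l))"
  proof (rule sum_mono)
    fix l
    have "0 \<le> 2 ^ m * Q l" unfolding Q_def by (intro mult_nonneg_nonneg exp_ge_zero) simp_all
    have "(\<Sum>p\<in>pairs l. real (card (E l p))) \<le> real (card (pairs l)) * (2 ^ m * Q l)"
      unfolding Q_def by (rule sum_bounded_above) (rule tail)
    also have "\<dots> \<le> (c l * c (Suc l)) * (2 ^ m * Q l)"
      by (rule mult_right_mono[OF card_pairs]) fact
    also have "\<dots> = 2 ^ m * (c l * c (Suc l) * Q l)" by (rule mult.left_commute)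
    finally show "(\<Sum>p\<in>pairs l. real (card (E l p))) \<le> 2 ^ m * (c l * c (Suc l) * Q l)" .
  qed
  have "real (\<Sum>l<L. \<Sum>p\<in>pairs l. card (E l p)) \<le> 2 ^ m * (\<Sum>l<L. c l * c (Suc l) * Q l)"
    unfolding sum_distrib_left of_nat_sum by (rule levels)
  with union have "real (card {\<sigma>\<in>signs m. \<exists>v\<in>T. \<bar>\<Sum>i<m. \<sigma> i * (g v i)\<^sup>2\<bar> > real m * \<theta> * sqrt M})
      \<le> 2 ^ m * (\<Sum>l<L. c l * c (Suc l) * Q l)"
    by (meson of_nat_le_iff order_trans)
  then show ?thesis by (simp only: Q_def)
qed

section \<open>Covering by the empirical method\<close>

text \<open>
  On the interval from \<open>a - B\<close> to \<open>a + B\<close> a convex function lies below its chord. The term linear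
  in \<open>y\<close> vanishes on averaging over a centred \<open>y\<close>.
\<close>

lemma cosh_add_le_chord:
  fixes a y B :: real
  assumes "\<bar>y\<bar> \<le> B" "B > 0"
  shows "cosh (a + y) \<le> cosh a * cosh B + y * (sinh a * sinh B / B)"
proof -
  have cv: "convex_on UNIV (cosh :: real \<Rightarrow> real)"
  proof (rule f''_ge0_imp_convex)
    show "(cosh has_real_derivative sinh x) (at x)" "(sinh has_real_derivative cosh x) (at x)" for x :: real
      by (auto intro!: derivative_eq_intros)
  qed (use cosh_real_nonneg in auto)
  define u where "u = (B + y) / (2 * B)"
  have u: "0 \<le> u" "u \<le> 1" using assms by (auto simp: u_def field_simps)
  have "a + y = (1 - u) *\<^sub>R (a - B) + u *\<^sub>R (a + B)"
    using assms by (simp add: u_def field_simps)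
  then have "cosh (a + y) \<le> (1 - u) * cosh (a - B) + u * cosh (a + B)"
    using convex_onD[OF cv, of u "a - B" "a + B"] u by simp
  also have "\<dots> = cosh a * cosh B + (2 * u - 1) * (sinh a * sinh B)"
    by (simp add: cosh_add cosh_diff algebra_simps)
  also have "2 * u - 1 = y / B" using assms by (simp add: u_def field_simps)
  finally show ?thesis by simp
qed

text \<open>
  A deterministic form of Maurey's random selection. If the next atom were drawn with the weights
  \<open>p\<close>, the expected potential would grow by at most the factor \<open>cosh B\<close>; hence some atom does at
  least as well as the average, and the atoms can be chosen one after the other.
\<close>

lemma greedy_cosh_potential:
  fixes y :: "'a \<Rightarrow> nat \<Rightarrow> real" and p :: "'a \<Rightarrow> real"
  assumes fin: "finite A" and p: "\<And>a. a \<in> A \<Longrightarrow> p a \<ge> 0" "(\<Sum>a\<in>A. p a) = 1"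
    and centred: "\<And>i. i < m \<Longrightarrow> (\<Sum>a\<in>A. p a * y a i) = 0"
    and bound: "\<And>a i. a \<in> A \<Longrightarrow> i < m \<Longrightarrow> \<bar>y a i\<bar> \<le> B" and B: "B > 0"
  shows "\<exists>J\<in>{..<k::nat} \<rightarrow>\<^sub>E A. (\<Sum>i<m. cosh (\<Sum>l<k. y (J l) i)) \<le> real m * cosh B ^ k"
proof (induction k)
  case 0
  then show ?case by simp
next
  case (Suc k)
  then obtain J where J: "J \<in> {..<k} \<rightarrow>\<^sub>E A"
    and le: "(\<Sum>i<m. cosh (\<Sum>l<k. y (J l) i)) \<le> real m * cosh B ^ k" by blast
  define S where "S i = (\<Sum>l<k. y (J l) i)" for i
  have "(\<Sum>a\<in>A. p a * (\<Sum>i<m. cosh (S i + y a i))) \<le> (\<Sum>i<m. cosh (S i)) * cosh B"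
  proof -
    have "(\<Sum>a\<in>A. p a * (\<Sum>i<m. cosh (S i + y a i))) = (\<Sum>i<m. \<Sum>a\<in>A. p a * cosh (S i + y a i))"
      unfolding sum_distrib_left by (rule sum.swap)
    also have "\<dots> \<le> (\<Sum>i<m. cosh (S i) * cosh B)"
    proof (rule sum_mono)
      fix i assume "i \<in> {..<m}"
      then have i: "i < m" by simp
      have "(\<Sum>a\<in>A. p a * cosh (S i + y a i))
          \<le> (\<Sum>a\<in>A. p a * (cosh (S i) * cosh B + y a i * (sinh (S i) * sinh B / B)))"
        by (intro sum_mono mult_left_mono cosh_add_le_chord bound p B i)
      also have "\<dots> = (\<Sum>a\<in>A. p a * (cosh (S i) * cosh B) + (p a * y a i) * (sinh (S i) * sinh B / B))"
        by (intro sum.cong refl) (simp only: distrib_left mult.assoc)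
      also have "\<dots> = (\<Sum>a\<in>A. p a) * (cosh (S i) * cosh B) + (\<Sum>a\<in>A. p a * y a i) * (sinh (S i) * sinh B / B)"
        by (simp only: sum.distrib sum_distrib_right)
      finally show "(\<Sum>a\<in>A. p a * cosh (S i + y a i)) \<le> cosh (S i) * cosh B"
        by (simp add: p(2) centred[OF i])
    qed
    finally show ?thesis by (simp add: sum_distrib_right)
  qed
  have "\<exists>a\<in>A. (\<Sum>i<m. cosh (S i + y a i)) \<le> (\<Sum>i<m. cosh (S i)) * cosh B"
  proof (rule ccontr)
    assume "\<not> ?thesis"
    then have gt: "a \<in> A \<Longrightarrow> (\<Sum>i<m. cosh (S i)) * cosh B < (\<Sum>i<m. cosh (S i + y a i))" for a
      by (auto simp: not_le)
    define F where "F a = (\<Sum>i<m. cosh (S i + y a i)) - (\<Sum>i<m. cosh (S i)) * cosh B" for a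
    have "(\<Sum>a\<in>A. p a * F a) = (\<Sum>a\<in>A. p a * (\<Sum>i<m. cosh (S i + y a i))) - (\<Sum>i<m. cosh (S i)) * cosh B"
      by (simp add: F_def right_diff_distrib sum_subtractf sum_distrib_right[symmetric] p(2))
    then have "(\<Sum>a\<in>A. p a * F a) \<le> 0"
      using \<open>(\<Sum>a\<in>A. p a * (\<Sum>i<m. cosh (S i + y a i))) \<le> (\<Sum>i<m. cosh (S i)) * cosh B\<close> by simp
    moreover have nn: "a \<in> A \<Longrightarrow> 0 \<le> p a * F a" for a
      using gt[of a] p(1)[of a] by (simp add: F_def)
    ultimately have "(\<Sum>a\<in>A. p a * F a) = 0" using sum_nonneg[of A "\<lambda>a. p a * F a"] by force
    then have "\<forall>a\<in>A. p a * F a = 0" using nn fin by (subst (asm) sum_nonneg_eq_0_iff) auto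
    then have "\<forall>a\<in>A. p a = 0" using gt by (fastforce simp: F_def)
    then show False using p(2) by simp
  qed
  then obtain a where a: "a \<in> A" and step: "(\<Sum>i<m. cosh (S i + y a i)) \<le> (\<Sum>i<m. cosh (S i)) * cosh B" by blast
  define J' where "J' = J(k := a)"
  have "J' \<in> {..<Suc k} \<rightarrow>\<^sub>E A" using J a
    by (auto simp: J'_def PiE_def Pi_def extensional_def)
  moreover have "(\<Sum>i<m. cosh (\<Sum>l<Suc k. y (J' l) i)) \<le> real m * cosh B ^ Suc k"
  proof -
    have "(\<Sum>l<Suc k. y (J' l) i) = S i + y a i" for i
      by (simp add: J'_def S_def)
    then have "(\<Sum>i<m. cosh (\<Sum>l<Suc k. y (J' l) i)) = (\<Sum>i<m. cosh (S i + y a i))" by simp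
    also note step
    also have "(\<Sum>i<m. cosh (S i)) * cosh B \<le> real m * cosh B ^ k * cosh B"
      using le by (intro mult_right_mono) (auto simp: S_def cosh_real_nonneg)
    finally show ?thesis by (simp add: mult_ac)
  qed
  ultimately show ?case by blast
qed

text \<open>
  The parameter \<open>h = u / B\<^sup>2\<close> minimizes the exponent \<open>h\<^sup>2 * B\<^sup>2 / 2 - h * u\<close>, as in Hoeffding's
  inequality; the logarithm of \<open>2 * m\<close> pays for the \<open>m\<close> coordinates and the two tails.
\<close>

lemma maurey_average:
  fixes y :: "'a \<Rightarrow> nat \<Rightarrow> real" and p :: "'a \<Rightarrow> real"
  assumes fin: "finite A" and p: "\<And>a. a \<in> A \<Longrightarrow> p a \<ge> 0" "(\<Sum>a\<in>A. p a) = 1"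
    and centred: "\<And>i. i < m \<Longrightarrow> (\<Sum>a\<in>A. p a * y a i) = 0"
    and bound: "\<And>a i. a \<in> A \<Longrightarrow> i < m \<Longrightarrow> \<bar>y a i\<bar> \<le> B" and B: "B > 0"
    and u: "u > 0" and m: "m \<ge> 1" and k: "real k \<ge> 2 * B\<^sup>2 * ln (2 * real m) / u\<^sup>2"
  shows "\<exists>J\<in>{..<k::nat} \<rightarrow>\<^sub>E A. \<forall>i<m. \<bar>\<Sum>l<k. y (J l) i\<bar> \<le> real k * u"
proof -
  define h where "h = u / B\<^sup>2"
  have h: "h > 0" using u B by (simp add: h_def)
  obtain J where J: "J \<in> {..<k} \<rightarrow>\<^sub>E A"
    and pot: "(\<Sum>i<m. cosh (\<Sum>l<k. h * y (J l) i)) \<le> real m * cosh (h * B) ^ k"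
  proof -
    have "\<exists>J\<in>{..<k::nat} \<rightarrow>\<^sub>E A. (\<Sum>i<m. cosh (\<Sum>l<k. h * y (J l) i)) \<le> real m * cosh (h * B) ^ k"
    proof (rule greedy_cosh_potential[OF fin p])
      fix i assume i: "i < m"
      have "(\<Sum>a\<in>A. p a * (h * y a i)) = h * (\<Sum>a\<in>A. p a * y a i)"
        by (simp add: sum_distrib_left mult_ac)
      then show "(\<Sum>a\<in>A. p a * (h * y a i)) = 0" using centred[OF i] by simp
    next
      fix a i assume "a \<in> A" "i < m"
      then show "\<bar>h * y a i\<bar> \<le> h * B" using bound h by (simp add: abs_mult)
    qed (use h B in auto)
    then show ?thesis using that by blast
  qed
  have "\<bar>\<Sum>l<k. y (J l) i\<bar> \<le> real k * u" if i: "i < m" for i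
  proof (rule ccontr)
    assume big: "\<not> ?thesis"
    define s where "s = \<bar>\<Sum>l<k. y (J l) i\<bar>"
    have s: "s > real k * u" using big by (simp add: s_def)
    have "exp (h * s) / 2 < cosh (h * s)" by (simp add: cosh_field_def)
    also have "cosh (h * s) = cosh \<bar>\<Sum>l<k. h * y (J l) i\<bar>"
      using h by (simp add: s_def sum_distrib_left[symmetric] abs_mult)
    also have "\<dots> = cosh (\<Sum>l<k. h * y (J l) i)" by simp
    also have "\<dots> \<le> (\<Sum>i<m. cosh (\<Sum>l<k. h * y (J l) i))"
      using i by (intro member_le_sum[of i "{..<m}" "\<lambda>i. cosh (\<Sum>l<k. h * y (J l) i)"]) (auto simp: cosh_real_nonneg)
    also note pot
    also have "real m * cosh (h * B) ^ k \<le> real m * exp ((h * B)\<^sup>2 / 2) ^ k"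
      by (intro mult_left_mono power_mono cosh_le_exp_half_square) (auto simp: cosh_real_nonneg)
    also have "\<dots> = real m * exp (real k * ((h * B)\<^sup>2 / 2))"
      by (simp only: exp_of_nat_mult)
    finally have "exp (h * s) < 2 * real m * exp (real k * ((h * B)\<^sup>2 / 2))" by simp
    also have "2 * real m = exp (ln (2 * real m))" using m by simp
    finally have "h * s < ln (2 * real m) + real k * ((h * B)\<^sup>2 / 2)"
      by (simp only: exp_add[symmetric] exp_less_cancel_iff)
    moreover have "h * (real k * u) \<le> h * s" using s h by simp
    ultimately have "h * (real k * u) < ln (2 * real m) + real k * ((h * B)\<^sup>2 / 2)" by linarith
    moreover have "h * (real k * u) = real k * (u\<^sup>2 / B\<^sup>2)" by (simp add: h_def power2_eq_square)
    moreover have "(h * B)\<^sup>2 = u\<^sup>2 / B\<^sup>2" using B by (simp add: h_def power2_eq_square)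
    ultimately have "real k * (u\<^sup>2 / B\<^sup>2) < ln (2 * real m) + real k * (u\<^sup>2 / B\<^sup>2) / 2"
      by (simp only: times_divide_eq_right)
    moreover have "z < 2 * c" if "z < c + z / 2" for z c :: real using that by simp
    ultimately have "real k * (u\<^sup>2 / B\<^sup>2) < 2 * ln (2 * real m)" by blast
    then have "real k * u\<^sup>2 < 2 * B\<^sup>2 * ln (2 * real m)" using B by (simp add: field_simps)
    moreover have "2 * B\<^sup>2 * ln (2 * real m) \<le> real k * u\<^sup>2" using k u by (simp add: field_simps)
    ultimately show False by simp
  qed
  then show ?thesis using J by blast
qed

definition lin :: "nat \<Rightarrow> (nat \<Rightarrow> real) \<Rightarrow> (nat \<Rightarrow> real) \<Rightarrow> real" where
  "lin N x v = (\<Sum>j<N. x j * v j)"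

lemma abs_lin_le:
  assumes "\<And>j. j < N \<Longrightarrow> \<bar>x j\<bar> \<le> K" "(\<Sum>j<N. \<bar>v j\<bar>) \<le> b" "K \<ge> 0"
  shows "\<bar>lin N x v\<bar> \<le> b * K"
proof -
  have "\<bar>lin N x v\<bar> \<le> (\<Sum>j<N. \<bar>x j * v j\<bar>)" unfolding lin_def by (rule sum_abs)
  also have "\<dots> \<le> (\<Sum>j<N. K * \<bar>v j\<bar>)"
    using assms(1) by (intro sum_mono) (auto simp: abs_mult intro!: mult_right_mono)
  also have "\<dots> = K * (\<Sum>j<N. \<bar>v j\<bar>)" by (simp add: sum_distrib_left)
  also have "\<dots> \<le> K * b" by (intro mult_left_mono assms)
  finally show ?thesis by (simp add: mult.commute)
qed

text \<open>
  A vector of the \<open>l1\<close> ball of radius \<open>b\<close> is an average of the vertices \<open>\<plusminus>b\<close> times a unit vector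
  and of \<open>0\<close>. An average of \<open>k\<close> of them already approximates it on all \<open>m\<close> functionals, and there
  are only \<open>(3 * N) ^ k\<close> such averages.
\<close>

lemma l1_ball_maurey:
  fixes x :: "nat \<Rightarrow> nat \<Rightarrow> real"
  assumes x: "\<And>i j. i < m \<Longrightarrow> j < N \<Longrightarrow> \<bar>x i j\<bar> \<le> K" and K: "K > 0" and b: "b > 0" and N: "N \<ge> 1"
    and v: "(\<Sum>j<N. \<bar>v j\<bar>) \<le> b"
    and u: "u > 0" and m: "m \<ge> 1" and k: "real k \<ge> 8 * (b * K)\<^sup>2 * ln (2 * real m) / u\<^sup>2" "k \<ge> 1"
  shows "\<exists>J\<in>{..<k} \<rightarrow>\<^sub>E ({..<N} \<times> {-1, 0, 1}).
           \<forall>i<m. \<bar>lin N (x i) v - (b / real k) * (\<Sum>l<k. snd (J l) * x i (fst (J l)))\<bar> \<le> u"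
proof -
  define A where "A = {..<N} \<times> {-1, 0, 1::real}"
  define W where "W = (\<Sum>j<N. \<bar>v j\<bar>)"
  \<comment> \<open>The weights select each signed coordinate in proportion to its share of the l1 norm.\<close>
  define p where "p a = (if snd a = 0 then (if fst a = 0 then 1 - W / b else 0)
      else (if sgn (v (fst a)) = snd a then \<bar>v (fst a)\<bar> / b else 0))" for a :: "nat \<times> real"
  have sumA: "(\<Sum>a\<in>A. p a * f a) = (1 - W / b) * f (0, 0) + (\<Sum>j<N. \<bar>v j\<bar> / b * f (j, sgn (v j)))" for f
  proof -
    have "(\<Sum>a\<in>A. p a * f a) = (\<Sum>j<N. \<Sum>t\<in>{-1,0,1}. p (j,t) * f (j,t))"
      unfolding A_def by (simp only: sum.cartesian_product case_prod_eta) (simp add: case_prod_beta)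
    also have "\<dots> = (\<Sum>j<N. (if j = 0 then (1 - W / b) * f (j, 0) else 0) + \<bar>v j\<bar> / b * f (j, sgn (v j)))"
      by (intro sum.cong refl) (auto simp: p_def sgn_if)
    also have "\<dots> = (1 - W / b) * f (0, 0) + (\<Sum>j<N. \<bar>v j\<bar> / b * f (j, sgn (v j)))"
      using N by (simp add: sum.distrib sum.delta)
    finally show ?thesis .
  qed
  define y where "y a i = lin N (x i) v - b * (snd a * x i (fst a))" for a :: "nat \<times> real" and i
  have W: "W \<le> b" using v by (simp add: W_def)
  have tot: "(\<Sum>a\<in>A. p a) = 1"
  proof -
    have "(\<Sum>a\<in>A. p a) = (1 - W / b) + (\<Sum>j<N. \<bar>v j\<bar> / b)" using sumA[of "\<lambda>_. 1"] by simp
    also have "(\<Sum>j<N. \<bar>v j\<bar> / b) = W / b" by (simp add: W_def sum_divide_distrib)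
    finally show ?thesis by simp
  qed
  have "\<exists>J\<in>{..<k} \<rightarrow>\<^sub>E A. \<forall>i<m. \<bar>\<Sum>l<k. y (J l) i\<bar> \<le> real k * u"
  proof (rule maurey_average[OF _ _ tot, where B = "2 * (b * K)"])
    show "finite A" by (simp add: A_def)
    show "p a \<ge> 0" for a using W b by (auto simp: p_def)
    show "(\<Sum>a\<in>A. p a * y a i) = 0" for i
    proof -
      have "(\<Sum>a\<in>A. p a * (b * (snd a * x i (fst a)))) = (\<Sum>j<N. \<bar>v j\<bar> / b * (b * (sgn (v j) * x i j)))"
        unfolding sumA by simp
      also have "\<dots> = lin N (x i) v"
        unfolding lin_def using b by (intro sum.cong refl) (simp add: sgn_if)
      finally show ?thesis
        by (simp add: y_def right_diff_distrib sum_subtractf sum_distrib_right[symmetric] tot)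
    qed
    show "\<bar>y a i\<bar> \<le> 2 * (b * K)" if "a \<in> A" "i < m" for a i
    proof -
      have "\<bar>lin N (x i) v\<bar> \<le> b * K" using that x v K by (intro abs_lin_le) auto
      moreover have "\<bar>b * (snd a * x i (fst a))\<bar> \<le> b * K"
      proof -
        have "\<bar>snd a\<bar> * \<bar>x i (fst a)\<bar> \<le> 1 * K"
          using that x K by (intro mult_mono) (auto simp: A_def)
        then show ?thesis using b by (simp add: abs_mult)
      qed
      ultimately show ?thesis unfolding y_def by linarith
    qed
    show "2 * (2 * (b * K))\<^sup>2 * ln (2 * real m) / u\<^sup>2 \<le> real k"
      using k(1) by (simp add: power_mult_distrib)
  qed (use b K u m in auto)
  then obtain J where J: "J \<in> {..<k} \<rightarrow>\<^sub>E A" and app: "\<And>i. i < m \<Longrightarrow> \<bar>\<Sum>l<k. y (J l) i\<bar> \<le> real k * u" by blast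
  have "\<bar>lin N (x i) v - (b / real k) * (\<Sum>l<k. snd (J l) * x i (fst (J l)))\<bar> \<le> u" if "i < m" for i
  proof -
    have "(\<Sum>l<k. y (J l) i) = real k * (lin N (x i) v - (b / real k) * (\<Sum>l<k. snd (J l) * x i (fst (J l))))"
      using k(2) by (simp add: y_def sum_subtractf sum_distrib_left[symmetric] right_diff_distrib)
    then have "real k * \<bar>lin N (x i) v - (b / real k) * (\<Sum>l<k. snd (J l) * x i (fst (J l)))\<bar> \<le> real k * u"
      using app[OF that] by (simp add: abs_mult)
    then show ?thesis using k(2) by simp
  qed
  then show ?thesis using J unfolding A_def by blast
qed

text \<open>
  The averages of vertices need not belong to \<open>T\<close>. Each average that is close to some point of \<open>T\<close>
  is replaced by one such point, which costs a factor 2 in the distance.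
\<close>

lemma l1_ball_net:
  fixes x :: "nat \<Rightarrow> nat \<Rightarrow> real" and T :: "(nat \<Rightarrow> real) set"
  assumes x: "\<And>i j. i < m \<Longrightarrow> j < N \<Longrightarrow> \<bar>x i j\<bar> \<le> K" and K: "K > 0" and b: "b > 0" and N: "N \<ge> 1"
    and T: "\<And>v. v \<in> T \<Longrightarrow> (\<Sum>j<N. \<bar>v j\<bar>) \<le> b"
    and u: "u > 0" and m: "m \<ge> 1" and k: "real k \<ge> 8 * (b * K)\<^sup>2 * ln (2 * real m) / u\<^sup>2" "k \<ge> 1"
  shows "\<exists>\<pi>. (\<forall>v\<in>T. \<pi> v \<in> T) \<and> finite (\<pi> ` T) \<and> card (\<pi> ` T) \<le> (3 * N) ^ k \<and>
            (\<forall>v\<in>T. \<forall>i<m. \<bar>lin N (x i) v - lin N (x i) (\<pi> v)\<bar> \<le> 2 * u)"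
proof -
  define JJ where "JJ = {..<k} \<rightarrow>\<^sub>E ({..<N} \<times> {-1, 0, 1::real})"
  define near where "near v J \<longleftrightarrow> (\<forall>i<m. \<bar>lin N (x i) v - (b / real k) * (\<Sum>l<k. snd (J l) * x i (fst (J l)))\<bar> \<le> u)"
    for v and J :: "nat \<Rightarrow> nat \<times> real"
  have "\<forall>v\<in>T. \<exists>J\<in>JJ. near v J"
    unfolding JJ_def near_def by (intro ballI l1_ball_maurey[where K = K] x K b N T u m k)
  then obtain c where c: "\<And>v. v \<in> T \<Longrightarrow> c v \<in> JJ" "\<And>v. v \<in> T \<Longrightarrow> near v (c v)" by metis
  define \<pi> where "\<pi> v = inv_into T c (c v)" for v
  have \<pi>: "\<pi> v \<in> T" "c (\<pi> v) = c v" if "v \<in> T" for v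
    using that by (auto simp: \<pi>_def inv_into_into f_inv_into_f)
  have fin: "finite JJ" by (auto simp: JJ_def intro!: finite_PiE)
  have cJ: "c ` T \<subseteq> JJ" using c by auto
  have im: "\<pi> ` T = inv_into T c ` (c ` T)" by (auto simp: \<pi>_def image_image)
  have "card (\<pi> ` T) \<le> card (c ` T)"
    unfolding im using finite_subset[OF cJ fin] by (rule card_image_le)
  also have "\<dots> \<le> card JJ" by (rule card_mono[OF fin cJ])
  also have "card JJ = (3 * N) ^ k"
  proof -
    have "card ({..<N} \<times> {-1, 0, 1::real}) = 3 * N" by (simp add: card_cartesian_product)
    then show ?thesis by (simp only: JJ_def card_PiE[OF finite_lessThan] prod_constant card_lessThan)
  qed
  finally have "card (\<pi> ` T) \<le> (3 * N) ^ k" .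
  moreover have "finite (\<pi> ` T)" unfolding im using finite_subset[OF cJ fin] by blast
  moreover have "\<bar>lin N (x i) v - lin N (x i) (\<pi> v)\<bar> \<le> 2 * u" if "v \<in> T" "i < m" for v i
  proof -
    have "near v (c v)" "near (\<pi> v) (c v)" using c \<pi> that by metis+
    then show ?thesis using that(2) unfolding near_def by fastforce
  qed
  ultimately show ?thesis using \<pi>(1) by blast
qed

text \<open>
  Level \<open>l\<close> uses the scale \<open>b * K / 2 ^ l\<close>, at which a net has about
  \<open>exp (8 * 4 ^ l * ln (2 * m) * ln (3 * N))\<close> points, and level 0 is the single point 0. The
  deviation allowed at level \<open>l\<close> has two summands, up to constant factors. The share \<open>\<theta> / L\<close> gives
  an exponent growing like \<open>4 ^ l / L\<^sup>2\<close>, which outweighs the size of the net at every level. The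
  share \<open>\<theta> / 2 ^ l\<close> gives the exponent \<open>Q\<close>, free of \<open>L\<close>; without it the bound for the coarsest
  levels would only be of the order \<open>exp (- Q / L\<^sup>2)\<close>.
\<close>

lemma rademacher_l1_class:
  fixes x :: "nat \<Rightarrow> nat \<Rightarrow> real" and T :: "(nat \<Rightarrow> real) set"
  assumes x: "\<And>i j. i < m \<Longrightarrow> j < N \<Longrightarrow> \<bar>x i j\<bar> \<le> K" and K: "K > 0" and b: "b > 0" and N: "N \<ge> 1" and m: "m \<ge> 1"
    and T: "\<And>v. v \<in> T \<Longrightarrow> (\<Sum>j<N. \<bar>v j\<bar>) \<le> b" and T0: "(\<lambda>_. 0) \<in> T"
    and M: "\<And>v. v \<in> T \<Longrightarrow> (\<Sum>i<m. (lin N (x i) v)\<^sup>2) \<le> real m * M" and M0: "M > 0"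
    and \<theta>: "\<theta> > 0" and L: "L \<ge> 1" "8 * (b * K) / \<theta> \<le> 2 ^ L"
    and Q: "Q = real m * \<theta>\<^sup>2 / (4608 * (b * K)\<^sup>2)"
    and entropy: "20 * ln (2 * real m) * ln (3 * real N) \<le> Q / (real L)\<^sup>2"
  shows "real (card {\<sigma>\<in>signs m. \<exists>v\<in>T. \<bar>\<Sum>i<m. \<sigma> i * (lin N (x i) v)\<^sup>2\<bar> > real m * \<theta> * sqrt M})
     \<le> 2 ^ m * (2 * real L * exp (- Q))"
proof -
  define u where "u l = b * K / 2 ^ l" for l :: nat
  have u: "u l > 0" for l using b K by (simp add: u_def)
  have lnm: "ln (2 * real m) \<ge> 1 / 2"
  proof -
    have "ln 2 \<le> ln (2 * real m)" using m by simp
    then show ?thesis using ln2_ge_two_thirds by linarith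
  qed
  have lnN: "ln (3 * real N) \<ge> 0" using N by (intro ln_ge_zero) simp
  define k where "k l = nat \<lceil>8 * 4 ^ l * ln (2 * real m)\<rceil>" for l :: nat
  have k_lower: "real (k l) \<ge> 8 * 4 ^ l * ln (2 * real m)" for l
    unfolding k_def by (rule real_nat_ceiling_ge)
  have k_big: "8 * 4 ^ l * ln (2 * real m) \<ge> 1" for l
  proof -
    have "1 * 1 \<le> (4::real) ^ l * (8 * ln (2 * real m))" using lnm by (intro mult_mono) auto
    then show ?thesis by simp
  qed
  have k1: "k l \<ge> 1" for l using k_lower[of l] k_big[of l] by linarith
  have k_upper: "real (k l) \<le> 16 * 4 ^ l * ln (2 * real m)" for l
  proof -
    have "real (k l) \<le> 8 * 4 ^ l * ln (2 * real m) + 1" using k_big[of l] unfolding k_def by linarith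
    then show ?thesis using k_big[of l] by linarith
  qed
  have "\<exists>\<pi>. (\<forall>v\<in>T. \<pi> v \<in> T) \<and> finite (\<pi> ` T) \<and> card (\<pi> ` T) \<le> (3 * N) ^ k l \<and>
            (\<forall>v\<in>T. \<forall>i<m. \<bar>lin N (x i) v - lin N (x i) (\<pi> v)\<bar> \<le> 2 * u l)" for l
  proof (rule l1_ball_net[OF _ K b N _ u m _ k1])
    show "\<bar>x i j\<bar> \<le> K" if "i < m" "j < N" for i j using that by (rule x)
    show "(\<Sum>j<N. \<bar>v j\<bar>) \<le> b" if "v \<in> T" for v using that by (rule T)
    have "8 * (b * K)\<^sup>2 * ln (2 * real m) / (u l)\<^sup>2 = 8 * 4 ^ l * ln (2 * real m)"
    proof -
      have "(4::real) ^ l = (2 ^ l)\<^sup>2" by (simp add: power2_eq_square flip: power_mult_distrib)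
      then show ?thesis using b K by (simp add: u_def power_divide)
    qed
    then show "8 * (b * K)\<^sup>2 * ln (2 * real m) / (u l)\<^sup>2 \<le> real (k l)" using k_lower[of l] by simp
  qed
  then have "\<exists>\<pi>. \<forall>l. (\<forall>v\<in>T. \<pi> l v \<in> T) \<and> finite (\<pi> l ` T) \<and> card (\<pi> l ` T) \<le> (3 * N) ^ k l \<and>
            (\<forall>v\<in>T. \<forall>i<m. \<bar>lin N (x i) v - lin N (x i) (\<pi> l v)\<bar> \<le> 2 * u l)"
    by (intro choice allI)
  then obtain \<pi>' where \<pi>': "\<And>l v. v \<in> T \<Longrightarrow> \<pi>' l v \<in> T" "\<And>l. finite (\<pi>' l ` T)" "\<And>l. card (\<pi>' l ` T) \<le> (3 * N) ^ k l"
     "\<And>l v i. v \<in> T \<Longrightarrow> i < m \<Longrightarrow> \<bar>lin N (x i) v - lin N (x i) (\<pi>' l v)\<bar> \<le> 2 * u l"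
    by blast
  define \<pi> where "\<pi> l = (if l = 0 then (\<lambda>_ _. 0) else \<pi>' l)" for l :: nat
  define c where "c l = (3 * real N) ^ k l" for l
  define w where "w l = 2 * u l" for l
  define \<tau> where "\<tau> l = \<theta> / 4 * (1 / real L + 1 / 2 ^ Suc l)" for l :: nat
  have lin0: "lin N y (\<lambda>_. 0) = 0" for y by (simp add: lin_def)
  have card_bound: "real (card {\<sigma>\<in>signs m. \<exists>v\<in>T. \<bar>\<Sum>i<m. \<sigma> i * (lin N (x i) v)\<^sup>2\<bar> > real m * \<theta> * sqrt M})
     \<le> 2 ^ m * (\<Sum>l<L. c l * c (Suc l) * (2 * exp (- real m * (\<tau> l)\<^sup>2 / (8 * (w l + w (Suc l))\<^sup>2))))"
  proof (rule chaining[where \<pi> = \<pi>, OF _ M0 m])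
    show "(\<Sum>i<m. (lin N (x i) v)\<^sup>2) \<le> real m * M" if "v \<in> T" for v using that by (rule M)
    show "\<pi> l v \<in> T" if "v \<in> T" for l v using that \<pi>'(1) T0 by (simp add: \<pi>_def)
    show "finite (\<pi> l ` T)" for l using \<pi>'(2) by (cases "l = 0") (auto simp: \<pi>_def image_constant_conv)
    show "real (card (\<pi> l ` T)) \<le> c l" for l
    proof (cases "l = 0")
      case True
      have "real (card (\<pi> l ` T)) \<le> 1" using True by (simp add: \<pi>_def image_constant_conv)
      also have "1 \<le> c l" unfolding c_def using N by (intro one_le_power) simp
      finally show ?thesis .
    next
      case False
      then have "real (card (\<pi> l ` T)) \<le> real ((3 * N) ^ k l)"
        using \<pi>'(3) unfolding \<pi>_def of_nat_le_iff by simp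
      then show ?thesis by (simp add: c_def)
    qed
    show "\<bar>lin N (x i) v - lin N (x i) (\<pi> l v)\<bar> \<le> w l" if "v \<in> T" "i < m" for l v i
    proof (cases "l = 0")
      case True
      have "\<bar>lin N (x i) v\<bar> \<le> b * K" using that x T K by (intro abs_lin_le) auto
      then show ?thesis using True b K by (simp add: \<pi>_def lin0 w_def u_def)
    next
      case False
      then show ?thesis using \<pi>'(4) that by (simp add: \<pi>_def w_def)
    qed
    show "w l > 0" for l using u by (simp add: w_def)
    show "\<tau> l \<ge> 0" for l using \<theta> by (simp add: \<tau>_def)
    show "lin N (x i) (\<pi> 0 v) = 0" for v i by (simp add: \<pi>_def lin0)
    show "(\<Sum>l<L. \<tau> l) + 2 * w L \<le> \<theta>"
    proof -
      have geo: "(\<Sum>l<L. 1 / 2 ^ Suc l) \<le> (1::real)" for L :: nat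
      proof -
        have "(\<Sum>l<L. 1 / 2 ^ Suc l) = 1 - 1 / (2::real) ^ L"
          by (induction L) (simp_all add: field_simps)
        then show ?thesis by simp
      qed
      have "(\<Sum>l<L. \<tau> l) = \<theta> / 4 * (1 + (\<Sum>l<L. 1 / 2 ^ Suc l))"
        using L(1) unfolding \<tau>_def sum_distrib_left[symmetric] sum.distrib by simp
      also have "\<dots> \<le> \<theta> / 4 * (1 + 1)" using geo[of L] \<theta> by (intro mult_left_mono add_left_mono) auto
      finally have "(\<Sum>l<L. \<tau> l) \<le> \<theta> / 2" by simp
      moreover have "2 * w L \<le> \<theta> / 2"
        using L(2) \<theta> by (simp add: w_def u_def field_simps)
      ultimately show ?thesis by simp
    qed
  qed
  have term_le: "c l * c (Suc l) * (2 * exp (- real m * (\<tau> l)\<^sup>2 / (8 * (w l + w (Suc l))\<^sup>2))) \<le> 2 * exp (- Q)" for l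
  proof -
    have N3: "3 * real N > 0" using N by simp
    have c_exp: "c l = exp (real (k l) * ln (3 * real N))" for l
      using N3 by (simp add: c_def exp_of_nat_mult)
    have four: "(4::real) ^ l = (2 ^ l)\<^sup>2" by (simp add: power2_eq_square flip: power_mult_distrib)
    have "(real (k l) + real (k (Suc l))) * ln (3 * real N) \<le> (80 * 4 ^ l * ln (2 * real m)) * ln (3 * real N)"
      using k_upper[of l] k_upper[of "Suc l"] lnN by (intro mult_right_mono) auto
    also have "\<dots> = 4 * 4 ^ l * (20 * ln (2 * real m) * ln (3 * real N))" by simp
    also have "\<dots> \<le> 4 * 4 ^ l * (Q / (real L)\<^sup>2)" by (intro mult_left_mono entropy) auto
    finally have ent: "(real (k l) + real (k (Suc l))) * ln (3 * real N) \<le> 4 * 4 ^ l * (Q / (real L)\<^sup>2)" .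
    have "w l + w (Suc l) = 3 * (b * K) / 2 ^ l" by (simp add: w_def u_def)
    then have ww: "8 * (w l + w (Suc l))\<^sup>2 = 72 * (b * K)\<^sup>2 / 4 ^ l"
      by (simp add: four power_divide power_mult_distrib)
    have "(\<tau> l)\<^sup>2 \<ge> (\<theta> / 4)\<^sup>2 * ((1 / real L)\<^sup>2 + (1 / 2 ^ Suc l)\<^sup>2)"
    proof -
      have sq: "a\<^sup>2 + d\<^sup>2 \<le> (a + d)\<^sup>2" if "a \<ge> 0" "d \<ge> 0" for a d :: real
        using that by (simp add: power2_sum)
      show ?thesis unfolding \<tau>_def power_mult_distrib
        by (rule mult_left_mono, rule sq) auto
    qed
    also have "(\<theta> / 4)\<^sup>2 * ((1 / real L)\<^sup>2 + (1 / 2 ^ Suc l)\<^sup>2) = \<theta>\<^sup>2 / 16 * (1 / (real L)\<^sup>2 + 1 / (4 * 4 ^ l))"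
      by (simp add: four power_divide power_mult_distrib)
    finally have tau: "\<theta>\<^sup>2 / 16 * (1 / (real L)\<^sup>2 + 1 / (4 * 4 ^ l)) \<le> (\<tau> l)\<^sup>2" .
    have bK: "b * K \<noteq> 0" using b K by simp
    have "4 * 4 ^ l * (Q / (real L)\<^sup>2) + Q
        = real m * (\<theta>\<^sup>2 / 16 * (1 / (real L)\<^sup>2 + 1 / (4 * 4 ^ l))) / (72 * (b * K)\<^sup>2 / 4 ^ l)"
    proof -
      have "4 * g * (a / (4608 * C) / e) + a / (4608 * C) = s * (t / 16 * (1 / e + 1 / (4 * g))) / (72 * C / g)"
        if "a = s * t" "g > 0" "C > 0" "e > 0" for a s t g C e :: real
        using that(2-4) unfolding that(1) by (simp add: divide_simps) (simp add: algebra_simps)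
      from this[of "real m * \<theta>\<^sup>2" "real m" "\<theta>\<^sup>2" "4 ^ l" "(b * K)\<^sup>2" "(real L)\<^sup>2"]
      show ?thesis unfolding Q using bK L(1) by simp
    qed
    also have "\<dots> \<le> real m * (\<tau> l)\<^sup>2 / (72 * (b * K)\<^sup>2 / 4 ^ l)"
      by (intro divide_right_mono mult_left_mono tau) auto
    finally have expo: "4 * 4 ^ l * (Q / (real L)\<^sup>2) + Q \<le> real m * (\<tau> l)\<^sup>2 / (8 * (w l + w (Suc l))\<^sup>2)"
      by (simp only: ww)
    have "c l * c (Suc l) * (2 * exp (- real m * (\<tau> l)\<^sup>2 / (8 * (w l + w (Suc l))\<^sup>2)))
       = 2 * exp ((real (k l) + real (k (Suc l))) * ln (3 * real N) - real m * (\<tau> l)\<^sup>2 / (8 * (w l + w (Suc l))\<^sup>2))"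
    proof -
      have "exp p * exp q * (2 * exp (- a * t / z)) = 2 * exp (p + q - a * t / z)" for p q a t z :: real
      proof -
        have "p + q - a * t / z = p + q + (- a * t / z)" by simp
        then show ?thesis by (simp only: exp_add)
      qed
      then show ?thesis unfolding c_exp distrib_right .
    qed
    also have "\<dots> \<le> 2 * exp (- Q)"
    proof -
      have "2 * exp p \<le> 2 * exp q" if "p \<le> q" for p q :: real using that by simp
      then show ?thesis by this (use ent expo in linarith)
    qed
    finally show ?thesis .
  qed
  have "(\<Sum>l<L. c l * c (Suc l) * (2 * exp (- real m * (\<tau> l)\<^sup>2 / (8 * (w l + w (Suc l))\<^sup>2)))) \<le> (\<Sum>l<L. 2 * exp (- Q))"
    by (rule sum_mono) (rule term_le)
  also have "\<dots> = 2 * real L * exp (- Q)" by simp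
  finally show ?thesis
    by (intro order_trans[OF card_bound] mult_left_mono) auto
qed

section \<open>Symmetrization\<close>

text \<open>
  Distinct coordinates of a uniform point of a finite power are independent, so the mixed second
  moments of a centred function vanish.
\<close>

lemma sum_PiE_mult_coords:
  fixes g :: "'a \<Rightarrow> real"
  assumes G: "finite G" and ij: "i < m" "j < m" and g: "(\<Sum>q\<in>G. g q) = 0"
  shows "(\<Sum>\<tau>\<in>{..<m} \<rightarrow>\<^sub>E G. g (\<tau> i) * g (\<tau> j)) =
     (if i = j then real (card G) ^ (m - 1) * (\<Sum>q\<in>G. (g q)\<^sup>2) else 0)"
proof -
  define h where "h l q = (if l = i then g q else 1) * (if l = j then g q else 1)" for l :: nat and q
  have "(\<Sum>\<tau>\<in>{..<m} \<rightarrow>\<^sub>E G. g (\<tau> i) * g (\<tau> j)) = (\<Sum>\<tau>\<in>{..<m} \<rightarrow>\<^sub>E G. \<Prod>l<m. h l (\<tau> l))"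
    using ij by (intro sum.cong refl) (simp add: h_def prod.distrib prod.delta)
  also have "\<dots> = (\<Prod>l<m. \<Sum>q\<in>G. h l q)"
    by (rule prod_sum_PiE[symmetric]) (auto simp: G)
  also have "\<dots> = (\<Sum>q\<in>G. h i q) * (\<Prod>l\<in>{..<m} - {i}. \<Sum>q\<in>G. h l q)"
    using ij by (intro prod.remove) auto
  also have "\<dots> = (if i = j then real (card G) ^ (m - 1) * (\<Sum>q\<in>G. (g q)\<^sup>2) else 0)"
  proof (cases "i = j")
    case True
    have "(\<Prod>l\<in>{..<m} - {i}. \<Sum>q\<in>G. h l q) = (\<Prod>l\<in>{..<m} - {i}. real (card G))"
      by (intro prod.cong refl) (simp add: h_def True[symmetric])
    also have "\<dots> = real (card G) ^ (m - 1)" using ij by simp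
    finally show ?thesis using True by (simp add: h_def power2_eq_square)
  next
    case False
    then have "(\<Sum>q\<in>G. h i q) = 0" using g by (simp add: h_def)
    then show ?thesis using False by simp
  qed
  finally show ?thesis .
qed

text \<open>
  The variance of \<open>f\<close> is at most its second moment, hence at most \<open>H\<close> times its mean.
\<close>

lemma chebyshev_empirical_mean:
  fixes f :: "'a \<Rightarrow> real" and m :: nat and H \<mu> t :: real
  assumes G: "finite G" "G \<noteq> {}" and f: "\<And>q. q \<in> G \<Longrightarrow> 0 \<le> f q" "\<And>q. q \<in> G \<Longrightarrow> f q \<le> H"
    and \<mu>: "\<mu> = (\<Sum>q\<in>G. f q) / card G" "\<mu> \<le> 1" and t: "t > 0" and m: "m \<ge> 1"
  shows "real (card {\<tau>\<in>{..<m} \<rightarrow>\<^sub>E G. \<bar>(\<Sum>i<m. f (\<tau> i)) / m - \<mu>\<bar> > t}) \<le> H / (m * t\<^sup>2) * card ({..<m} \<rightarrow>\<^sub>E G)"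
proof -
  define \<Omega> where "\<Omega> = {..<m} \<rightarrow>\<^sub>E G"
  define g where "g q = f q - \<mu>" for q
  define Z where "Z = {\<tau>\<in>\<Omega>. \<bar>(\<Sum>i<m. f (\<tau> i)) / m - \<mu>\<bar> > t}"
  have cG: "real (card G) > 0" using G by (simp add: card_gt_0_iff)
  have fin: "finite \<Omega>" unfolding \<Omega>_def using G by (intro finite_PiE) auto
  have g0: "(\<Sum>q\<in>G. g q) = 0" using cG by (simp add: g_def sum_subtractf \<mu>)
  have H: "H \<ge> 0" using f G by fastforce
  have g2: "(\<Sum>q\<in>G. (g q)\<^sup>2) \<le> H * real (card G)"
  proof -
    have sq: "(g q)\<^sup>2 = (f q)\<^sup>2 - (2 * \<mu>) * f q + \<mu>\<^sup>2" for q by (simp add: g_def power2_diff)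
    have "(\<Sum>q\<in>G. (g q)\<^sup>2) = (\<Sum>q\<in>G. (f q)\<^sup>2) - 2 * \<mu> * (\<Sum>q\<in>G. f q) + \<mu>\<^sup>2 * real (card G)"
      unfolding sq sum.distrib sum_subtractf sum_distrib_left[symmetric] by simp
    also have "(\<Sum>q\<in>G. f q) = \<mu> * real (card G)" using cG \<mu> by simp
    finally have "(\<Sum>q\<in>G. (g q)\<^sup>2) = (\<Sum>q\<in>G. (f q)\<^sup>2) - \<mu>\<^sup>2 * real (card G)"
      by (simp add: power2_eq_square algebra_simps)
    also have "\<dots> \<le> (\<Sum>q\<in>G. (f q)\<^sup>2)" by simp
    also have "\<dots> \<le> (\<Sum>q\<in>G. H * f q)"
      unfolding power2_eq_square by (intro sum_mono mult_right_mono f)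
    also have "\<dots> = H * (\<mu> * real (card G))" using cG by (simp add: \<mu> sum_distrib_left)
    also have "\<dots> \<le> H * (1 * real (card G))"
      using H \<mu>(2) by (intro mult_left_mono mult_right_mono) auto
    finally show ?thesis by simp
  qed
  have dev: "(\<Sum>i<m. f (\<tau> i)) / m - \<mu> = (\<Sum>i<m. g (\<tau> i)) / m" for \<tau>
    using m by (simp add: g_def sum_subtractf field_simps)
  have "real (card Z) * t\<^sup>2 = (\<Sum>\<tau>\<in>Z. t\<^sup>2)" by simp
  also have "\<dots> \<le> (\<Sum>\<tau>\<in>Z. ((\<Sum>i<m. g (\<tau> i)) / m)\<^sup>2)"
  proof (rule sum_mono)
    fix \<tau> assume "\<tau> \<in> Z"
    then have "t \<le> \<bar>(\<Sum>i<m. g (\<tau> i)) / m\<bar>" by (simp add: Z_def dev)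
    then have "t\<^sup>2 \<le> \<bar>(\<Sum>i<m. g (\<tau> i)) / m\<bar>\<^sup>2" using t by (intro power_mono) auto
    then show "t\<^sup>2 \<le> ((\<Sum>i<m. g (\<tau> i)) / m)\<^sup>2" by (simp only: power2_abs)
  qed
  also have "\<dots> \<le> (\<Sum>\<tau>\<in>\<Omega>. ((\<Sum>i<m. g (\<tau> i)) / m)\<^sup>2)"
    by (rule sum_mono2[OF fin]) (auto simp: Z_def)
  also have "\<dots> = (\<Sum>\<tau>\<in>\<Omega>. \<Sum>i<m. \<Sum>j<m. g (\<tau> i) * g (\<tau> j)) / m\<^sup>2"
    by (simp add: power_divide power2_eq_square sum_product sum_divide_distrib)
  also have "(\<Sum>\<tau>\<in>\<Omega>. \<Sum>i<m. \<Sum>j<m. g (\<tau> i) * g (\<tau> j)) = (\<Sum>i<m. \<Sum>j<m. \<Sum>\<tau>\<in>\<Omega>. g (\<tau> i) * g (\<tau> j))"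
    by (subst sum.swap, intro sum.cong refl, rule sum.swap)
  also have "\<dots> = (\<Sum>i<m. \<Sum>j<m. if i = j then real (card G) ^ (m - 1) * (\<Sum>q\<in>G. (g q)\<^sup>2) else 0)"
    unfolding \<Omega>_def by (intro sum.cong refl sum_PiE_mult_coords G g0) auto
  also have "\<dots> = real m * (real (card G) ^ (m - 1) * (\<Sum>q\<in>G. (g q)\<^sup>2))"
    by (simp add: sum.delta)
  also have "real m * (real (card G) ^ (m - 1) * (\<Sum>q\<in>G. (g q)\<^sup>2)) / m\<^sup>2 = real (card G) ^ (m - 1) * (\<Sum>q\<in>G. (g q)\<^sup>2) / m"
    using m by (simp add: power2_eq_square)
  also have "\<dots> \<le> real (card G) ^ (m - 1) * (H * real (card G)) / m"
    by (intro divide_right_mono mult_left_mono g2) auto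
  also have "\<dots> = H / m * real (card \<Omega>)"
    using m by (cases m) (simp_all add: \<Omega>_def card_PiE)
  finally have "real (card Z) \<le> H / m * real (card \<Omega>) / t\<^sup>2"
    using t by (subst pos_le_divide_eq) auto
  then show ?thesis using t by (simp add: Z_def \<Omega>_def)
qed

lemma card_filter_eq_sum:
  assumes "finite A"
  shows "real (card {z\<in>A. P z}) = (\<Sum>z\<in>A. if P z then 1 else 0)"
  using sum.inter_filter[OF assms, of "\<lambda>_. 1::real" P] by simp

text \<open>
  The Rademacher bound is relative to the supremum \<open>M\<close> of the empirical means of the very sample
  that is to be controlled. To avoid an a priori bound on \<open>M\<close>, the sample is compared with an
  independent second one, and only pairs are counted in which the deviation \<open>D\<close> of the first
  sample is at least that of the second; by symmetry these are at least half of the pairs with a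
  bad first sample. In such a pair both empirical means are at most \<open>1 + D\<close>, and Chebyshev's
  inequality for the second sample at a nearly extremal \<open>v\<close> loses at most half of what remains. So
  \<open>D / 2\<close>, which is at least \<open>\<epsilon> / 4 * sqrt (1 + D)\<close>, bounds the difference of the two empirical
  means at \<open>v\<close> from below. Exchanging the two samples coordinatewise does not change the counting
  measure, and it turns this difference into a sum with random signs.
\<close>

lemma symmetrization:
  fixes f :: "'v \<Rightarrow> 'a \<Rightarrow> real" and G :: "'a set" and T :: "'v set" and m :: nat and H \<epsilon> p :: real
  assumes G: "finite G" "G \<noteq> {}" and T: "T \<noteq> {}" and m: "m \<ge> 1"
    and f: "\<And>v q. v \<in> T \<Longrightarrow> q \<in> G \<Longrightarrow> 0 \<le> f v q" "\<And>v q. v \<in> T \<Longrightarrow> q \<in> G \<Longrightarrow> f v q \<le> H"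
    and \<mu>: "\<And>v. \<mu> v = (\<Sum>q\<in>G. f v q) / card G" "\<And>v. v \<in> T \<Longrightarrow> \<mu> v \<le> 1"
    and \<epsilon>: "0 < \<epsilon>" "\<epsilon> \<le> 1" and mH: "64 * H \<le> m * \<epsilon>\<^sup>2"
    and rademacher: "\<And>x (M::real). x \<in> {..<m} \<rightarrow>\<^sub>E G \<Longrightarrow> M > 0 \<Longrightarrow> (\<And>v. v \<in> T \<Longrightarrow> (\<Sum>i<m. f v (x i)) \<le> m * M) \<Longrightarrow>
        real (card {\<sigma>\<in>signs m. \<exists>v\<in>T. \<bar>\<Sum>i<m. \<sigma> i * f v (x i)\<bar> > m * (\<epsilon> / 12) * sqrt M}) \<le> 2 ^ m * p"
  shows "real (card {\<tau>\<in>{..<m} \<rightarrow>\<^sub>E G. \<exists>v\<in>T. \<bar>(\<Sum>i<m. f v (\<tau> i)) / m - \<mu> v\<bar> > \<epsilon>})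
      \<le> 8 * p * card ({..<m} \<rightarrow>\<^sub>E G)"
proof -
  define \<Omega> where "\<Omega> = {..<m} \<rightarrow>\<^sub>E G"
  define P where "P \<tau> v = (\<Sum>i<m. f v (\<tau> i)) / m" for \<tau> v
  define a where "a \<tau> v = \<bar>P \<tau> v - \<mu> v\<bar>" for \<tau> v
  define D where "D \<tau> = (SUP v\<in>T. a \<tau> v)" for \<tau>
  define Bad where "Bad = {\<tau>\<in>\<Omega>. \<epsilon> < D \<tau>}"
  have fin: "finite \<Omega>" unfolding \<Omega>_def using G by (intro finite_PiE) auto
  have cG: "real (card G) > 0" using G by (simp add: card_gt_0_iff)
  have H0: "H \<ge> 0" using f G T by fastforce
  have \<Omega>G: "\<tau> i \<in> G" if "\<tau> \<in> \<Omega>" "i < m" for \<tau> i using that by (auto simp: \<Omega>_def)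
  have \<mu>0: "0 \<le> \<mu> v" if "v \<in> T" for v using that f by (auto simp: \<mu> intro!: divide_nonneg_nonneg sum_nonneg)
  have P_bounds: "0 \<le> P \<tau> v" "P \<tau> v \<le> H" if "\<tau> \<in> \<Omega>" "v \<in> T" for \<tau> v
  proof -
    show "0 \<le> P \<tau> v" unfolding P_def using that f \<Omega>G by (auto intro!: divide_nonneg_nonneg sum_nonneg)
    have "(\<Sum>i<m. f v (\<tau> i)) \<le> real (card {..<m}) * H" using that f \<Omega>G by (intro sum_bounded_above) auto
    then show "P \<tau> v \<le> H" using m by (simp add: P_def field_simps)
  qed
  have bdd_a: "bdd_above (a \<tau> ` T)" if "\<tau> \<in> \<Omega>" for \<tau>
  proof (rule bdd_aboveI2)
    show "a \<tau> v \<le> H + 1" if "v \<in> T" for v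
      using P_bounds[OF \<open>\<tau> \<in> \<Omega>\<close> that] \<mu>0[OF that] \<mu>(2)[OF that] H0 by (simp add: a_def abs_le_iff)
  qed
  have a_le: "a \<tau> v \<le> D \<tau>" if "\<tau> \<in> \<Omega>" "v \<in> T" for \<tau> v
    unfolding D_def by (rule cSUP_upper[OF that(2) bdd_a[OF that(1)]])
  have near_sup: "\<exists>v\<in>T. 3 / 4 * D \<tau> < a \<tau> v" if "\<tau> \<in> Bad" for \<tau>
  proof -
    have "\<tau> \<in> \<Omega>" and "3 / 4 * D \<tau> < D \<tau>" using that \<epsilon> by (auto simp: Bad_def)
    then show ?thesis using less_cSUP_iff[OF T bdd_a] unfolding D_def by blast
  qed
  then obtain vv where vv: "\<And>\<tau>. \<tau> \<in> Bad \<Longrightarrow> vv \<tau> \<in> T" "\<And>\<tau>. \<tau> \<in> Bad \<Longrightarrow> 3 / 4 * D \<tau> < a \<tau> (vv \<tau>)" by metis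
  define S where "S \<tau> \<tau>' = (SUP v\<in>T. P \<tau> v + P \<tau>' v)" for \<tau> \<tau>'
  \<comment> \<open>This bound for the two empirical means is invariant under the exchange of coordinates.\<close>
  define M where "M \<tau> \<tau>' = max 1 (S \<tau> \<tau>' / 2)" for \<tau> \<tau>'
  have bdd_S: "bdd_above ((\<lambda>v. P \<tau> v + P \<tau>' v) ` T)" if "\<tau> \<in> \<Omega>" "\<tau>' \<in> \<Omega>" for \<tau> \<tau>'
    by (rule bdd_aboveI2[of _ _ "H + H"]) (intro add_mono P_bounds that)
  define E1 where "E1 = {(\<tau>, \<tau>') \<in> \<Omega> \<times> \<Omega>. \<epsilon> < D \<tau> \<and> D \<tau>' \<le> D \<tau>}"
  define E3 where "E3 = {(\<tau>, \<tau>') \<in> \<Omega> \<times> \<Omega>. \<exists>v\<in>T. \<bar>P \<tau> v - P \<tau>' v\<bar> \<ge> \<epsilon> / 4 * sqrt (M \<tau> \<tau>')}"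
  \<comment> \<open>The pairs in which the second sample misjudges the nearly extremal point of the first.\<close>
  define Far where "Far = (SIGMA \<tau>:Bad. {\<tau>'\<in>\<Omega>. \<bar>P \<tau>' (vv \<tau>) - \<mu> (vv \<tau>)\<bar> > \<epsilon> / 4})"
  have fin2: "finite (\<Omega> \<times> \<Omega>)" using fin by simp
  have finBad: "finite Bad" using fin by (simp add: Bad_def)
  have "Bad \<times> \<Omega> \<subseteq> E1 \<union> prod.swap ` E1"
  proof
    fix z assume "z \<in> Bad \<times> \<Omega>"
    then obtain \<tau> \<tau>' where z: "z = (\<tau>, \<tau>')" "\<tau> \<in> \<Omega>" "\<tau>' \<in> \<Omega>" "\<epsilon> < D \<tau>" by (auto simp: Bad_def)
    show "z \<in> E1 \<union> prod.swap ` E1"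
    proof (cases "D \<tau>' \<le> D \<tau>")
      case True then show ?thesis using z by (auto simp: E1_def)
    next
      case False
      then have "(\<tau>', \<tau>) \<in> E1" using z by (auto simp: E1_def)
      then show ?thesis using z(1) by (auto simp: image_iff intro!: bexI[of _ "(\<tau>', \<tau>)"])
    qed
  qed
  then have "card (Bad \<times> \<Omega>) \<le> card (E1 \<union> prod.swap ` E1)"
    by (rule card_mono[rotated]) (auto simp: E1_def intro: finite_subset[OF _ fin2])
  also have "\<dots> \<le> card E1 + card (prod.swap ` E1)" by (rule card_Un_le)
  also have "\<dots> \<le> card E1 + card E1"
    by (intro add_left_mono card_image_le) (auto simp: E1_def intro: finite_subset[OF _ fin2])
  finally have half: "card Bad * card \<Omega> \<le> 2 * card E1" by (simp add: card_cartesian_product)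
  have "E1 \<subseteq> E3 \<union> Far"
  proof
    fix z assume "z \<in> E1"
    then obtain \<tau> \<tau>' where z: "z = (\<tau>, \<tau>')" "\<tau> \<in> \<Omega>" "\<tau>' \<in> \<Omega>" "\<epsilon> < D \<tau>" "D \<tau>' \<le> D \<tau>" by (auto simp: E1_def)
    have bad: "\<tau> \<in> Bad" using z by (simp add: Bad_def)
    show "z \<in> E3 \<union> Far"
    proof (cases "z \<in> Far")
      case False
      define v where "v = vv \<tau>"
      have v: "v \<in> T" "3 / 4 * D \<tau> < a \<tau> v" using vv[OF bad] by (auto simp: v_def)
      have "\<bar>P \<tau>' v - \<mu> v\<bar> \<le> \<epsilon> / 4" using False z bad by (auto simp: Far_def v_def)
      then have diff: "D \<tau> / 2 \<le> \<bar>P \<tau> v - P \<tau>' v\<bar>" using v(2) z(4) unfolding a_def by linarith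
      have "S \<tau> \<tau>' \<le> 2 * (1 + D \<tau>)" unfolding S_def
      proof (rule cSUP_least[OF T])
        fix w assume w: "w \<in> T"
        have "P \<tau> w \<le> 1 + D \<tau>" using a_le[OF z(2) w] \<mu>(2)[OF w] unfolding a_def by linarith
        moreover have "P \<tau>' w \<le> 1 + D \<tau>" using a_le[OF z(3) w] z(5) \<mu>(2)[OF w] unfolding a_def by linarith
        ultimately show "P \<tau> w + P \<tau>' w \<le> 2 * (1 + D \<tau>)" by simp
      qed
      then have "M \<tau> \<tau>' \<le> 1 + D \<tau>" using z(4) \<epsilon> by (simp add: M_def)
      then have "sqrt (M \<tau> \<tau>') \<le> sqrt (1 + D \<tau>)" by simp
      also have "\<dots> \<le> 1 + D \<tau>"
        using z(4) \<epsilon> by (intro real_le_lsqrt) (auto simp: power2_eq_square algebra_simps)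
      finally have "\<epsilon> / 4 * sqrt (M \<tau> \<tau>') \<le> \<epsilon> / 4 * (1 + D \<tau>)" using \<epsilon> by (intro mult_left_mono) auto
      also have "\<dots> \<le> D \<tau> / 2"
      proof -
        have "\<epsilon> * D \<tau> \<le> 1 * D \<tau>" using \<epsilon> z(4) by (intro mult_right_mono) auto
        then show ?thesis using z(4) by (simp add: algebra_simps)
      qed
      finally have "z \<in> E3" using z v diff by (auto simp: E3_def intro!: bexI[of _ v])
      then show ?thesis by simp
    qed simp
  qed
  then have "card E1 \<le> card (E3 \<union> Far)"
    by (rule card_mono[rotated]) (auto simp: E3_def Far_def Bad_def intro: finite_subset[OF _ fin2] fin)
  also have "\<dots> \<le> card E3 + card Far" by (rule card_Un_le)
  finally have E1_le: "card E1 \<le> card E3 + card Far" .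
  have Far_le: "real (card Far) \<le> real (card Bad) * card \<Omega> / 4"
  proof -
    have "real (card Far) = (\<Sum>\<tau>\<in>Bad. real (card {\<tau>'\<in>\<Omega>. \<bar>P \<tau>' (vv \<tau>) - \<mu> (vv \<tau>)\<bar> > \<epsilon> / 4}))"
      unfolding Far_def using fin finBad by (subst card_SigmaI) auto
    also have "\<dots> \<le> (\<Sum>\<tau>\<in>Bad. 1 / 4 * real (card \<Omega>))"
    proof (rule sum_mono)
      fix \<tau> assume "\<tau> \<in> Bad"
      then have v: "vv \<tau> \<in> T" using vv by blast
      have "real (card {\<tau>'\<in>\<Omega>. \<bar>P \<tau>' (vv \<tau>) - \<mu> (vv \<tau>)\<bar> > \<epsilon> / 4}) \<le> H / (m * (\<epsilon> / 4)\<^sup>2) * card \<Omega>"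
        unfolding P_def \<Omega>_def
        by (rule chebyshev_empirical_mean[OF G _ _ \<mu>(1) \<mu>(2)[OF v]]) (use v f \<epsilon> m in auto)
      also have "H / (m * (\<epsilon> / 4)\<^sup>2) \<le> 1 / 4"
        using mH \<epsilon> m by (simp add: field_simps power2_eq_square)
      finally show "real (card {\<tau>'\<in>\<Omega>. \<bar>P \<tau>' (vv \<tau>) - \<mu> (vv \<tau>)\<bar> > \<epsilon> / 4}) \<le> 1 / 4 * real (card \<Omega>)"
        by (simp add: mult_right_mono)
    qed
    finally show ?thesis by simp
  qed
  have Bad_le: "real (card Bad) * card \<Omega> \<le> 4 * real (card E3)"
  proof -
    have "real (card Bad * card \<Omega>) \<le> real (2 * card E1)" using half by (simp only: of_nat_le_iff)
    then have "real (card Bad) * card \<Omega> \<le> 2 * real (card E1)" by (simp only: of_nat_mult of_nat_numeral)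
    moreover have "real (card E1) \<le> real (card E3) + real (card Far)" using E1_le by linarith
    ultimately show ?thesis using Far_le by linarith
  qed
  \<comment> \<open>The sign vector decides in which coordinates the two samples are exchanged.\<close>
  define ex where "ex \<sigma> z = (\<lambda>i\<in>{..<m}. if \<sigma> i = 1 then fst z i else snd z i,
      \<lambda>i\<in>{..<m}. if \<sigma> i = 1 then snd z i else fst z i)" for \<sigma> :: "nat \<Rightarrow> real" and z :: "(nat \<Rightarrow> 'a) \<times> (nat \<Rightarrow> 'a)"
  have ex_in: "ex \<sigma> z \<in> \<Omega> \<times> \<Omega>" if "z \<in> \<Omega> \<times> \<Omega>" for \<sigma> z
  proof -
    have "fst z i \<in> G" "snd z i \<in> G" if "i < m" for i
      using \<Omega>G[of "fst z" i] \<Omega>G[of "snd z" i] \<open>z \<in> \<Omega> \<times> \<Omega>\<close> that by (simp_all add: mem_Times_iff)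
    then show ?thesis unfolding ex_def \<Omega>_def by (intro SigmaI restrict_PiE_iff[THEN iffD2] ballI) simp_all
  qed
  have ex_ex: "ex \<sigma> (ex \<sigma> z) = z" if "z \<in> \<Omega> \<times> \<Omega>" for \<sigma> z
  proof (rule prod_eqI)
    have z: "fst z i = undefined" "snd z i = undefined" if "\<not> i < m" for i
      using \<open>z \<in> \<Omega> \<times> \<Omega>\<close> that by (auto simp: \<Omega>_def intro: PiE_arb)
    show "fst (ex \<sigma> (ex \<sigma> z)) = fst z" "snd (ex \<sigma> (ex \<sigma> z)) = snd z"
      by (rule ext, simp add: ex_def z)+
  qed
  have bij: "card {z\<in>\<Omega> \<times> \<Omega>. ex \<sigma> z \<in> E3} = card E3" for \<sigma>
  proof (rule bij_betw_same_card)
    show "bij_betw (ex \<sigma>) {z\<in>\<Omega> \<times> \<Omega>. ex \<sigma> z \<in> E3} E3"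
    proof (rule bij_betw_byWitness[where f' = "ex \<sigma>"])
      have "E3 \<subseteq> \<Omega> \<times> \<Omega>" by (auto simp: E3_def)
      then show "\<forall>z\<in>E3. ex \<sigma> (ex \<sigma> z) = z" "ex \<sigma> ` E3 \<subseteq> {z\<in>\<Omega> \<times> \<Omega>. ex \<sigma> z \<in> E3}"
        using ex_ex ex_in by (blast, force)
    qed (use ex_ex in auto)
  qed
  have per_pair: "real (card {\<sigma>\<in>signs m. ex \<sigma> z \<in> E3}) \<le> 2 * (2 ^ m * p)" if z: "z \<in> \<Omega> \<times> \<Omega>" for z
  proof -
    obtain \<tau> \<tau>' where zz: "z = (\<tau>, \<tau>')" "\<tau> \<in> \<Omega>" "\<tau>' \<in> \<Omega>" using z by auto
    \<comment> \<open>Twice the mean of the two suprema bounds each sample separately, whichever coordinates are exchanged.\<close>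
    define M2 where "M2 = 2 * M \<tau> \<tau>'"
    have M1: "M \<tau> \<tau>' \<ge> 1" by (simp add: M_def)
    have sum_le: "P \<tau> v + P \<tau>' v \<le> M2" if "v \<in> T" for v
    proof -
      have "P \<tau> v + P \<tau>' v \<le> S \<tau> \<tau>'" unfolding S_def by (rule cSUP_upper[OF that bdd_S[OF zz(2,3)]])
      then show ?thesis by (simp add: M2_def M_def)
    qed
    define R where "R x = {\<sigma>\<in>signs m. \<exists>v\<in>T. \<bar>\<Sum>i<m. \<sigma> i * f v (x i)\<bar> > m * (\<epsilon> / 12) * sqrt M2}" for x
    have R: "real (card (R x)) \<le> 2 ^ m * p" if "x = \<tau> \<or> x = \<tau>'" for x
      unfolding R_def
    proof (rule rademacher)
      show "x \<in> {..<m} \<rightarrow>\<^sub>E G" using that zz by (auto simp: \<Omega>_def)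
      show "M2 > 0" using M1 by (simp add: M2_def)
      fix v assume v: "v \<in> T"
      have "P x v \<le> M2" using that sum_le[OF v] P_bounds(1)[OF zz(2) v] P_bounds(1)[OF zz(3) v] by auto
      then show "(\<Sum>i<m. f v (x i)) \<le> m * M2" using m by (simp add: P_def field_simps)
    qed
    have "{\<sigma>\<in>signs m. ex \<sigma> z \<in> E3} \<subseteq> R \<tau> \<union> R \<tau>'"
    proof (rule subsetI, rule ccontr)
      fix \<sigma> assume "\<sigma> \<in> {\<sigma>\<in>signs m. ex \<sigma> z \<in> E3}" and no: "\<sigma> \<notin> R \<tau> \<union> R \<tau>'"
      then have \<sigma>: "\<sigma> \<in> signs m" "ex \<sigma> z \<in> E3" by auto
      define y y' where "y = fst (ex \<sigma> z)" and "y' = snd (ex \<sigma> z)"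
      have sg: "\<sigma> i = 1 \<or> \<sigma> i = -1" if "i < m" for i using \<sigma>(1) that by (auto simp: signs_def PiE_iff)
      have sum_eq: "P y v + P y' v = P \<tau> v + P \<tau>' v" for v
      proof -
        have "(\<Sum>i<m. f v (y i)) + (\<Sum>i<m. f v (y' i)) = (\<Sum>i<m. f v (\<tau> i)) + (\<Sum>i<m. f v (\<tau>' i))"
          unfolding sum.distrib[symmetric] by (rule sum.cong) (auto simp: y_def y'_def ex_def zz)
        then show ?thesis by (simp add: P_def add_divide_distrib[symmetric])
      qed
      have diff_eq: "real m * (P y v - P y' v) = (\<Sum>i<m. \<sigma> i * f v (\<tau> i)) - (\<Sum>i<m. \<sigma> i * f v (\<tau>' i))" for v
      proof -
        have "real m * (P y v - P y' v) = (\<Sum>i<m. f v (y i)) - (\<Sum>i<m. f v (y' i))"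
          using m by (simp add: P_def field_simps)
        also have "\<dots> = (\<Sum>i<m. \<sigma> i * f v (\<tau> i)) - (\<Sum>i<m. \<sigma> i * f v (\<tau>' i))"
          unfolding sum_subtractf[symmetric]
          by (rule sum.cong) (use sg in \<open>force simp: y_def y'_def ex_def zz\<close>)+
        finally show ?thesis .
      qed
      have M_eq: "M y y' = M \<tau> \<tau>'" by (simp add: M_def S_def sum_eq)
      have "(y, y') \<in> E3" using \<sigma>(2) by (simp add: y_def y'_def)
      then obtain v where v: "v \<in> T" "\<bar>P y v - P y' v\<bar> \<ge> \<epsilon> / 4 * sqrt (M \<tau> \<tau>')"
        by (auto simp: E3_def M_eq)
      have "\<bar>\<Sum>i<m. \<sigma> i * f v (\<tau> i)\<bar> \<le> m * (\<epsilon> / 12) * sqrt M2" "\<bar>\<Sum>i<m. \<sigma> i * f v (\<tau>' i)\<bar> \<le> m * (\<epsilon> / 12) * sqrt M2"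
        using no \<sigma>(1) v(1) by (auto simp: R_def not_less)
      then have "\<bar>real m * (P y v - P y' v)\<bar> \<le> 2 * (m * (\<epsilon> / 12) * sqrt M2)" unfolding diff_eq by linarith
      moreover have "2 * (c * (\<epsilon> / 12) * s) = c * (\<epsilon> / 6 * s)" for c s by simp
      ultimately have "real m * \<bar>P y v - P y' v\<bar> \<le> real m * (\<epsilon> / 6 * sqrt M2)"
        by (simp only: abs_mult abs_of_nat)
      then have "\<bar>P y v - P y' v\<bar> \<le> \<epsilon> / 6 * sqrt M2" using m by simp
      with v(2) have "\<epsilon> / 4 * sqrt (M \<tau> \<tau>') \<le> \<epsilon> / 6 * sqrt M2" by linarith
      also have "\<dots> = \<epsilon> / 6 * sqrt 2 * sqrt (M \<tau> \<tau>')" by (simp add: M2_def real_sqrt_mult)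
      finally have "1 / 4 \<le> sqrt 2 / 6" using \<epsilon> M1 by (simp add: field_simps)
      moreover have "sqrt 2 < 3 / 2" by (rule real_less_lsqrt) (auto simp: power2_eq_square)
      ultimately show False by simp
    qed
    then have "card {\<sigma>\<in>signs m. ex \<sigma> z \<in> E3} \<le> card (R \<tau> \<union> R \<tau>')"
      by (rule card_mono[rotated]) (auto simp: R_def)
    also have "\<dots> \<le> card (R \<tau>) + card (R \<tau>')" by (rule card_Un_le)
    finally have "real (card {\<sigma>\<in>signs m. ex \<sigma> z \<in> E3}) \<le> real (card (R \<tau>)) + real (card (R \<tau>'))" by linarith
    also have "\<dots> \<le> 2 ^ m * p + 2 ^ m * p" by (intro add_mono R) auto
    finally show ?thesis by (simp add: mult_ac)
  qed
  have "2 ^ m * real (card E3) = (\<Sum>\<sigma>\<in>signs m. real (card {z\<in>\<Omega> \<times> \<Omega>. ex \<sigma> z \<in> E3}))"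
    by (simp add: bij card_signs)
  also have "\<dots> = (\<Sum>\<sigma>\<in>signs m. \<Sum>z\<in>\<Omega> \<times> \<Omega>. if ex \<sigma> z \<in> E3 then 1 else 0)"
    by (rule sum.cong[OF refl]) (rule card_filter_eq_sum[OF fin2])
  also have "\<dots> = (\<Sum>z\<in>\<Omega> \<times> \<Omega>. \<Sum>\<sigma>\<in>signs m. if ex \<sigma> z \<in> E3 then 1 else 0)" by (rule sum.swap)
  also have "\<dots> = (\<Sum>z\<in>\<Omega> \<times> \<Omega>. real (card {\<sigma>\<in>signs m. ex \<sigma> z \<in> E3}))"
    by (rule sum.cong[OF refl]) (rule card_filter_eq_sum[OF finite_signs, symmetric])
  also have "\<dots> \<le> (\<Sum>z\<in>\<Omega> \<times> \<Omega>. 2 * (2 ^ m * p))" by (rule sum_mono) (rule per_pair)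
  also have "\<dots> = 2 ^ m * (2 * p * (real (card \<Omega>) * real (card \<Omega>)))" by (simp add: card_cartesian_product)
  finally have "real (card E3) \<le> 2 * p * (real (card \<Omega>) * real (card \<Omega>))" by simp
  then have "4 * real (card E3) \<le> 4 * (2 * p * (real (card \<Omega>) * real (card \<Omega>)))" by simp
  also have "\<dots> = (8 * p * real (card \<Omega>)) * card \<Omega>" by simp
  finally have "real (card Bad) * card \<Omega> \<le> (8 * p * real (card \<Omega>)) * card \<Omega>"
    by (rule order_trans[OF Bad_le])
  moreover have "real (card \<Omega>) > 0" using cG by (simp add: \<Omega>_def card_PiE)
  ultimately have "real (card Bad) \<le> 8 * p * real (card \<Omega>)" by simp
  moreover have "{\<tau>\<in>\<Omega>. \<exists>v\<in>T. \<bar>(\<Sum>i<m. f v (\<tau> i)) / m - \<mu> v\<bar> > \<epsilon>} \<subseteq> Bad"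
    using a_le by (force simp: Bad_def a_def P_def)
  then have "card {\<tau>\<in>\<Omega>. \<exists>v\<in>T. \<bar>(\<Sum>i<m. f v (\<tau> i)) / m - \<mu> v\<bar> > \<epsilon>} \<le> card Bad"
    by (rule card_mono[OF finBad])
  ultimately show ?thesis unfolding \<Omega>_def by linarith
qed

section \<open>Sparse vectors and bounded systems\<close>

definition sparse_ball :: "nat \<Rightarrow> nat \<Rightarrow> (nat \<Rightarrow> real) set" where
  "sparse_ball N s = {v. (\<Sum>j<N. (v j)\<^sup>2) \<le> 1 \<and> card {j. j < N \<and> v j \<noteq> 0} \<le> s}"

lemma sparse_ball_l1:
  assumes "v \<in> sparse_ball N s"
  shows "(\<Sum>j<N. \<bar>v j\<bar>) \<le> sqrt (real s)"
proof -
  have "(\<Sum>j<N. \<bar>v j\<bar>) = (\<Sum>j<N. \<bar>v j\<bar> * \<bar>of_bool (v j \<noteq> 0)\<bar>)"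
    by (intro sum.cong) auto
  also have "\<dots> \<le> sqrt 1 * sqrt (real s)"
  proof (rule sum_abs_mult_le_sqrt)
    show "(\<Sum>j<N. (v j)\<^sup>2) \<le> 1" using assms by (simp add: sparse_ball_def)
    have "(\<Sum>j<N. (of_bool (v j \<noteq> 0))\<^sup>2) = (\<Sum>j<N. if v j \<noteq> 0 then 1 else (0::real))"
      by (intro sum.cong) auto
    also have "\<dots> = real (card {j\<in>{..<N}. v j \<noteq> 0})"
      by (rule card_filter_eq_sum[symmetric]) simp
    also have "\<dots> \<le> real s" using assms by (simp add: sparse_ball_def)
    finally show "(\<Sum>j<N. (of_bool (v j \<noteq> 0))\<^sup>2) \<le> real s" .
  qed
  finally show ?thesis by simp
qed

text \<open>
  With \<open>2 ^ L \<ge> s\<close> the finest scale \<open>sqrt s * K / 2 ^ L\<close> is a small multiple of \<open>\<epsilon>\<close>, because \<open>s\<close>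
  exceeds a large multiple of \<open>K\<^sup>2 / \<epsilon>\<^sup>2\<close>. The entropy contains \<open>ln (2 * m)\<close>, although \<open>m\<close> has no
  upper bound. At the threshold \<open>m0\<close> for \<open>m\<close> the hypothesis on \<open>s\<close> bounds this logarithm by
  \<open>6 * ln s\<close>, and above the threshold \<open>m / ln (2 * m)\<close> increases: the tangent inequality
  \<open>ln (m / m0) \<le> m / m0 - 1\<close> expresses this.
\<close>

lemma chaining_parameters:
  fixes \<epsilon> K :: real and m s N :: nat
  assumes \<epsilon>: "0 < \<epsilon>" "\<epsilon> \<le> 1" and K: "K \<ge> 1" and N: "N \<ge> 2" and s: "s \<ge> 2"
    and Ct: "Ct = 10000000000 * K\<^sup>2 / \<epsilon>\<^sup>2"
    and m_large: "real m \<ge> Ct * real s * (ln (real s)) ^ 3 * ln (real N)"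
    and s_large: "real s \<ge> Ct * ln (real N)"
    and Q: "Q = real m * (\<epsilon> / 12)\<^sup>2 / (4608 * (sqrt (real s) * K)\<^sup>2)"
  obtains L :: nat where "m \<ge> 1" "L \<ge> 1" "8 * (sqrt (real s) * K) / (\<epsilon> / 12) \<le> 2 ^ L"
    "20 * ln (2 * real m) * ln (3 * real N) \<le> Q / (real L)\<^sup>2"
    "64 * (sqrt (real s) * K)\<^sup>2 \<le> real m * \<epsilon>\<^sup>2"
    "16 * real L * exp (- Q) \<le> real N powr (- ((ln (real s)) ^ 3))"
proof -
  define l where "l = ln (real s)"
  define n where "n = ln (real N)"
  define c where "c = K\<^sup>2 / \<epsilon>\<^sup>2"
  define m0 where "m0 = Ct * real s * l ^ 3 * n"
  have Ctc: "Ct = 10000000000 * c" by (simp add: Ct c_def)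
  have c1: "c \<ge> 1"
  proof -
    have "\<epsilon>\<^sup>2 \<le> 1" using \<epsilon> by (simp add: power_le_one)
    moreover have "1 \<le> K\<^sup>2" using K by simp
    ultimately show ?thesis using \<epsilon> by (simp add: c_def le_divide_eq)
  qed
  have n: "n \<ge> 2 / 3"
  proof -
    have "ln 2 \<le> n" using N by (simp add: n_def)
    then show ?thesis using ln2_ge_two_thirds by linarith
  qed
  have s9: "real s \<ge> 1000000000 * c"
  proof -
    have "1000000000 * c \<le> 10000000000 * c * (2 / 3)" using c1 by simp
    also have "\<dots> \<le> 10000000000 * c * n" using c1 n by (intro mult_left_mono) auto
    also have "\<dots> \<le> real s" using s_large by (simp add: Ctc n_def)
    finally show ?thesis .
  qed
  have s9': "real s \<ge> 1000000000" using s9 c1 by linarith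
  have l1: "l \<ge> 1"
  proof -
    have "exp 1 \<le> real s" using exp_le s9' by linarith
    then have "ln (exp 1) \<le> l" unfolding l_def using s by (subst ln_le_cancel_iff) auto
    then show ?thesis by simp
  qed
  have ls: "l \<le> real s" unfolding l_def using s ln_le_minus_one[of "real s"] by simp
  have l3: "l ^ 3 \<ge> l" "l ^ 3 \<ge> 1" using l1 self_le_power[of l 3] by auto
  have m0pos: "m0 > 0"
  proof -
    have "c > 0" "real s > 0" "l ^ 3 > 0" "n > 0" using c1 s l3 n by linarith+
    then show ?thesis by (simp add: m0_def Ctc)
  qed
  have m_m0: "real m \<ge> m0" using m_large by (simp add: m0_def l_def n_def)
  have m1: "m \<ge> 1" using m_m0 m0pos by (cases m) auto
  have lnm: "ln (2 * real m) * m0 \<le> 8 * (l * real m)"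
  proof -
    have "Ct * n \<le> real s" using s_large by (simp add: n_def)
    then have "Ct * n * (real s * l ^ 3) \<le> real s * (real s * real s ^ 3)"
      using ls l1 by (intro mult_mono power_mono) auto
    then have "m0 \<le> real s ^ 5" by (simp add: m0_def mult_ac power_numeral_reduce)
    then have "2 * m0 \<le> real s * real s ^ 5" using s m0pos by (intro mult_mono) auto
    then have "2 * m0 \<le> real s ^ 6" by (simp add: power_numeral_reduce)
    then have "ln (2 * m0) \<le> ln (real s ^ 6)" using m0pos s by (subst ln_le_cancel_iff) auto
    then have 1: "ln (2 * m0) \<le> 6 * l" using s by (simp add: l_def ln_realpow)
    have "ln (2 * real m) = ln (2 * m0) + ln (real m / m0)"
      using m0pos m1 by (subst ln_mult_pos[symmetric]) auto
    also have "\<dots> \<le> 6 * l + real m / m0"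
      using 1 ln_le_minus_one[of "real m / m0"] m0pos m1 by simp
    finally have "ln (2 * real m) * m0 \<le> (6 * l + real m / m0) * m0"
      using m0pos by (intro mult_right_mono) auto
    also have "\<dots> = 6 * (l * m0) + real m" using m0pos by (simp add: algebra_simps)
    also have "\<dots> \<le> 6 * (l * real m) + l * real m"
      using m_m0 l1 by (intro add_mono mult_left_mono) (auto simp: mult_le_cancel_right1)
    also have "\<dots> \<le> 8 * (l * real m)" using l1 by simp
    finally show ?thesis .
  qed
  define L where "L = nat \<lceil>log 2 (real s)\<rceil>"
  have log1: "log 2 (real s) \<ge> 1" using s by (simp add: le_log_iff)
  have L1: "L \<ge> 1" unfolding L_def using log1 by linarith
  have L2: "real s \<le> 2 ^ L"
  proof -
    have "log 2 (real s) \<le> real L" unfolding L_def by (rule real_nat_ceiling_ge)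
    then have "real s \<le> 2 powr real L" using s by (simp add: log_le_iff)
    then show ?thesis by (simp add: powr_realpow)
  qed
  have L3: "real L \<le> 3 * l"
  proof -
    have "real L \<le> log 2 (real s) + 1" unfolding L_def using log1 by linarith
    also have "log 2 (real s) = l / ln 2" by (simp add: log_def l_def)
    also have "l / ln 2 \<le> l / (2 / 3)" using l1 ln2_ge_two_thirds by (intro divide_left_mono) auto
    finally show ?thesis using l1 by simp
  qed
  \<comment> \<open>The factor is \<open>663552 = 12\<^sup>2 * 4608\<close>.\<close>
  have Qeq: "Q * (663552 * (real s * c)) = real m"
    using \<epsilon> K s by (simp add: Q c_def power_mult_distrib field_simps)
  have sc: "real s * c > 0" using s c1 by simp
  have Q0: "Q \<ge> 0" by (simp add: Q)
  have m0eq: "m0 = (real s * c) * (10000000000 * l ^ 3 * n)" by (simp add: m0_def Ctc)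
  have Qbig: "15000 * (l ^ 3 * n) \<le> Q"
  proof -
    have "(real s * c) * (10000000000 * l ^ 3 * n) \<le> (real s * c) * (663552 * Q)"
      using m_m0 Qeq unfolding m0eq by (simp add: mult_ac)
    then have "10000000000 * l ^ 3 * n \<le> 663552 * Q" using sc by (simp only: mult_le_cancel_left_pos)
    then have "10000000000 * (l ^ 3 * n) \<le> 663552 * Q" by (simp only: mult.assoc)
    moreover have "l ^ 3 * n \<ge> 0" using l3 n by (intro mult_nonneg_nonneg) linarith+
    ultimately show ?thesis by linarith
  qed
  \<comment> \<open>The factor is \<open>540 = 20 * 3 * 3\<^sup>2\<close>, from \<open>ln (3 * N) \<le> 3 * ln N\<close> and \<open>L \<le> 3 * ln s\<close>.\<close>
  have entropy: "540 * (l\<^sup>2 * (ln (2 * real m) * n)) \<le> Q"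
  proof -
    have "(real s * c * l) * (10000000000 * (l\<^sup>2 * (ln (2 * real m) * n))) = ln (2 * real m) * m0"
      by (simp add: m0eq power2_eq_square power3_eq_cube)
    also have "\<dots> \<le> 8 * (l * real m)" by (rule lnm)
    also have "\<dots> = (real s * c * l) * (8 * 663552 * Q)" using Qeq by (simp add: mult_ac)
    finally have "10000000000 * (l\<^sup>2 * (ln (2 * real m) * n)) \<le> 8 * 663552 * Q"
      using sc l1 by (simp only: mult_le_cancel_left_pos mult_pos_pos)
    moreover have "l\<^sup>2 * (ln (2 * real m) * n) \<ge> 0" using m1 n by (intro mult_nonneg_nonneg) auto
    ultimately show ?thesis by linarith
  qed
  show thesis
  proof (rule that[OF m1 L1])
    have "(8 * (sqrt (real s) * K) / (\<epsilon> / 12))\<^sup>2 = 9216 * c * real s"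
      by (simp add: c_def power_divide power_mult_distrib)
    also have "\<dots> \<le> real s * real s" using s9 c1 s by (intro mult_right_mono) auto
    finally have "(8 * (sqrt (real s) * K) / (\<epsilon> / 12))\<^sup>2 \<le> (real s)\<^sup>2" by (simp add: power2_eq_square)
    then have "8 * (sqrt (real s) * K) / (\<epsilon> / 12) \<le> real s" by (rule power2_le_imp_le) simp
    then show "8 * (sqrt (real s) * K) / (\<epsilon> / 12) \<le> 2 ^ L" using L2 by linarith
    have N3: "ln (3 * real N) \<le> 3 * n"
    proof -
      have "3 * N \<le> N ^ 3"
      proof -
        have "2 * 2 \<le> N * N" using N by (intro mult_le_mono) auto
        then have "3 * N \<le> (N * N) * N" by (intro mult_le_mono) auto
        then show ?thesis by (simp add: power3_eq_cube)
      qed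
      then have "real (3 * N) \<le> real (N ^ 3)" by (simp only: of_nat_le_iff)
      then have "ln (real (3 * N)) \<le> ln (real (N ^ 3))" using N by (subst ln_le_cancel_iff) auto
      then show ?thesis using N by (simp add: n_def ln_realpow)
    qed
    have lm0: "ln (2 * real m) \<ge> 0" using m1 by simp
    have lN0: "ln (3 * real N) \<ge> 0" using N by simp
    have "20 * ln (2 * real m) * ln (3 * real N) * (real L)\<^sup>2 \<le> 20 * ln (2 * real m) * (3 * n) * (3 * l)\<^sup>2"
      using lm0 lN0 N3 L3 n by (intro mult_mono power_mono) auto
    also have "\<dots> = 540 * (l\<^sup>2 * (ln (2 * real m) * n))" by (simp add: power_mult_distrib)
    finally have "20 * ln (2 * real m) * ln (3 * real N) * (real L)\<^sup>2 \<le> Q" using entropy by linarith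
    then show "20 * ln (2 * real m) * ln (3 * real N) \<le> Q / (real L)\<^sup>2"
      using L1 by (simp add: pos_le_divide_eq)
    have "64 * (real s * c) \<le> real m"
    proof -
      have "1 * (2 / 3) \<le> l ^ 3 * n" using l3 n l1 by (intro mult_mono) auto
      then have "64 \<le> 10000000000 * (l ^ 3 * n)" by linarith
      then have "(real s * c) * 64 \<le> (real s * c) * (10000000000 * (l ^ 3 * n))" using sc by (intro mult_left_mono) auto
      then show ?thesis using m_m0 unfolding m0eq mult.assoc by linarith
    qed
    then have "64 * (real s * c) * \<epsilon>\<^sup>2 \<le> real m * \<epsilon>\<^sup>2" by (intro mult_right_mono) auto
    then show "64 * (sqrt (real s) * K)\<^sup>2 \<le> real m * \<epsilon>\<^sup>2"
      using \<epsilon> by (simp add: c_def power_mult_distrib)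
    have "16 * real L \<le> 48 * l" using L3 by linarith
    also have "\<dots> \<le> exp (48 * l)" using exp_ge_add_one_self[of "48 * l"] by linarith
    finally have "16 * real L * exp (- Q) \<le> exp (48 * l) * exp (- Q)" by (intro mult_right_mono) auto
    also have "\<dots> = exp (48 * l - Q)" by (simp add: mult_exp_exp)
    also have "\<dots> \<le> exp (- (l ^ 3 * n))"
    proof -
      have "l * (2 / 3) \<le> l ^ 3 * n" using l3 n l1 by (intro mult_mono) auto
      then have "48 * l - Q \<le> - (l ^ 3 * n)" using Qbig l1 by linarith
      then show ?thesis by simp
    qed
    also have "\<dots> = real N powr (- ((ln (real s)) ^ 3))"
      using N by (simp add: powr_def n_def l_def)
    finally show "16 * real L * exp (- Q) \<le> real N powr (- ((ln (real s)) ^ 3))" .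
  qed
qed

text \<open>
  A uniform law of large numbers for the quadratic forms of sparse vectors. Here \<open>K\<close> bounds the
  entries of the sampled vectors, and \<open>Bessel\<close> is the upper Riesz bound of the system.
\<close>

lemma sparse_uniform_deviation:
  fixes X :: "'a \<Rightarrow> nat \<Rightarrow> real" and \<epsilon> K :: real and m s N :: nat
  assumes G: "finite G" "G \<noteq> {}"
    and X: "\<And>q j. q \<in> G \<Longrightarrow> j < N \<Longrightarrow> \<bar>X q j\<bar> \<le> K"
    and Bessel: "\<And>v. (\<Sum>q\<in>G. (lin N (X q) v)\<^sup>2) / card G \<le> (\<Sum>j<N. (v j)\<^sup>2)"
    and \<epsilon>: "0 < \<epsilon>" "\<epsilon> \<le> 1" and K: "K \<ge> 1" and N: "N \<ge> 2" and s: "s \<ge> 2"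
    and Ct: "Ct = 10000000000 * K\<^sup>2 / \<epsilon>\<^sup>2"
    and m_large: "real m \<ge> Ct * real s * (ln (real s)) ^ 3 * ln (real N)"
    and s_large: "real s \<ge> Ct * ln (real N)"
  shows "real (card {\<tau>\<in>{..<m} \<rightarrow>\<^sub>E G. \<exists>v\<in>sparse_ball N s.
            \<bar>(\<Sum>i<m. (lin N (X (\<tau> i)) v)\<^sup>2) / m - (\<Sum>q\<in>G. (lin N (X q) v)\<^sup>2) / card G\<bar> > \<epsilon>})
      \<le> real N powr (- ((ln (real s)) ^ 3)) * card ({..<m} \<rightarrow>\<^sub>E G)"
proof -
  define b where "b = sqrt (real s)"
  define Q where "Q = real m * (\<epsilon> / 12)\<^sup>2 / (4608 * (b * K)\<^sup>2)"
  obtain L where L: "m \<ge> 1" "L \<ge> 1" "8 * (b * K) / (\<epsilon> / 12) \<le> 2 ^ L"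
    "20 * ln (2 * real m) * ln (3 * real N) \<le> Q / (real L)\<^sup>2"
    "64 * (b * K)\<^sup>2 \<le> real m * \<epsilon>\<^sup>2"
    "16 * real L * exp (- Q) \<le> real N powr (- ((ln (real s)) ^ 3))"
    using chaining_parameters[OF \<epsilon> K N s Ct m_large s_large Q_def[unfolded b_def]] unfolding b_def by blast
  have b: "b > 0" using s by (simp add: b_def)
  have l1: "(\<Sum>j<N. \<bar>v j\<bar>) \<le> b" if "v \<in> sparse_ball N s" for v
    unfolding b_def using that by (rule sparse_ball_l1)
  have zero: "(\<lambda>_. 0) \<in> sparse_ball N s" by (simp add: sparse_ball_def)
  have "real (card {\<tau>\<in>{..<m} \<rightarrow>\<^sub>E G. \<exists>v\<in>sparse_ball N s.
            \<bar>(\<Sum>i<m. (lin N (X (\<tau> i)) v)\<^sup>2) / m - (\<Sum>q\<in>G. (lin N (X q) v)\<^sup>2) / card G\<bar> > \<epsilon>})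
      \<le> 8 * (2 * real L * exp (- Q)) * card ({..<m} \<rightarrow>\<^sub>E G)"
  proof (rule symmetrization[OF G _ L(1) _ _ _ _ \<epsilon> L(5)])
    show "sparse_ball N s \<noteq> {}" using zero by blast
    show "(lin N (X q) v)\<^sup>2 \<le> (b * K)\<^sup>2" if "v \<in> sparse_ball N s" "q \<in> G" for v q
    proof -
      have "\<bar>lin N (X q) v\<bar> \<le> b * K" using X that l1 K by (intro abs_lin_le) auto
      then have "\<bar>lin N (X q) v\<bar>\<^sup>2 \<le> (b * K)\<^sup>2" by (intro power_mono) auto
      then show ?thesis by simp
    qed
    show "(\<Sum>q\<in>G. (lin N (X q) v)\<^sup>2) / card G \<le> 1" if "v \<in> sparse_ball N s" for v
      using Bessel[of v] that by (simp add: sparse_ball_def)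
    fix x and M :: real
    assume x: "x \<in> {..<m} \<rightarrow>\<^sub>E G" and M: "M > 0"
      "\<And>v. v \<in> sparse_ball N s \<Longrightarrow> (\<Sum>i<m. (lin N (X (x i)) v)\<^sup>2) \<le> real m * M"
    show "real (card {\<sigma>\<in>signs m. \<exists>v\<in>sparse_ball N s. \<bar>\<Sum>i<m. \<sigma> i * (lin N (X (x i)) v)\<^sup>2\<bar> > m * (\<epsilon> / 12) * sqrt M})
       \<le> 2 ^ m * (2 * real L * exp (- Q))"
    proof (rule rademacher_l1_class[where x = "\<lambda>i. X (x i)" and K = K and b = b])
      show "\<bar>X (x i) j\<bar> \<le> K" if "i < m" "j < N" for i j
        using X x that by (auto simp: PiE_iff)
    qed (use K b N L l1 zero M \<epsilon> Q_def in auto)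
  qed auto
  also have "\<dots> = 16 * real L * exp (- Q) * card ({..<m} \<rightarrow>\<^sub>E G)" by simp
  also have "\<dots> \<le> real N powr (- ((ln (real s)) ^ 3)) * card ({..<m} \<rightarrow>\<^sub>E G)"
    by (intro mult_right_mono L(6)) auto
  finally show ?thesis .
qed

section \<open>Discrete sine and cosine transforms\<close>

text \<open>
  Multiplication by \<open>2 * sin (x / 2)\<close> makes the sum telescope. The value is due to the missing end
  points \<open>q = 0\<close> and \<open>q = n + 1\<close>: with half of the terms 1 and \<open>(-1) ^ k\<close> there, the sum would
  vanish.
\<close>

lemma sum_cos_arith:
  fixes k n :: nat
  assumes k: "0 < k" "k < 2 * (n + 1)"
  shows "(\<Sum>q=1..n. cos (pi * real k * real q / (real n + 1))) = - ((1 + (-1) ^ k) / 2)"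
proof -
  define x where "x = pi * real k / (real n + 1)"
  have tele: "2 * sin (x / 2) * (\<Sum>q=1..p. cos (real q * x)) = sin ((real p + 1 / 2) * x) - sin (x / 2)" for p
  proof (induction p)
    case (Suc p)
    have "2 * sin (x / 2) * cos (real (Suc p) * x) = sin ((real (Suc p) + 1 / 2) * x) - sin ((real p + 1 / 2) * x)"
    proof -
      have "(real (Suc p) + 1 / 2) * x = real (Suc p) * x + x / 2" "(real p + 1 / 2) * x = real (Suc p) * x - x / 2"
        by (simp_all add: algebra_simps)
      then show ?thesis by (simp only: sin_add sin_diff) simp
    qed
    then show ?case using Suc by (simp add: distrib_left)
  qed simp
  have "(real n + 1 / 2) * x = pi * real k - x / 2"
    by (simp add: x_def field_simps)
  then have "sin ((real n + 1 / 2) * x) = - ((-1) ^ k * sin (x / 2))"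
    by (simp add: sin_diff)
  then have "2 * sin (x / 2) * (\<Sum>q=1..n. cos (real q * x)) = 2 * sin (x / 2) * (- ((1 + (-1) ^ k) / 2))"
    unfolding tele by (simp add: algebra_simps)
  moreover have "sin (x / 2) > 0"
  proof (rule sin_gt_zero)
    show "0 < x / 2" using k by (simp add: x_def)
    have "real k < real (2 * (n + 1))" using k(2) by (simp only: of_nat_less_iff)
    then have "pi * real k < pi * (2 * (real n + 1))" by simp
    then show "x / 2 < pi" by (simp add: x_def field_simps)
  qed
  ultimately have "(\<Sum>q=1..n. cos (real q * x)) = - ((1 + (-1) ^ k) / 2)"
    by (simp only: mult_cancel_left) simp
  moreover have "(\<Sum>q=1..n. cos (pi * real k * real q / (real n + 1))) = (\<Sum>q=1..n. cos (real q * x))"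
    by (intro sum.cong refl) (simp add: x_def mult_ac)
  ultimately show ?thesis by simp
qed

lemma sum_cos_difference:
  fixes i j n :: nat
  assumes ij: "i \<in> {1..n}" "j \<in> {1..n}"
  shows "(\<Sum>q=1..n. cos (pi * real i * real q / (real n + 1) - pi * real j * real q / (real n + 1)))
     = (if i = j then real n + 1 else 0) - (1 + (-1) ^ i * (-1) ^ j) / 2"
proof -
  have *: "(\<Sum>q=1..n. cos (pi * real i * real q / (real n + 1) - pi * real j * real q / (real n + 1)))
     = - ((1 + (-1) ^ i * (-1) ^ j) / 2)" if "j < i" "i \<le> n" for i j
  proof -
    have "pi * real i * real q / (real n + 1) - pi * real j * real q / (real n + 1) = pi * real (i - j) * real q / (real n + 1)" for q
      unfolding diff_divide_distrib[symmetric] using that by (simp add: of_nat_diff algebra_simps)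
    moreover have "(-1::real) ^ (i - j) = (-1) ^ i * (-1) ^ j"
      using that by (cases "even i"; cases "even j") auto
    ultimately show ?thesis using sum_cos_arith[of "i - j" n] that by simp
  qed
  consider "j < i" | "i < j" | "i = j" by linarith
  then show ?thesis
  proof cases
    case 1
    have "i \<le> n" using ij by simp
    then show ?thesis unfolding *[OF 1 \<open>i \<le> n\<close>] using 1 by simp
  next
    case 2
    have "j \<le> n" using ij by simp
    have "cos (a - b) = cos (b - a)" for a b :: real using cos_minus[of "a - b"] by simp
    then have "(\<Sum>q=1..n. cos (pi * real i * real q / (real n + 1) - pi * real j * real q / (real n + 1)))
      = (\<Sum>q=1..n. cos (pi * real j * real q / (real n + 1) - pi * real i * real q / (real n + 1)))"
      by (intro sum.cong refl)
    also note *[OF 2 \<open>j \<le> n\<close>]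
    finally show ?thesis using 2 by (simp add: mult.commute)
  next
    case 3
    then show ?thesis by (simp flip: power_add)
  qed
qed

lemma sum_cos_sum:
  fixes i j n :: nat
  assumes ij: "i \<in> {1..n}" "j \<in> {1..n}"
  shows "(\<Sum>q=1..n. cos (pi * real i * real q / (real n + 1) + pi * real j * real q / (real n + 1)))
     = - ((1 + (-1) ^ i * (-1) ^ j) / 2)"
proof -
  have "pi * real i * real q / (real n + 1) + pi * real j * real q / (real n + 1) = pi * real (i + j) * real q / (real n + 1)" for q
    unfolding add_divide_distrib[symmetric] by (simp add: algebra_simps)
  then show ?thesis using sum_cos_arith[of "i + j" n] ij by (simp add: power_add)
qed

text \<open>
  The orthogonal discrete sine transform of type I.
\<close>

definition dst :: "nat \<Rightarrow> nat \<Rightarrow> nat \<Rightarrow> real" where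
  "dst n q j = sqrt (2 / (real n + 1)) * sin (pi * real j * real q / (real n + 1))"

text \<open>
  The interior rows and columns of the discrete cosine transform of type I, normalized like the
  sine transform.
\<close>

definition dct :: "nat \<Rightarrow> nat \<Rightarrow> nat \<Rightarrow> real" where
  "dct n q j = sqrt (2 / (real n + 1)) * cos (pi * real j * real q / (real n + 1))"

lemma sqrt_mult_sqrt_mult:
  fixes x a b :: real
  assumes "x \<ge> 0"
  shows "sqrt x * a * (sqrt x * b) = x * (a * b)"
proof -
  have "sqrt x * a * (sqrt x * b) = (sqrt x * sqrt x) * (a * b)" by (simp only: mult_ac)
  then show ?thesis using assms by simp
qed

lemma dst_gram:
  assumes "i \<in> {1..n}" "j \<in> {1..n}"
  shows "(\<Sum>q=1..n. dst n q i * dst n q j) = (if i = j then 1 else 0)"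
proof -
  have "(\<Sum>q=1..n. dst n q i * dst n q j)
    = (\<Sum>q=1..n. 1 / (real n + 1) * (cos (pi * real i * real q / (real n + 1) - pi * real j * real q / (real n + 1))
       - cos (pi * real i * real q / (real n + 1) + pi * real j * real q / (real n + 1))))"
    by (intro sum.cong refl) (simp add: dst_def sqrt_mult_sqrt_mult cos_add cos_diff)
  also have "\<dots> = (if i = j then 1 else 0)"
    unfolding sum_distrib_left[symmetric] sum_subtractf sum_cos_difference[OF assms] sum_cos_sum[OF assms] by simp
  finally show ?thesis .
qed

text \<open>
  The columns of the cosine transform would be orthonormal if the end points \<open>q = 0\<close> and
  \<open>q = n + 1\<close> were included with half weights. Their absence subtracts a positive semidefinite
  matrix of rank at most two, so the transform is a contraction.
\<close>

lemma dct_gram: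
  assumes "i \<in> {1..n}" "j \<in> {1..n}"
  shows "(\<Sum>q=1..n. dct n q i * dct n q j) = (if i = j then 1 else 0) - (1 + (-1) ^ i * (-1) ^ j) / (real n + 1)"
proof -
  have "(\<Sum>q=1..n. dct n q i * dct n q j)
    = (\<Sum>q=1..n. 1 / (real n + 1) * (cos (pi * real i * real q / (real n + 1) - pi * real j * real q / (real n + 1))
       + cos (pi * real i * real q / (real n + 1) + pi * real j * real q / (real n + 1))))"
    by (intro sum.cong refl) (simp add: dct_def sqrt_mult_sqrt_mult cos_add cos_diff)
  also have "\<dots> = (if i = j then 1 else 0) - (1 + (-1) ^ i * (-1) ^ j) / (real n + 1)"
    unfolding sum_distrib_left[symmetric] sum.distrib sum_cos_difference[OF assms] sum_cos_sum[OF assms]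
    by (simp add: field_simps)
  finally show ?thesis .
qed

lemma sum_square_gram:
  fixes A :: "'a \<Rightarrow> 'b \<Rightarrow> real"
  shows "(\<Sum>q\<in>Q. (\<Sum>j\<in>J. A q j * v j)\<^sup>2) = (\<Sum>i\<in>J. \<Sum>j\<in>J. v i * v j * (\<Sum>q\<in>Q. A q i * A q j))"
proof -
  have "(\<Sum>q\<in>Q. (\<Sum>j\<in>J. A q j * v j)\<^sup>2) = (\<Sum>q\<in>Q. \<Sum>i\<in>J. \<Sum>j\<in>J. v i * v j * (A q i * A q j))"
    unfolding power2_eq_square sum_product by (intro sum.cong refl) (simp add: mult_ac)
  also have "\<dots> = (\<Sum>i\<in>J. \<Sum>j\<in>J. \<Sum>q\<in>Q. v i * v j * (A q i * A q j))"
    by (subst sum.swap, intro sum.cong refl, rule sum.swap)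
  finally show ?thesis by (simp only: sum_distrib_left)
qed

lemma dst_isometry: "(\<Sum>q\<in>{1..n}. (\<Sum>j\<in>{1..n}. dst n q j * v j)\<^sup>2) = (\<Sum>j\<in>{1..n}. (v j)\<^sup>2)"
proof -
  have "(\<Sum>q\<in>{1..n}. (\<Sum>j\<in>{1..n}. dst n q j * v j)\<^sup>2) = (\<Sum>i\<in>{1..n}. \<Sum>j\<in>{1..n}. v i * v j * (if i = j then 1 else 0))"
    unfolding sum_square_gram by (intro sum.cong refl) (simp only: dst_gram)
  also have "\<dots> = (\<Sum>j\<in>{1..n}. (v j)\<^sup>2)"
    by (intro sum.cong refl) (simp add: power2_eq_square sum.delta if_distrib cong: if_cong)
  finally show ?thesis .
qed

lemma dct_contraction: "(\<Sum>q\<in>{1..n}. (\<Sum>j\<in>{1..n}. dct n q j * v j)\<^sup>2) \<le> (\<Sum>j\<in>{1..n}. (v j)\<^sup>2)"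
proof -
  have "(\<Sum>q\<in>{1..n}. (\<Sum>j\<in>{1..n}. dct n q j * v j)\<^sup>2)
     = (\<Sum>i\<in>{1..n}. \<Sum>j\<in>{1..n}. v i * v j * ((if i = j then 1 else 0) - (1 + (-1) ^ i * (-1) ^ j) / (real n + 1)))"
    unfolding sum_square_gram by (intro sum.cong refl) (simp only: dct_gram)
  also have "\<dots> = (\<Sum>i\<in>{1..n}. \<Sum>j\<in>{1..n}. v i * v j * (if i = j then 1 else 0))
      - ((\<Sum>i\<in>{1..n}. \<Sum>j\<in>{1..n}. v i * v j) + (\<Sum>i\<in>{1..n}. \<Sum>j\<in>{1..n}. ((-1) ^ i * v i) * ((-1) ^ j * v j))) / (real n + 1)"
    unfolding sum_divide_distrib sum.distrib[symmetric] sum_subtractf[symmetric]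
    by (intro sum.cong refl) (simp add: algebra_simps diff_divide_distrib add_divide_distrib)
  also have "(\<Sum>i\<in>{1..n}. \<Sum>j\<in>{1..n}. v i * v j * (if i = j then 1 else 0)) = (\<Sum>j\<in>{1..n}. (v j)\<^sup>2)"
    by (intro sum.cong refl) (simp add: power2_eq_square sum.delta if_distrib cong: if_cong)
  also have "(\<Sum>i\<in>{1..n}. \<Sum>j\<in>{1..n}. v i * v j) = (\<Sum>i\<in>{1..n}. v i)\<^sup>2"
    by (simp add: power2_eq_square sum_product)
  also have "(\<Sum>i\<in>{1..n}. \<Sum>j\<in>{1..n}. ((-1) ^ i * v i) * ((-1) ^ j * v j)) = (\<Sum>i\<in>{1..n}. (-1) ^ i * v i)\<^sup>2"
    by (simp only: power2_eq_square sum_product)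
  finally show ?thesis by simp
qed

section \<open>Tensor products\<close>

lemma sum_PiE_insert:
  assumes "k \<notin> K"
  shows "(\<Sum>q\<in>insert k K \<rightarrow>\<^sub>E G. f q) = (\<Sum>a\<in>G. \<Sum>q\<in>K \<rightarrow>\<^sub>E G. f (q(k := a)))"
proof -
  have "(\<Sum>q\<in>insert k K \<rightarrow>\<^sub>E G. f q) = (\<Sum>(a, q)\<in>G \<times> (K \<rightarrow>\<^sub>E G). f (q(k := a)))"
    unfolding PiE_insert_eq
    by (subst sum.reindex) (use inj_combinator[OF assms, of "\<lambda>_. G"] in \<open>auto simp: case_prod_beta\<close>)
  then show ?thesis by (simp add: sum.cartesian_product)
qed

text \<open>
  One coordinate at a time: the transform in the new coordinate acts on the slices of the
  transform in the old ones. The relation \<open>R\<close> allows the same induction to serve isometries and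
  contractions.
\<close>

lemma tensor_transform:
  fixes A :: "'k \<Rightarrow> 'a \<Rightarrow> 'a \<Rightarrow> real" and R :: "real \<Rightarrow> real \<Rightarrow> bool"
  assumes "finite K" and R: "R = (\<le>) \<or> R = (=)"
    and A: "\<And>k v. k \<in> K \<Longrightarrow> R (\<Sum>a\<in>G. (\<Sum>b\<in>G. A k a b * v b)\<^sup>2) (\<Sum>b\<in>G. (v b)\<^sup>2)"
  shows "R (\<Sum>q\<in>K \<rightarrow>\<^sub>E G. (\<Sum>j\<in>K \<rightarrow>\<^sub>E G. (\<Prod>k\<in>K. A k (q k) (j k)) * v j)\<^sup>2) (\<Sum>j\<in>K \<rightarrow>\<^sub>E G. (v j)\<^sup>2)"
  using assms(1) A
proof (induction K arbitrary: v rule: finite_induct)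
  case empty
  then show ?case using R by auto
next
  case (insert k K)
  define P where "P = K \<rightarrow>\<^sub>E G"
  have Rtrans: "R x z" if "R x y" "R y z" for x y z using R that by auto
  have Rsum': "R (\<Sum>i\<in>I. f i) (\<Sum>i\<in>I. g i)" if "\<And>i. i \<in> I \<Longrightarrow> R (f i) (g i)" for I :: "'a set" and f g
    using R that by (auto intro: sum_mono sum.cong)
  have Rsum'': "R (\<Sum>i\<in>I. f i) (\<Sum>i\<in>I. g i)" if "\<And>i. i \<in> I \<Longrightarrow> R (f i) (g i)" for I :: "('k \<Rightarrow> 'a) set" and f g
    using R that by (auto intro: sum_mono sum.cong)
  define w where "w q b = (\<Sum>j\<in>P. (\<Prod>l\<in>K. A l (q l) (j l)) * v (j(k := b)))" for q b
  have prod_upd: "(\<Prod>l\<in>insert k K. A l ((q(k := a)) l) ((j(k := b)) l)) = A k a b * (\<Prod>l\<in>K. A l (q l) (j l))" for q j a b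
  proof -
    have "(\<Prod>l\<in>K. A l ((q(k := a)) l) ((j(k := b)) l)) = (\<Prod>l\<in>K. A l (q l) (j l))"
      using insert.hyps by (intro prod.cong refl) auto
    then show ?thesis using insert.hyps by simp
  qed
  have "(\<Sum>q\<in>insert k K \<rightarrow>\<^sub>E G. (\<Sum>j\<in>insert k K \<rightarrow>\<^sub>E G. (\<Prod>l\<in>insert k K. A l (q l) (j l)) * v j)\<^sup>2)
      = (\<Sum>a\<in>G. \<Sum>q\<in>P. (\<Sum>b\<in>G. A k a b * w q b)\<^sup>2)"
    unfolding sum_PiE_insert[OF insert.hyps(2)] prod_upd w_def P_def[symmetric]
    by (simp only: sum_distrib_left mult.assoc)
  also have "\<dots> = (\<Sum>q\<in>P. \<Sum>a\<in>G. (\<Sum>b\<in>G. A k a b * w q b)\<^sup>2)" by (rule sum.swap)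
  finally have eq: "(\<Sum>q\<in>insert k K \<rightarrow>\<^sub>E G. (\<Sum>j\<in>insert k K \<rightarrow>\<^sub>E G. (\<Prod>l\<in>insert k K. A l (q l) (j l)) * v j)\<^sup>2)
      = (\<Sum>q\<in>P. \<Sum>a\<in>G. (\<Sum>b\<in>G. A k a b * w q b)\<^sup>2)" .
  have step: "R (\<Sum>q\<in>P. \<Sum>a\<in>G. (\<Sum>b\<in>G. A k a b * w q b)\<^sup>2) (\<Sum>q\<in>P. \<Sum>b\<in>G. (w q b)\<^sup>2)"
    by (rule Rsum'') (rule insert.prems, simp)
  have rest: "R (\<Sum>b\<in>G. \<Sum>q\<in>P. (w q b)\<^sup>2) (\<Sum>b\<in>G. \<Sum>j\<in>P. (v (j(k := b)))\<^sup>2)"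
  proof (rule Rsum')
    fix b
    show "R (\<Sum>q\<in>P. (w q b)\<^sup>2) (\<Sum>j\<in>P. (v (j(k := b)))\<^sup>2)"
      unfolding w_def P_def
    proof (rule insert.IH)
      show "R (\<Sum>a\<in>G. (\<Sum>b\<in>G. A l a b * u b)\<^sup>2) (\<Sum>b\<in>G. (u b)\<^sup>2)" if "l \<in> K" for l u
        using that by (intro insert.prems) simp
    qed
  qed
  have swap: "(\<Sum>q\<in>P. \<Sum>b\<in>G. (w q b)\<^sup>2) = (\<Sum>b\<in>G. \<Sum>q\<in>P. (w q b)\<^sup>2)" by (rule sum.swap)
  have "R (\<Sum>q\<in>P. \<Sum>a\<in>G. (\<Sum>b\<in>G. A k a b * w q b)\<^sup>2) (\<Sum>b\<in>G. \<Sum>j\<in>P. (v (j(k := b)))\<^sup>2)"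
    by (rule Rtrans[OF step]) (subst swap, rule rest)
  then show ?case
    unfolding eq sum_PiE_insert[OF insert.hyps(2), of "\<lambda>j. (v j)\<^sup>2"] P_def[symmetric] .
qed

section \<open>The collocation matrix\<close>

definition sine_tensor :: "nat \<Rightarrow> nat \<Rightarrow> (nat \<Rightarrow> nat) \<Rightarrow> (nat \<Rightarrow> nat) \<Rightarrow> real" where
  "sine_tensor d n q j = (\<Prod>l=1..d. dst n (q l) (j l))"

text \<open>
  The factor in direction \<open>k\<close> is the cosine transform, because the \<open>k\<close>-th partial derivative turns
  the sine in this direction into a cosine.
\<close>

definition mixed_tensor :: "nat \<Rightarrow> nat \<Rightarrow> nat \<Rightarrow> (nat \<Rightarrow> nat) \<Rightarrow> (nat \<Rightarrow> nat) \<Rightarrow> real" where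
  "mixed_tensor d n k q j = (\<Prod>l=1..d. (if l = k then dct else dst) n (q l) (j l))"

definition grad_weight :: "nat \<Rightarrow> nat \<Rightarrow> (nat \<Rightarrow> nat) \<Rightarrow> real" where
  "grad_weight d k j = real (j k) / (\<Sum>l=1..d. (real (j l))\<^sup>2)"

lemma sine_tensor_isometry:
  "(\<Sum>q\<in>grid d n. (\<Sum>j\<in>grid d n. sine_tensor d n q j * v j)\<^sup>2) = (\<Sum>j\<in>grid d n. (v j)\<^sup>2)"
  unfolding grid_def sine_tensor_def
  by (rule tensor_transform[where R = "(=)"]) (auto intro: dst_isometry[simplified])

lemma mixed_tensor_contraction:
  "(\<Sum>q\<in>grid d n. (\<Sum>j\<in>grid d n. mixed_tensor d n k q j * v j)\<^sup>2) \<le> (\<Sum>j\<in>grid d n. (v j)\<^sup>2)"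
  unfolding grid_def mixed_tensor_def
proof (rule tensor_transform[where R = "(\<le>)"])
  fix l and v :: "nat \<Rightarrow> real"
  show "(\<Sum>a\<in>{1..n}. (\<Sum>b\<in>{1..n}. (if l = k then dct else dst) n a b * v b)\<^sup>2) \<le> (\<Sum>b\<in>{1..n}. (v b)\<^sup>2)"
    using dct_contraction[of n v] dst_isometry[of n v] by (cases "l = k") simp_all
qed auto

text \<open>
  The weight is at most \<open>1 / j k\<close>.
\<close>

lemma grad_weight_bounds:
  assumes "k \<in> {1..d}"
  shows "0 \<le> grad_weight d k j" "grad_weight d k j \<le> 1"
proof -
  have "real (j k) \<le> (real (j k))\<^sup>2"
    by (cases "j k") (auto simp: power2_eq_square)
  also have "\<dots> \<le> (\<Sum>l=1..d. (real (j l))\<^sup>2)" using assms by (intro member_le_sum) auto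
  finally show "grad_weight d k j \<le> 1" by (auto simp: grad_weight_def divide_le_eq_1)
  show "0 \<le> grad_weight d k j" by (auto simp: grad_weight_def intro!: divide_nonneg_nonneg sum_nonneg)
qed

lemma sine_basis_coeff:
  "1 / (real n + 1) powr (real d / 2) * (2 powr (real d / 2) / (pi\<^sup>2 * c)) = sqrt (2 / (real n + 1)) ^ d / (pi\<^sup>2 * c)"
proof -
  have "sqrt (2 / (real n + 1)) ^ d = ((2 / (real n + 1)) powr (1 / 2)) powr real d"
    by (simp add: powr_half_sqrt powr_realpow)
  also have "\<dots> = (2 / (real n + 1)) powr (real d / 2)" by (simp add: powr_powr)
  also have "\<dots> = 2 powr (real d / 2) / (real n + 1) powr (real d / 2)" by (simp add: powr_divide)
  finally show ?thesis by simp
qed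

lemma sine_basis_split:
  assumes "k \<in> {1..d}"
  shows "sine_basis d n j (x(k := t)) =
    sqrt (2 / (real n + 1)) ^ d / (pi\<^sup>2 * (\<Sum>l=1..d. (real (j l))\<^sup>2)) *
    (sin (pi * real (j k) * t) * (\<Prod>l\<in>{1..d} - {k}. sin (pi * real (j l) * x l)))"
proof -
  have "(\<Prod>l=1..d. sin (pi * real (j l) * (x(k := t)) l)) =
     sin (pi * real (j k) * t) * (\<Prod>l\<in>{1..d} - {k}. sin (pi * real (j l) * (x(k := t)) l))"
    using assms by (subst prod.remove[of _ k]) auto
  also have "(\<Prod>l\<in>{1..d} - {k}. sin (pi * real (j l) * (x(k := t)) l)) = (\<Prod>l\<in>{1..d} - {k}. sin (pi * real (j l) * x l))"
    by (intro prod.cong) auto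
  finally show ?thesis unfolding sine_basis_def sine_basis_coeff by simp
qed

lemma grad_sine_basis:
  assumes "k \<in> {1..d}"
  shows "grad d (sine_basis d n j) x k =
    sqrt (2 / (real n + 1)) ^ d / (pi\<^sup>2 * (\<Sum>l=1..d. (real (j l))\<^sup>2)) *
    (pi * real (j k) * cos (pi * real (j k) * x k) * (\<Prod>l\<in>{1..d} - {k}. sin (pi * real (j l) * x l)))"
proof -
  have "((\<lambda>t. sine_basis d n j (x(k := t))) has_real_derivative
    sqrt (2 / (real n + 1)) ^ d / (pi\<^sup>2 * (\<Sum>l=1..d. (real (j l))\<^sup>2)) *
    (pi * real (j k) * cos (pi * real (j k) * x k) * (\<Prod>l\<in>{1..d} - {k}. sin (pi * real (j l) * x l)))) (at (x k))"
  proof -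
    have "((\<lambda>t. C * (sin (w * t) * P)) has_real_derivative C * (w * cos (w * y) * P)) (at y)" for C w P y :: real
      by (auto intro!: derivative_eq_intros)
    then show ?thesis unfolding sine_basis_split[OF assms] .
  qed
  then show ?thesis using assms by (simp add: grad_def partial_deriv_def DERIV_imp_deriv)
qed

text \<open>
  By the product rule, the second derivatives of the basis function add up to a multiple of it
  that cancels \<open>\<parallel>j\<parallel>\<^sup>2\<close> in the normalization, which leaves the sine transform. The terms with the
  gradient of \<open>\<eta>\<close> contain a single derivative, which changes one sine into a cosine.
\<close>

lemma colloc_entry_eq:
  assumes j: "j \<in> grid d n" and q: "q \<in> grid d n" and d: "d \<ge> 1" and z: "z = colloc_point d n q"
    and \<eta>: "\<And>k. k \<in> {1..d} \<Longrightarrow> (\<lambda>t. \<eta> (z(k := t))) differentiable at (z k)"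
  shows "colloc_entry d n \<eta> q j = - \<eta> z * sine_tensor d n q j
     + (\<Sum>k=1..d. grad d \<eta> z k * (1 / pi * grad_weight d k j) * mixed_tensor d n k q j)"
proof -
  define J where "J = (\<Sum>l=1..d. (real (j l))\<^sup>2)"
  define c where "c = sqrt (2 / (real n + 1)) ^ d / (pi\<^sup>2 * J)"
  define rest where "rest k = (\<Prod>l\<in>{1..d} - {k}. sin (pi * real (j l) * z l))" for k
  have J: "J > 0"
  proof -
    have "1 \<le> j 1" using j d by (auto simp: grid_def PiE_iff)
    then have "0 < (real (j 1))\<^sup>2" by simp
    also have "\<dots> \<le> J" unfolding J_def using d by (intro member_le_sum) auto
    finally show ?thesis .
  qed
  have arg: "pi * real (j l) * z l = pi * real (j l) * real (q l) / (real n + 1)" if "l \<in> {1..d}" for l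
    using that by (simp add: z colloc_point_def)
  have sine: "sine_tensor d n q j = sqrt (2 / (real n + 1)) ^ d * (sin (pi * real (j k) * z k) * rest k)" if k: "k \<in> {1..d}" for k
  proof -
    have "sine_tensor d n q j = (\<Prod>l=1..d. sqrt (2 / (real n + 1)) * sin (pi * real (j l) * z l))"
      unfolding sine_tensor_def dst_def by (intro prod.cong refl) (simp only: arg)
    also have "\<dots> = sqrt (2 / (real n + 1)) ^ d * (\<Prod>l=1..d. sin (pi * real (j l) * z l))"
      by (simp add: prod.distrib)
    also have "(\<Prod>l=1..d. sin (pi * real (j l) * z l)) = sin (pi * real (j k) * z k) * rest k"
      unfolding rest_def using k by (subst prod.remove[of _ k]) auto
    finally show ?thesis .
  qed
  have mixed: "mixed_tensor d n k q j = sqrt (2 / (real n + 1)) ^ d * (cos (pi * real (j k) * z k) * rest k)" if k: "k \<in> {1..d}" for k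
  proof -
    have "mixed_tensor d n k q j = (\<Prod>l=1..d. sqrt (2 / (real n + 1)) * (if l = k then cos (pi * real (j l) * z l) else sin (pi * real (j l) * z l)))"
      unfolding mixed_tensor_def by (intro prod.cong refl) (simp add: dst_def dct_def arg)
    also have "\<dots> = sqrt (2 / (real n + 1)) ^ d * (\<Prod>l=1..d. if l = k then cos (pi * real (j l) * z l) else sin (pi * real (j l) * z l))"
      by (simp add: prod.distrib)
    also have "(\<Prod>l=1..d. if l = k then cos (pi * real (j l) * z l) else sin (pi * real (j l) * z l)) = cos (pi * real (j k) * z k) * rest k"
      unfolding rest_def using k by (subst prod.remove[of _ k]) (auto intro!: prod.cong)
    finally show ?thesis .
  qed
  have flux: "partial_deriv k (\<lambda>x. \<eta> x * grad d (sine_basis d n j) x k) z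
     = grad d \<eta> z k * (1 / pi * grad_weight d k j) * mixed_tensor d n k q j - \<eta> z * sine_tensor d n q j * ((real (j k))\<^sup>2 / J)"
    if k: "k \<in> {1..d}" for k
  proof -
    have eta: "((\<lambda>t. \<eta> (z(k := t))) has_real_derivative grad d \<eta> z k) (at (z k))"
      using \<eta>[OF k] k by (simp add: grad_def partial_deriv_def DERIV_deriv_iff_real_differentiable)
    have rest_upd: "(\<Prod>l\<in>{1..d} - {k}. sin (pi * real (j l) * (z(k := t)) l)) = rest k" for t
      unfolding rest_def by (intro prod.cong) auto
    have flux_eq: "grad d (sine_basis d n j) (z(k := t)) k = c * (pi * real (j k) * cos (pi * real (j k) * t) * rest k)" for t
      unfolding grad_sine_basis[OF k] rest_upd by (simp add: c_def J_def)
    have "((\<lambda>t. \<eta> (z(k := t)) * (c * (pi * real (j k) * cos (pi * real (j k) * t) * rest k))) has_real_derivative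
       (grad d \<eta> z k * (c * (pi * real (j k) * cos (pi * real (j k) * z k) * rest k))
        + (c * (pi * real (j k) * (- sin (pi * real (j k) * z k) * (pi * real (j k))) * rest k)) * \<eta> (z(k := z k)))) (at (z k))"
      by (rule DERIV_mult[OF eta]) (auto intro!: derivative_eq_intros)
    then have "partial_deriv k (\<lambda>x. \<eta> x * grad d (sine_basis d n j) x k) z =
       grad d \<eta> z k * (c * (pi * real (j k) * cos (pi * real (j k) * z k) * rest k))
        + (c * (pi * real (j k) * (- sin (pi * real (j k) * z k) * (pi * real (j k))) * rest k)) * \<eta> z"
      unfolding partial_deriv_def flux_eq by (simp add: DERIV_imp_deriv)
    also have "\<dots> = grad d \<eta> z k * (1 / pi * grad_weight d k j) * mixed_tensor d n k q j - \<eta> z * sine_tensor d n q j * ((real (j k))\<^sup>2 / J)"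
      unfolding mixed[OF k] sine[OF k] c_def grad_weight_def J_def[symmetric]
      using J by (simp add: power2_eq_square field_simps)
    finally show ?thesis .
  qed
  have "colloc_entry d n \<eta> q j = (\<Sum>k=1..d. grad d \<eta> z k * (1 / pi * grad_weight d k j) * mixed_tensor d n k q j)
     - (\<Sum>k=1..d. \<eta> z * sine_tensor d n q j * ((real (j k))\<^sup>2 / J))"
    unfolding colloc_entry_def divergence_def z[symmetric] sum_subtractf[symmetric]
    by (intro sum.cong refl flux) auto
  also have "(\<Sum>k=1..d. \<eta> z * sine_tensor d n q j * ((real (j k))\<^sup>2 / J)) = \<eta> z * sine_tensor d n q j * (J / J)"
    unfolding sum_distrib_left[symmetric] sum_divide_distrib[symmetric] by (simp only: J_def)
  finally show ?thesis using J by simp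
qed

lemma L2_set_sum_le: "finite K \<Longrightarrow> L2_set (\<lambda>q. \<Sum>k\<in>K. f k q) G \<le> (\<Sum>k\<in>K. L2_set (f k) G)"
proof (induction K rule: finite_induct)
  case (insert k K)
  have "L2_set (\<lambda>q. f k q + (\<Sum>k\<in>K. f k q)) G \<le> L2_set (f k) G + L2_set (\<lambda>q. \<Sum>k\<in>K. f k q) G"
    by (rule L2_set_triangle_ineq)
  then show ?case using insert by simp
qed (simp add: L2_set_def)

lemma L2_set_scaled_le:
  assumes "\<And>q. q \<in> G \<Longrightarrow> \<bar>a q\<bar> \<le> E" "E \<ge> 0"
  shows "L2_set (\<lambda>q. a q * f q) G \<le> E * L2_set f G"
proof -
  have "L2_set (\<lambda>q. a q * f q) G = L2_set (\<lambda>q. \<bar>a q\<bar> * \<bar>f q\<bar>) G"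
    by (simp add: L2_set_def power_mult_distrib)
  also have "\<dots> \<le> L2_set (\<lambda>q. E * \<bar>f q\<bar>) G"
    using assms by (intro L2_set_mono mult_right_mono) auto
  also have "\<dots> = E * L2_set (\<lambda>q. \<bar>f q\<bar>) G" using assms by (simp add: L2_set_right_distrib)
  finally show ?thesis by (simp add: L2_set_def)
qed

text \<open>
  The operator is a diagonal multiple of the isometry \<open>F\<close> plus, for each \<open>k\<close>, a diagonal multiple
  of the contraction \<open>H k\<close>. The upper bound is the triangle inequality; for the lower bound the
  square is expanded and only the mixed term is estimated, by the Cauchy--Schwarz inequality.
\<close>

lemma colloc_norm_bounds:
  fixes \<eta> :: "(nat \<Rightarrow> nat) \<Rightarrow> real" and g :: "nat \<Rightarrow> (nat \<Rightarrow> nat) \<Rightarrow> real" and v :: "(nat \<Rightarrow> nat) \<Rightarrow> real"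
  assumes \<eta>: "\<And>q. q \<in> grid d n \<Longrightarrow> \<bar>\<eta> q\<bar> \<le> E" "\<And>q. q \<in> grid d n \<Longrightarrow> \<mu> \<le> \<eta> q" and pos: "\<mu> > 0" "E \<ge> 0"
    and g: "\<And>k q. k \<in> {1..d} \<Longrightarrow> q \<in> grid d n \<Longrightarrow> \<bar>g k q\<bar> \<le> S k" "\<And>k. k \<in> {1..d} \<Longrightarrow> S k \<ge> 0"
    and B: "\<And>q j. q \<in> grid d n \<Longrightarrow> j \<in> grid d n \<Longrightarrow> B q j = - \<eta> q * sine_tensor d n q j
       + (\<Sum>k=1..d. g k q * (1 / pi * grad_weight d k j) * mixed_tensor d n k q j)"
  defines "V \<equiv> (\<Sum>j\<in>grid d n. (v j)\<^sup>2)" and "W \<equiv> (\<Sum>q\<in>grid d n. (\<Sum>j\<in>grid d n. B q j * v j)\<^sup>2)"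
  shows "(\<mu>\<^sup>2 - 2 / pi * E * (\<Sum>k=1..d. S k)) * V \<le> W" "W \<le> (E + 1 / pi * (\<Sum>k=1..d. S k))\<^sup>2 * V"
proof -
  define G where "G = grid d n"
  define F where "F q = (\<Sum>j\<in>G. sine_tensor d n q j * v j)" for q
  define H where "H k q = (\<Sum>j\<in>G. mixed_tensor d n k q j * (grad_weight d k j * v j))" for k q
  define a where "a q = \<eta> q * F q" for q
  define e where "e q = (\<Sum>k=1..d. (1 / pi * g k q) * H k q)" for q
  define N where "N = sqrt V"
  have V0: "V \<ge> 0" by (simp add: V_def sum_nonneg)
  have N: "N \<ge> 0" "N\<^sup>2 = V" using V0 by (auto simp: N_def)
  have split: "(\<Sum>j\<in>G. B q j * v j) = e q - a q" if "q \<in> G" for q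
  proof -
    have "(\<Sum>j\<in>G. B q j * v j) = (\<Sum>j\<in>G. (\<Sum>k=1..d. (1 / pi * g k q) * (mixed_tensor d n k q j * (grad_weight d k j * v j))) - \<eta> q * (sine_tensor d n q j * v j))"
    proof (rule sum.cong[OF refl])
      fix j assume "j \<in> G"
      then have "B q j * v j = (\<Sum>k=1..d. g k q * (1 / pi * grad_weight d k j) * mixed_tensor d n k q j) * v j - \<eta> q * (sine_tensor d n q j * v j)"
        using that by (simp add: B G_def left_diff_distrib)
      also have "(\<Sum>k=1..d. g k q * (1 / pi * grad_weight d k j) * mixed_tensor d n k q j) * v j
          = (\<Sum>k=1..d. (1 / pi * g k q) * (mixed_tensor d n k q j * (grad_weight d k j * v j)))"
        unfolding sum_distrib_right by (intro sum.cong refl) simp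
      finally show "B q j * v j = (\<Sum>k=1..d. (1 / pi * g k q) * (mixed_tensor d n k q j * (grad_weight d k j * v j))) - \<eta> q * (sine_tensor d n q j * v j)" .
    qed
    also have "\<dots> = (\<Sum>j\<in>G. \<Sum>k=1..d. (1 / pi * g k q) * (mixed_tensor d n k q j * (grad_weight d k j * v j))) - a q"
      by (simp only: sum_subtractf a_def F_def sum_distrib_left)
    also have "(\<Sum>j\<in>G. \<Sum>k=1..d. (1 / pi * g k q) * (mixed_tensor d n k q j * (grad_weight d k j * v j))) = e q"
      unfolding e_def H_def sum_distrib_left by (rule sum.swap)
    finally show ?thesis .
  qed
  \<comment> \<open>From here on \<open>N\<close> is the norm of \<open>v\<close>.\<close>
  have F_norm: "L2_set F G = N" by (simp add: L2_set_def F_def N_def V_def G_def sine_tensor_isometry)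
  have H_norm: "L2_set (H k) G \<le> N" if "k \<in> {1..d}" for k
  proof -
    have "(\<Sum>q\<in>G. (H k q)\<^sup>2) \<le> (\<Sum>j\<in>G. (grad_weight d k j * v j)\<^sup>2)"
      unfolding H_def G_def by (rule mixed_tensor_contraction)
    also have "\<dots> \<le> V" unfolding V_def G_def
    proof (rule sum_mono)
      fix j
      have "(grad_weight d k j)\<^sup>2 \<le> 1" using grad_weight_bounds[OF that] by (simp add: power_le_one)
      then show "(grad_weight d k j * v j)\<^sup>2 \<le> (v j)\<^sup>2"
        unfolding power_mult_distrib using mult_right_mono[of "(grad_weight d k j)\<^sup>2" 1 "(v j)\<^sup>2"] by simp
    qed
    finally show ?thesis by (simp add: L2_set_def N_def)
  qed
  have a_upper: "L2_set a G \<le> E * N"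
    unfolding a_def F_norm[symmetric] using \<eta>(1) pos by (intro L2_set_scaled_le) (auto simp: G_def)
  have e_upper: "L2_set e G \<le> (1 / pi * (\<Sum>k=1..d. S k)) * N"
  proof -
    have "L2_set e G \<le> (\<Sum>k=1..d. L2_set (\<lambda>q. (1 / pi * g k q) * H k q) G)"
      unfolding e_def by (rule L2_set_sum_le) simp
    also have "\<dots> \<le> (\<Sum>k=1..d. (1 / pi * S k) * N)"
    proof (rule sum_mono)
      fix k assume k: "k \<in> {1..d}"
      have "L2_set (\<lambda>q. (1 / pi * g k q) * H k q) G \<le> (1 / pi * S k) * L2_set (H k) G"
        using g k by (intro L2_set_scaled_le) (auto simp: G_def abs_mult intro!: divide_right_mono)
      also have "\<dots> \<le> (1 / pi * S k) * N" using H_norm[OF k] g(2)[OF k] by (intro mult_left_mono) auto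
      finally show "L2_set (\<lambda>q. (1 / pi * g k q) * H k q) G \<le> (1 / pi * S k) * N" .
    qed
    also have "\<dots> = (1 / pi * (\<Sum>k=1..d. S k)) * N" by (simp only: sum_distrib_left sum_distrib_right)
    finally show ?thesis .
  qed
  have W_eq: "W = (\<Sum>q\<in>G. (e q - a q)\<^sup>2)" unfolding W_def G_def[symmetric] by (intro sum.cong refl) (simp add: split)
  have sqrt_W: "sqrt W \<le> (E + 1 / pi * (\<Sum>k=1..d. S k)) * N"
  proof -
    have "sqrt W = L2_set (\<lambda>q. e q + (- a q)) G" by (simp add: W_eq L2_set_def)
    also have "\<dots> \<le> L2_set e G + L2_set (\<lambda>q. - a q) G" by (rule L2_set_triangle_ineq)
    also have "L2_set (\<lambda>q. - a q) G = L2_set a G" by (simp add: L2_set_def)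
    finally show ?thesis using a_upper e_upper by (simp add: distrib_right)
  qed
  have "W \<le> ((E + 1 / pi * (\<Sum>k=1..d. S k)) * N)\<^sup>2" by (rule sqrt_le_D[OF sqrt_W])
  then show "W \<le> (E + 1 / pi * (\<Sum>k=1..d. S k))\<^sup>2 * V" unfolding power_mult_distrib N(2) .
  define Z where "Z = (1 / pi * (\<Sum>k=1..d. S k)) * E * V"
  have "\<mu>\<^sup>2 * V \<le> (\<Sum>q\<in>G. (a q)\<^sup>2)"
  proof -
    have "\<mu>\<^sup>2 * V = (\<Sum>q\<in>G. \<mu>\<^sup>2 * (F q)\<^sup>2)"
      unfolding sum_distrib_left[symmetric] F_def G_def sine_tensor_isometry V_def ..
    also have "\<dots> \<le> (\<Sum>q\<in>G. (\<eta> q)\<^sup>2 * (F q)\<^sup>2)"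
      using \<eta>(2) pos by (intro sum_mono mult_right_mono power_mono) (auto simp: G_def)
    finally show ?thesis by (simp add: a_def power_mult_distrib)
  qed
  moreover have "(\<Sum>q\<in>G. e q * a q) \<le> Z"
  proof -
    have "(\<Sum>q\<in>G. e q * a q) \<le> (\<Sum>q\<in>G. \<bar>e q\<bar> * \<bar>a q\<bar>)"
      by (intro sum_mono) (simp add: abs_mult[symmetric])
    also have "\<dots> \<le> L2_set e G * L2_set a G" by (rule L2_set_mult_ineq)
    also have "\<dots> \<le> ((1 / pi * (\<Sum>k=1..d. S k)) * N) * (E * N)"
      by (rule mult_mono[OF e_upper a_upper order_trans[OF L2_set_nonneg e_upper] L2_set_nonneg])
    also have "\<dots> = (1 / pi * (\<Sum>k=1..d. S k)) * E * N\<^sup>2" by (simp add: power2_eq_square)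
    finally show ?thesis by (simp only: N Z_def)
  qed
  moreover have "W = (\<Sum>q\<in>G. (a q)\<^sup>2) + (\<Sum>q\<in>G. (e q)\<^sup>2) - 2 * (\<Sum>q\<in>G. e q * a q)"
    unfolding W_eq by (simp add: power2_diff sum.distrib sum_subtractf sum_distrib_left mult.assoc)
  moreover have "(\<Sum>q\<in>G. (e q)\<^sup>2) \<ge> 0" by (simp add: sum_nonneg)
  ultimately have "\<mu>\<^sup>2 * V - 2 * Z \<le> W" by linarith
  moreover have "(a - 2 / pi * c * t) * y = a * y - 2 * ((1 / pi * t) * c * y)" for a c t y :: real
    by (simp add: left_diff_distrib)
  ultimately show "(\<mu>\<^sup>2 - 2 / pi * E * (\<Sum>k=1..d. S k)) * V \<le> W" unfolding Z_def by simp
qed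

lemma abs_dst_le: "\<bar>dst n q j\<bar> \<le> sqrt (2 / (real n + 1))"
  using mult_left_mono[OF abs_sin_le_one, of "sqrt (2 / (real n + 1))"] by (simp add: dst_def abs_mult)

lemma abs_dct_le: "\<bar>dct n q j\<bar> \<le> sqrt (2 / (real n + 1))"
  using mult_left_mono[OF abs_cos_le_one, of "sqrt (2 / (real n + 1))"] by (simp add: dct_def abs_mult)

lemma abs_sine_tensor_le: "\<bar>sine_tensor d n q j\<bar> \<le> sqrt (2 / (real n + 1)) ^ d"
proof -
  have "\<bar>sine_tensor d n q j\<bar> \<le> (\<Prod>l=1..d. sqrt (2 / (real n + 1)))"
    unfolding sine_tensor_def abs_prod by (intro prod_mono conjI abs_ge_zero abs_dst_le)
  then show ?thesis by simp
qed

lemma abs_mixed_tensor_le: "\<bar>mixed_tensor d n k q j\<bar> \<le> sqrt (2 / (real n + 1)) ^ d"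
proof -
  have "\<bar>mixed_tensor d n k q j\<bar> \<le> (\<Prod>l=1..d. sqrt (2 / (real n + 1)))"
    unfolding mixed_tensor_def abs_prod by (intro prod_mono conjI abs_ge_zero) (simp add: abs_dst_le abs_dct_le)
  then show ?thesis by simp
qed

text \<open>
  Each factor of the tensor products is at most \<open>sqrt (2 / (n + 1))\<close>, and \<open>n * (2 / (n + 1)) \<le> 2\<close>.
  This is the origin of the factor \<open>2 ^ d\<close> in the number of samples.
\<close>

lemma colloc_entry_bound:
  assumes \<eta>: "\<bar>\<eta>\<bar> \<le> E" and g: "\<And>k. k \<in> {1..d} \<Longrightarrow> \<bar>g k\<bar> \<le> S k"
    and B: "B = - \<eta> * sine_tensor d n q j + (\<Sum>k=1..d. g k * (1 / pi * grad_weight d k j) * mixed_tensor d n k q j)"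
  shows "real (n ^ d) * B\<^sup>2 \<le> 2 ^ d * (E + 1 / pi * (\<Sum>k=1..d. S k))\<^sup>2"
proof -
  define c where "c = sqrt (2 / (real n + 1)) ^ d"
  have c: "c \<ge> 0" by (simp add: c_def)
  have "\<bar>- \<eta> * sine_tensor d n q j\<bar> \<le> E * c"
    unfolding abs_mult abs_minus c_def using \<eta> by (intro mult_mono abs_sine_tensor_le) auto
  moreover have "\<bar>\<Sum>k=1..d. g k * (1 / pi * grad_weight d k j) * mixed_tensor d n k q j\<bar> \<le> (\<Sum>k=1..d. S k * (1 / pi * 1) * c)"
  proof (rule order_trans[OF sum_abs sum_mono])
    fix k assume k: "k \<in> {1..d}"
    show "\<bar>g k * (1 / pi * grad_weight d k j) * mixed_tensor d n k q j\<bar> \<le> S k * (1 / pi * 1) * c"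
      unfolding abs_mult c_def using g[OF k] grad_weight_bounds[OF k]
      by (intro mult_mono abs_mixed_tensor_le) (auto intro!: divide_right_mono mult_nonneg_nonneg divide_nonneg_nonneg)
  qed
  moreover have "(\<Sum>k=1..d. S k * (1 / pi * 1) * c) = (1 / pi * (\<Sum>k=1..d. S k)) * c"
    unfolding sum_distrib_left sum_distrib_right by (intro sum.cong refl) simp
  ultimately have "\<bar>B\<bar> \<le> (E + 1 / pi * (\<Sum>k=1..d. S k)) * c" unfolding B by (simp add: distrib_right)
  then have "\<bar>B\<bar>\<^sup>2 \<le> ((E + 1 / pi * (\<Sum>k=1..d. S k)) * c)\<^sup>2" by (intro power_mono) auto
  then have "B\<^sup>2 \<le> (E + 1 / pi * (\<Sum>k=1..d. S k))\<^sup>2 * c\<^sup>2" by (simp add: power_mult_distrib)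
  then have "real (n ^ d) * B\<^sup>2 \<le> real (n ^ d) * ((E + 1 / pi * (\<Sum>k=1..d. S k))\<^sup>2 * c\<^sup>2)" by (intro mult_left_mono) auto
  also have "\<dots> = (real (n ^ d) * c\<^sup>2) * (E + 1 / pi * (\<Sum>k=1..d. S k))\<^sup>2" by simp
  also have "\<dots> \<le> 2 ^ d * (E + 1 / pi * (\<Sum>k=1..d. S k))\<^sup>2"
  proof (rule mult_right_mono)
    have "c\<^sup>2 = (sqrt (2 / (real n + 1)) * sqrt (2 / (real n + 1))) ^ d"
      unfolding c_def power2_eq_square power_mult_distrib ..
    then have "c\<^sup>2 = (2 / (real n + 1)) ^ d" by simp
    then have "real (n ^ d) * c\<^sup>2 = (real n * (2 / (real n + 1))) ^ d"
      by (simp only: power_mult_distrib of_nat_power)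
    also have "\<dots> \<le> 2 ^ d" by (intro power_mono) (auto simp: field_simps)
    finally show "real (n ^ d) * c\<^sup>2 \<le> 2 ^ d" .
  qed simp
  finally show ?thesis .
qed

section \<open>Pointwise values and the essential supremum\<close>

lemma open_cube_subset: "open_cube d \<subseteq> closed_cube d"
  unfolding open_cube_def closed_cube_def by (intro PiE_mono) auto

text \<open>
  The extensional functions on \<open>{1..d}\<close> form a full product in which the coordinates outside of
  \<open>{1..d}\<close> range over one point, so Tychonoff's theorem applies.
\<close>

lemma compact_closed_cube: "compact (closed_cube d)"
proof -
  have eq: "closed_cube d = (\<Pi>\<^sub>E i\<in>UNIV. if i \<in> {1..d} then {0..1} else {undefined})"
    unfolding closed_cube_def PiE_iff extensional_def set_eq_iff
    by (simp only: if_split_mem2 PiE_UNIV_domain Pi_iff) auto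
  have "compactin (product_topology (\<lambda>i. euclidean) UNIV) (\<Pi>\<^sub>E i\<in>(UNIV::nat set). if i \<in> {1..d} then {0..1::real} else {undefined})"
    unfolding compactin_PiE by auto
  then show ?thesis by (simp only: eq euclidean_product_topology compactin_euclidean_iff)
qed

lemma cube_min_le:
  assumes "continuous_on (closed_cube d) f" "z \<in> closed_cube d"
  shows "cube_min d f \<le> f z"
proof -
  have "compact (f ` closed_cube d)" by (rule compact_continuous_image[OF assms(1) compact_closed_cube])
  then have "bdd_below (f ` closed_cube d)" by (rule bounded_imp_bdd_below[OF compact_imp_bounded])
  then show ?thesis unfolding cube_min_def using assms(2) by (rule cINF_lower)
qed

lemma open_cube_sets: "open_cube d \<in> sets (Pi\<^sub>M {1..d} (\<lambda>_. lborel))"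
  unfolding open_cube_def by (rule sets_PiM_I_finite) auto

lemma space_restrict_open_cube: "space (restrict_space (Pi\<^sub>M {1..d} (\<lambda>_. lborel)) (open_cube d)) = open_cube d"
  using sets.sets_into_space[OF open_cube_sets] by (auto simp: space_restrict_space)

text \<open>
  The product measure lives on extensional functions of finitely many coordinates, continuity on
  all functions with the topology of infinitely many; the coordinates outside of \<open>{1..d}\<close> are
  constant there, hence harmless.
\<close>

lemma measurable_identity_PiM:
  "(\<lambda>x. x) \<in> Pi\<^sub>M {1..d::nat} (\<lambda>_. lborel) \<rightarrow>\<^sub>M (borel :: (nat \<Rightarrow> real) measure)"
proof (rule measurable_coordinatewise_then_product)
  fix i
  show "(\<lambda>x. x i) \<in> borel_measurable (Pi\<^sub>M {1..d} (\<lambda>_. lborel :: real measure))"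
  proof (cases "i \<in> {1..d}")
    case True
    then have "(\<lambda>x. x i) \<in> Pi\<^sub>M {1..d} (\<lambda>_. lborel :: real measure) \<rightarrow>\<^sub>M lborel"
      by (rule measurable_component_singleton)
    then show ?thesis by simp
  next
    case False
    have "(\<lambda>x. x i) \<in> borel_measurable (Pi\<^sub>M {1..d} (\<lambda>_. lborel :: real measure)) \<longleftrightarrow>
        (\<lambda>_. undefined :: real) \<in> borel_measurable (Pi\<^sub>M {1..d} (\<lambda>_. lborel :: real measure))"
    proof (rule measurable_cong)
      fix x assume "x \<in> space (Pi\<^sub>M {1..d} (\<lambda>_. lborel :: real measure))"
      then have "x \<in> {1..d} \<rightarrow>\<^sub>E UNIV" by (simp add: space_PiM)
      then show "x i = undefined" using False by (rule PiE_arb)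
    qed
    then show ?thesis by simp
  qed
qed

lemma measurable_continuous_extension:
  assumes g: "continuous_on (closed_cube d) g" and fg: "\<And>z. z \<in> open_cube d \<Longrightarrow> f z = g z"
  shows "(\<lambda>z. ereal \<bar>f z\<bar>) \<in> borel_measurable (restrict_space (Pi\<^sub>M {1..d} (\<lambda>_. lborel)) (open_cube d))"
proof -
  define M where "M = restrict_space (Pi\<^sub>M {1..d} (\<lambda>_. lborel :: real measure)) (open_cube d)"
  have sp: "space M = open_cube d" unfolding M_def by (rule space_restrict_open_cube)
  have "(\<lambda>x. x) \<in> M \<rightarrow>\<^sub>M borel"
    unfolding M_def by (rule measurable_restrict_space1[OF measurable_identity_PiM])
  then have "(\<lambda>x. x) \<in> M \<rightarrow>\<^sub>M restrict_space borel (closed_cube d)"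
    by (rule measurable_restrict_space2[rotated]) (use sp open_cube_subset in auto)
  then have "(\<lambda>x. g x) \<in> M \<rightarrow>\<^sub>M borel"
    by (rule measurable_compose) (rule borel_measurable_continuous_on_restrict[OF g])
  then have "(\<lambda>x. ereal \<bar>g x\<bar>) \<in> M \<rightarrow>\<^sub>M borel" by measurable
  then show ?thesis
    unfolding M_def[symmetric] by (rule measurable_cong[THEN iffD1, rotated]) (simp add: sp fg)
qed

lemma box_around:
  fixes z :: "nat \<Rightarrow> real"
  assumes A: "open A" "z \<in> A" and z: "z \<in> open_cube d"
  obtains \<rho> where "\<rho> > 0" "(\<Pi>\<^sub>E k\<in>{1..d}. {z k - \<rho> <..< z k + \<rho>}) \<subseteq> A \<inter> open_cube d"
proof -
  have "openin (product_topology (\<lambda>i. euclidean) UNIV) A" using A by (simp add: open_fun_def)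
  from product_topology_open_contains_basis[OF this A(2)]
  obtain X where X: "z \<in> (\<Pi>\<^sub>E i\<in>UNIV. X i)" "\<And>i. open (X i)" "(\<Pi>\<^sub>E i\<in>UNIV. X i) \<subseteq> A" by auto
  have "\<exists>r>0. {z k - r <..< z k + r} \<subseteq> X k \<and> {z k - r <..< z k + r} \<subseteq> {0<..<1}" if k: "k \<in> {1..d}" for k
  proof -
    have "open (X k \<inter> {0<..<1})" using X(2) by auto
    moreover have "z k \<in> X k \<inter> {0<..<1}" using X(1) z k by (auto simp: open_cube_def PiE_iff)
    ultimately obtain r where r: "r > 0" "ball (z k) r \<subseteq> X k \<inter> {0<..<1}"
      by (meson open_contains_ball)
    moreover have "ball (z k) r = {z k - r <..< z k + r}" by (rule ball_eq_greaterThanLessThan)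
    ultimately show ?thesis by auto
  qed
  then obtain r where r: "\<And>k. k \<in> {1..d} \<Longrightarrow> r k > 0"
    "\<And>k. k \<in> {1..d} \<Longrightarrow> {z k - r k <..< z k + r k} \<subseteq> X k"
    "\<And>k. k \<in> {1..d} \<Longrightarrow> {z k - r k <..< z k + r k} \<subseteq> {0<..<1}" by metis
  define \<rho> where "\<rho> = Min (insert 1 (r ` {1..d}))"
  have "\<rho> > 0" unfolding \<rho>_def using r(1) by (subst Min_gr_iff) auto
  have \<rho>r: "\<rho> \<le> r k" if "k \<in> {1..d}" for k unfolding \<rho>_def using that by (intro Min_le) auto
  have "(\<Pi>\<^sub>E k\<in>{1..d}. {z k - \<rho> <..< z k + \<rho>}) \<subseteq> A \<inter> open_cube d"
  proof
    fix x assume x: "x \<in> (\<Pi>\<^sub>E k\<in>{1..d}. {z k - \<rho> <..< z k + \<rho>})"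
    have in_r: "x k \<in> {z k - r k <..< z k + r k}" if "k \<in> {1..d}" for k
    proof -
      have "x k \<in> {z k - \<rho> <..< z k + \<rho>}" using x that by (rule PiE_mem)
      then show ?thesis using \<rho>r[OF that] by auto
    qed
    have "x i \<in> X i" for i
    proof (cases "i \<in> {1..d}")
      case True then show ?thesis using in_r r(2) by blast
    next
      case False
      then have "x i = z i" using PiE_arb[OF x] PiE_arb[OF z[unfolded open_cube_def]] by simp
      then show ?thesis using PiE_mem[OF X(1), of i] by simp
    qed
    then have "x \<in> A" using X(3) by (auto simp: PiE_iff)
    moreover have "x \<in> open_cube d" unfolding open_cube_def
    proof (rule PiE_I)
      show "x k \<in> {0<..<1}" if "k \<in> {1..d}" for k using in_r[OF that] r(3)[OF that] by blast
      show "x k = undefined" if "k \<notin> {1..d}" for k using x that by (rule PiE_arb)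
    qed
    ultimately show "x \<in> A \<inter> open_cube d" by simp
  qed
  then show thesis using that \<open>\<rho> > 0\<close> by blast
qed

text \<open>
  If \<open>\<bar>f\<bar>\<close> exceeded its essential supremum at \<open>z\<close>, then by continuity it would do so on a box
  around \<open>z\<close>, which has positive volume. Compactness of the closed cube makes the essential
  supremum finite, so its conversion to a real number keeps the value.
\<close>

lemma abs_le_Linf_norm:
  assumes g: "continuous_on (closed_cube d) g" and fg: "\<And>z. z \<in> open_cube d \<Longrightarrow> f z = g z"
    and z: "z \<in> open_cube d"
  shows "\<bar>f z\<bar> \<le> Linf_norm d f"
proof -
  define P where "P = Pi\<^sub>M {1..d} (\<lambda>_. lborel :: real measure)"
  define M where "M = restrict_space P (open_cube d)"
  define e where "e = esssup M (\<lambda>z. ereal \<bar>f z\<bar>)"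
  have meas: "(\<lambda>z. ereal \<bar>f z\<bar>) \<in> borel_measurable M"
    unfolding M_def P_def by (rule measurable_continuous_extension[OF g fg])
  have lower: "ereal \<bar>f z\<bar> \<le> e"
  proof (rule ccontr)
    assume "\<not> ereal \<bar>f z\<bar> \<le> e"
    then have "e < ereal \<bar>f z\<bar>" by simp
    then obtain c where c: "e < ereal c" "ereal c < ereal \<bar>f z\<bar>" using ereal_dense2 by blast
    have "open {y::real. c < \<bar>y\<bar>}" by (intro open_Collect_less continuous_intros)
    then obtain A where A: "open A" "A \<inter> closed_cube d = g -` {y. c < \<bar>y\<bar>} \<inter> closed_cube d"
      using g unfolding continuous_on_open_invariant by blast
    have "z \<in> g -` {y. c < \<bar>y\<bar>} \<inter> closed_cube d" using c(2) z fg[OF z] open_cube_subset by auto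
    then have "z \<in> A" using A(2) by blast
    then obtain \<rho> where \<rho>: "\<rho> > 0" "(\<Pi>\<^sub>E k\<in>{1..d}. {z k - \<rho> <..< z k + \<rho>}) \<subseteq> A \<inter> open_cube d"
      using box_around[OF A(1) _ z] by blast
    define Box where "Box = (\<Pi>\<^sub>E k\<in>{1..d}. {z k - \<rho> <..< z k + \<rho>})"
    have Box_sets: "Box \<in> sets P" unfolding Box_def P_def by (rule sets_PiM_I_finite) auto
    interpret product_sigma_finite "\<lambda>_::nat. lborel :: real measure" by standard
    have "emeasure P Box = (\<Prod>k\<in>{1..d}. emeasure lborel {z k - \<rho> <..< z k + \<rho>})"
      unfolding P_def Box_def by (rule emeasure_PiM) auto
    also have "\<dots> = (\<Prod>k\<in>{1..d}. ennreal (2 * \<rho>))"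
      using \<rho>(1) by (intro prod.cong refl) simp
    also have "\<dots> \<noteq> 0" using \<rho>(1) by simp
    finally have pos: "emeasure P Box \<noteq> 0" .
    have "AE x in M. ereal \<bar>f x\<bar> \<le> e" unfolding e_def by (rule esssup_AE)
    then have ae: "AE x in P. x \<in> open_cube d \<longrightarrow> ereal \<bar>f x\<bar> \<le> e"
      unfolding M_def
      by (subst (asm) AE_restrict_space_iff)
         (use open_cube_sets[of d] sets.Int_space_eq2[OF open_cube_sets[of d]] in \<open>auto simp: P_def\<close>)
    have "AE x in P. x \<notin> Box"
    proof (rule AE_mp[OF ae], rule AE_I2, rule impI, rule notI)
      fix x assume x: "x \<in> open_cube d \<longrightarrow> ereal \<bar>f x\<bar> \<le> e" "x \<in> Box"
      then have xo: "x \<in> open_cube d" and xA: "x \<in> A" using \<rho>(2) by (auto simp: Box_def)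
      then have "x \<in> g -` {y. c < \<bar>y\<bar>}" using A(2) open_cube_subset by blast
      then have "ereal c < ereal \<bar>f x\<bar>" using fg[OF xo] by simp
      with c(1) have "e < ereal \<bar>f x\<bar>" by (rule less_trans)
      moreover have "ereal \<bar>f x\<bar> \<le> e" using x(1) xo by blast
      ultimately show False by (simp add: leD)
    qed
    then have "emeasure P {x \<in> space P. \<not> x \<notin> Box} = 0"
      by (rule AE_iff_measurable[THEN iffD1, rotated -1]) (use Box_sets sets.sets_into_space in \<open>auto simp: Int_def[symmetric]\<close>)
    moreover have "{x \<in> space P. \<not> x \<notin> Box} = Box" using sets.sets_into_space[OF Box_sets] by auto
    ultimately show False using pos by simp
  qed
  moreover have "e < \<infinity>"
  proof -
    have "compact (g ` closed_cube d)" by (rule compact_continuous_image[OF g compact_closed_cube])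
    then have "\<exists>b. \<forall>y\<in>g ` closed_cube d. norm y \<le> b"
      unfolding bounded_iff[symmetric] by (rule compact_imp_bounded)
    then obtain b where b: "\<And>x. x \<in> closed_cube d \<Longrightarrow> \<bar>g x\<bar> \<le> b" by auto
    have "e \<le> ereal b" unfolding e_def
    proof (rule esssup_I[OF meas], rule AE_I2)
      fix x assume "x \<in> space M"
      then have "x \<in> open_cube d" unfolding M_def P_def space_restrict_open_cube .
      then show "ereal \<bar>f x\<bar> \<le> ereal b" using b open_cube_subset fg by auto
    qed
    then show ?thesis by (auto simp: less_top[symmetric])
  qed
  ultimately have "ereal \<bar>f z\<bar> \<le> ereal (real_of_ereal e)"
    by (cases e) auto
  then show ?thesis by (simp add: Linf_norm_def e_def M_def P_def)
qed

section \<open>The spectrum of a Gram matrix\<close>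

lemma norm2_sq_eq_scalar_prod: "norm2_sq v = v \<bullet> v"
  by (simp add: norm2_sq_def scalar_prod_def power2_eq_square lessThan_atLeast0)

lemma norm2_sq_nonneg: "0 \<le> norm2_sq v"
  by (simp add: norm2_sq_def sum_nonneg)

lemma norm2_sq_pos:
  assumes "v \<in> carrier_vec N" "v \<noteq> 0\<^sub>v N"
  shows "0 < norm2_sq v"
proof -
  obtain i where i: "i < N" "v $ i \<noteq> 0" using assms by (auto simp: vec_eq_iff)
  have "0 < (v $ i)\<^sup>2" using i by simp
  also have "\<dots> \<le> norm2_sq v" unfolding norm2_sq_def using assms i by (intro member_le_sum) auto
  finally show ?thesis .
qed

lemma gram_scalar_prod:
  fixes B :: "real mat"
  assumes B: "B \<in> carrier_mat n N" and x: "x \<in> carrier_vec N" and y: "y \<in> carrier_vec N"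
  shows "x \<bullet> ((B\<^sup>T * B) *\<^sub>v y) = (B *\<^sub>v x) \<bullet> (B *\<^sub>v y)"
proof -
  have "(B\<^sup>T * B) *\<^sub>v y = B\<^sup>T *\<^sub>v (B *\<^sub>v y)" using B y by (intro assoc_mult_mat_vec) auto
  moreover have "(B\<^sup>T *\<^sub>v (B *\<^sub>v y)) \<bullet> x = (B *\<^sub>v y) \<bullet> (B *\<^sub>v x)"
    using B x y transpose_vec_mult_scalar[OF B x, of "B *\<^sub>v y"] by simp
  ultimately show ?thesis using B x y
    by (metis comm_scalar_prod mult_mat_vec_carrier transpose_carrier_mat)
qed

text \<open>
  A complex eigenvector splits into its real and imaginary parts \<open>x\<close> and \<open>y\<close>. The symmetry of the
  bilinear form at \<open>x\<close> and \<open>y\<close> forces the imaginary part of the eigenvalue to vanish, and then a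
  nonzero one of \<open>x\<close> and \<open>y\<close> is a real eigenvector.
\<close>

lemma symmetric_real_eigenvalue:
  fixes A :: "real mat"
  assumes A: "A \<in> carrier_mat N N" and N: "N > 0"
    and sym: "\<And>x y. x \<in> carrier_vec N \<Longrightarrow> y \<in> carrier_vec N \<Longrightarrow> x \<bullet> (A *\<^sub>v y) = y \<bullet> (A *\<^sub>v x)"
  shows "spectrum A \<noteq> {}"
proof -
  define C where "C = map_mat complex_of_real A"
  have C: "C \<in> carrier_mat N N" using A by (simp add: C_def)
  obtain ev w where w: "w \<in> carrier_vec N" "w \<noteq> 0\<^sub>v N" "C *\<^sub>v w = ev \<cdot>\<^sub>v w"
    using spectrum_non_empty[OF C N] C by (auto simp: spectrum_def eigenvalue_def eigenvector_def)
  define x where "x = map_vec Re w"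
  define y where "y = map_vec Im w"
  have xy: "x \<in> carrier_vec N" "y \<in> carrier_vec N" using w by (auto simp: x_def y_def)
  have comp: "(\<Sum>j<N. complex_of_real (A $$ (i, j)) * w $ j) = ev * w $ i" if i: "i < N" for i
  proof -
    have "(C *\<^sub>v w) $ i = (ev \<cdot>\<^sub>v w) $ i" by (simp only: w(3))
    moreover have "(C *\<^sub>v w) $ i = (\<Sum>j<N. complex_of_real (A $$ (i, j)) * w $ j)"
      using i A w(1) by (simp add: C_def scalar_prod_def row_def lessThan_atLeast0)
    ultimately show ?thesis using i w(1) by simp
  qed
  have Ax: "A *\<^sub>v x = Re ev \<cdot>\<^sub>v x - Im ev \<cdot>\<^sub>v y"
  proof (rule eq_vecI)
    fix i assume "i < dim_vec (Re ev \<cdot>\<^sub>v x - Im ev \<cdot>\<^sub>v y)"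
    then have i: "i < N" using xy by simp
    have "(A *\<^sub>v x) $ i = Re (\<Sum>j<N. complex_of_real (A $$ (i, j)) * w $ j)"
      using i A w(1) by (simp add: x_def scalar_prod_def row_def lessThan_atLeast0)
    then show "(A *\<^sub>v x) $ i = (Re ev \<cdot>\<^sub>v x - Im ev \<cdot>\<^sub>v y) $ i"
      unfolding comp[OF i] using i w(1) by (simp add: x_def y_def)
  qed (use A xy in auto)
  have Ay: "A *\<^sub>v y = Im ev \<cdot>\<^sub>v x + Re ev \<cdot>\<^sub>v y"
  proof (rule eq_vecI)
    fix i assume "i < dim_vec (Im ev \<cdot>\<^sub>v x + Re ev \<cdot>\<^sub>v y)"
    then have i: "i < N" using xy by simp
    have "(A *\<^sub>v y) $ i = Im (\<Sum>j<N. complex_of_real (A $$ (i, j)) * w $ j)"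
      using i A w(1) by (simp add: y_def scalar_prod_def row_def lessThan_atLeast0)
    then show "(A *\<^sub>v y) $ i = (Im ev \<cdot>\<^sub>v x + Re ev \<cdot>\<^sub>v y) $ i"
      unfolding comp[OF i] using i w(1) by (simp add: x_def y_def)
  qed (use A xy in auto)
  have nz: "x \<noteq> 0\<^sub>v N \<or> y \<noteq> 0\<^sub>v N"
  proof (rule ccontr)
    assume "\<not> ?thesis"
    then have z: "x = 0\<^sub>v N" "y = 0\<^sub>v N" by auto
    have "w = 0\<^sub>v N"
    proof (rule eq_vecI)
      fix i assume "i < dim_vec (0\<^sub>v N :: complex vec)"
      then have i: "i < N" by simp
      have "Re (w $ i) = x $ i" "Im (w $ i) = y $ i" using i w(1) by (auto simp: x_def y_def)
      then show "w $ i = 0\<^sub>v N $ i" using i z by (simp add: complex_eq_iff)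
    qed (use w in auto)
    then show False using w(2) by simp
  qed
  have "y \<bullet> (A *\<^sub>v x) = Re ev * (y \<bullet> x) - Im ev * norm2_sq y"
    unfolding Ax norm2_sq_eq_scalar_prod using xy by (simp add: scalar_prod_minus_distrib[of _ N])
  moreover have "x \<bullet> (A *\<^sub>v y) = Im ev * norm2_sq x + Re ev * (x \<bullet> y)"
    unfolding Ay norm2_sq_eq_scalar_prod using xy by (simp add: scalar_prod_add_distrib[of _ N])
  moreover have "x \<bullet> y = y \<bullet> x" using xy by (rule comm_scalar_prod)
  ultimately have "Im ev * (norm2_sq x + norm2_sq y) = 0"
    using sym[OF xy] by (simp add: algebra_simps)
  moreover have "norm2_sq x + norm2_sq y > 0"
    using nz
  proof
    assume "x \<noteq> 0\<^sub>v N"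
    then show ?thesis using norm2_sq_pos[OF xy(1)] norm2_sq_nonneg[of y] by simp
  next
    assume "y \<noteq> 0\<^sub>v N"
    then show ?thesis using norm2_sq_pos[OF xy(2)] norm2_sq_nonneg[of x] by simp
  qed
  ultimately have "Im ev = 0" by simp
  then have "A *\<^sub>v x = Re ev \<cdot>\<^sub>v x" "A *\<^sub>v y = Re ev \<cdot>\<^sub>v y"
    unfolding Ax Ay using xy by (auto intro!: eq_vecI)
  then have "eigenvalue A (Re ev)"
    using nz xy A unfolding eigenvalue_def eigenvector_def by auto
  then show ?thesis by (auto simp: spectrum_def)
qed

text \<open>
  The eigenvalues of a Gram matrix are values of its Rayleigh quotient. That there is an
  eigenvalue at all is needed because the minimum of an empty set is unspecified.
\<close>

lemma gram_spectrum_bounds: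
  fixes B :: "real mat"
  assumes B: "B \<in> carrier_mat N N" and N: "N > 0"
    and bounds: "\<And>v. v \<in> carrier_vec N \<Longrightarrow> r * norm2_sq v \<le> norm2_sq (B *\<^sub>v v)"
      "\<And>v. v \<in> carrier_vec N \<Longrightarrow> norm2_sq (B *\<^sub>v v) \<le> R * norm2_sq v"
  shows "r \<le> lambda_min (B\<^sup>T * B)" "lambda_min (B\<^sup>T * B) \<le> lambda_max (B\<^sup>T * B)" "lambda_max (B\<^sup>T * B) \<le> R"
proof -
  define A where "A = B\<^sup>T * B"
  have A: "A \<in> carrier_mat N N" using B by (simp add: A_def)
  have fin: "finite (spectrum A)" by (rule card_finite_spectrum(1)[OF A])
  have ne: "spectrum A \<noteq> {}"
  proof (rule symmetric_real_eigenvalue[OF A N])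
    fix x y :: "real Matrix.vec" assume xy: "x \<in> carrier_vec N" "y \<in> carrier_vec N"
    then have "(B *\<^sub>v x) \<bullet> (B *\<^sub>v y) = (B *\<^sub>v y) \<bullet> (B *\<^sub>v x)"
      using B by (intro comm_scalar_prod[of _ N]) auto
    then show "x \<bullet> (A *\<^sub>v y) = y \<bullet> (A *\<^sub>v x)"
      unfolding A_def gram_scalar_prod[OF B xy] gram_scalar_prod[OF B xy(2,1)] .
  qed
  have range: "r \<le> k \<and> k \<le> R" if k: "k \<in> spectrum A" for k
  proof -
    obtain v where v: "v \<in> carrier_vec N" "v \<noteq> 0\<^sub>v N" "A *\<^sub>v v = k \<cdot>\<^sub>v v"
      using k A by (auto simp: spectrum_def eigenvalue_def eigenvector_def)
    have "norm2_sq (B *\<^sub>v v) = v \<bullet> (A *\<^sub>v v)"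
      unfolding A_def norm2_sq_eq_scalar_prod using gram_scalar_prod[OF B v(1) v(1)] by simp
    also have "\<dots> = k * norm2_sq v" unfolding v(3) norm2_sq_eq_scalar_prod using v(1) by simp
    finally have "norm2_sq (B *\<^sub>v v) = k * norm2_sq v" .
    then show ?thesis using bounds[OF v(1)] norm2_sq_pos[OF v(1,2)] by simp
  qed
  have mm: "Min (spectrum A) \<in> spectrum A" "Max (spectrum A) \<in> spectrum A" using fin ne by auto
  show "r \<le> lambda_min (B\<^sup>T * B)" "lambda_max (B\<^sup>T * B) \<le> R"
    using range mm unfolding lambda_min_def lambda_max_def A_def[symmetric] by auto
  show "lambda_min (B\<^sup>T * B) \<le> lambda_max (B\<^sup>T * B)"
    using mm fin unfolding lambda_min_def lambda_max_def A_def[symmetric] by (intro Min_le)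
qed

section \<open>Restricted isometry of the compressive collocation matrix\<close>

lemma card_grid: "card (grid d n) = n ^ d"
  by (simp add: grid_def card_PiE)

lemma finite_grid [simp]: "finite (grid d n)"
  by (auto simp: grid_def intro!: finite_PiE)

lemma colloc_point_in_open_cube:
  assumes "q \<in> grid d n"
  shows "colloc_point d n q \<in> open_cube d"
  using assms by (force simp: colloc_point_def open_cube_def grid_def PiE_iff)

text \<open>
  The bounds for functions on the grid, transported to the numbering \<open>e\<close> of the grid points, with
  the pointwise bounds for \<open>\<eta>\<close> and its gradient taken from the essential suprema.
\<close>

lemma colloc_system_bounds:
  fixes \<eta> :: "(nat \<Rightarrow> real) \<Rightarrow> real" and v :: "nat \<Rightarrow> real"
  assumes d: "d \<ge> 1" and n: "n \<ge> 1" and e: "bij_betw e {0..<n ^ d} (grid d n)"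
    and C1: "C1_closed_cube d \<eta>" and pos: "cube_min d \<eta> > 0"
  defines "S \<equiv> (\<Sum>k=1..d. Linf_norm d (\<lambda>z. grad d \<eta> z k))"
  defines "r \<equiv> (cube_min d \<eta>)\<^sup>2 - 2 / pi * Linf_norm d \<eta> * S"
  defines "R \<equiv> (Linf_norm d \<eta> + 1 / pi * S)\<^sup>2"
  shows "r * (\<Sum>b<n ^ d. (v b)\<^sup>2) \<le> (\<Sum>q\<in>grid d n. (\<Sum>b<n ^ d. colloc_entry d n \<eta> q (e b) * v b)\<^sup>2)"
    and "(\<Sum>q\<in>grid d n. (\<Sum>b<n ^ d. colloc_entry d n \<eta> q (e b) * v b)\<^sup>2) \<le> R * (\<Sum>b<n ^ d. (v b)\<^sup>2)"
    and "\<And>q b. q \<in> grid d n \<Longrightarrow> b < n ^ d \<Longrightarrow> real (n ^ d) * (colloc_entry d n \<eta> q (e b))\<^sup>2 \<le> 2 ^ d * R"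
    and "R > 0"
proof -
  define E where "E = Linf_norm d \<eta>"
  define T where "T k = Linf_norm d (\<lambda>z. grad d \<eta> z k)" for k
  define z where "z = colloc_point d n"
  have zo: "z q \<in> open_cube d" if "q \<in> grid d n" for q
    unfolding z_def using that by (rule colloc_point_in_open_cube)
  have cont: "continuous_on (closed_cube d) \<eta>" using C1 by (simp add: C1_closed_cube_def)
  have E: "\<bar>\<eta> x\<bar> \<le> E" if "x \<in> open_cube d" for x
    unfolding E_def using that by (intro abs_le_Linf_norm[OF cont]) auto
  have T: "\<bar>grad d \<eta> x k\<bar> \<le> T k" if k: "k \<in> {1..d}" and x: "x \<in> open_cube d" for x k
  proof -
    obtain g where g: "continuous_on (closed_cube d) g" "\<And>z. z \<in> open_cube d \<Longrightarrow> g z = partial_deriv k \<eta> z"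
      using C1 k unfolding C1_closed_cube_def by blast
    have "\<bar>(\<lambda>z. grad d \<eta> z k) x\<bar> \<le> T k" unfolding T_def
    proof (rule abs_le_Linf_norm[OF g(1) _ x])
      show "grad d \<eta> z k = g z" if "z \<in> open_cube d" for z using g(2)[OF that] k by (simp add: grad_def)
    qed
    then show ?thesis by simp
  qed
  have \<mu>: "cube_min d \<eta> \<le> \<eta> x" if "x \<in> open_cube d" for x
    using cube_min_le[OF cont] that open_cube_subset by blast
  have "card (grid d n) > 0" unfolding card_grid using n by simp
  then obtain q0 where q0: "q0 \<in> grid d n" by (metis card_gt_0_iff ex_in_conv)
  have E_pos: "E > 0" using E[OF zo[OF q0]] \<mu>[OF zo[OF q0]] pos by linarith
  have T0: "T k \<ge> 0" if "k \<in> {1..d}" for k using T[OF that zo[OF q0]] by linarith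
  have S_eq: "S = (\<Sum>k=1..d. T k)" by (simp add: S_def T_def)
  have S0: "S \<ge> 0" unfolding S_eq using T0 by (intro sum_nonneg) auto
  show "R > 0" unfolding R_def E_def[symmetric] using E_pos S0 by (intro zero_less_power add_pos_nonneg) auto
  have entry: "colloc_entry d n \<eta> q j = - \<eta> (z q) * sine_tensor d n q j
     + (\<Sum>k=1..d. grad d \<eta> (z q) k * (1 / pi * grad_weight d k j) * mixed_tensor d n k q j)"
    if "q \<in> grid d n" "j \<in> grid d n" for q j
  proof (rule colloc_entry_eq[OF that(2,1) d])
    show "z q = colloc_point d n q" by (simp add: z_def)
    show "(\<lambda>t. \<eta> ((z q)(k := t))) differentiable at (z q k)" if "k \<in> {1..d}" for k
      using C1 that zo[OF \<open>q \<in> grid d n\<close>] unfolding C1_closed_cube_def by blast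
  qed
  \<comment> \<open>The vector \<open>v\<close> as a function on the grid.\<close>
  define w where "w j = v (the_inv_into {0..<n ^ d} e j)" for j
  have inj: "inj_on e {0..<n ^ d}" using e by (simp add: bij_betw_def)
  have w_e: "w (e b) = v b" if "b \<in> {0..<n ^ d}" for b
    unfolding w_def using the_inv_into_f_f[OF inj that] by simp
  have row: "(\<Sum>j\<in>grid d n. colloc_entry d n \<eta> q j * w j) = (\<Sum>b<n ^ d. colloc_entry d n \<eta> q (e b) * v b)" for q
  proof -
    have "(\<Sum>j\<in>grid d n. colloc_entry d n \<eta> q j * w j) = (\<Sum>b\<in>{0..<n ^ d}. colloc_entry d n \<eta> q (e b) * w (e b))"
      by (rule sum.reindex_bij_betw[OF e, symmetric])
    also have "\<dots> = (\<Sum>b\<in>{0..<n ^ d}. colloc_entry d n \<eta> q (e b) * v b)"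
      by (intro sum.cong refl) (simp only: w_e)
    finally show ?thesis by (simp only: lessThan_atLeast0)
  qed
  have w_norm: "(\<Sum>j\<in>grid d n. (w j)\<^sup>2) = (\<Sum>b<n ^ d. (v b)\<^sup>2)"
  proof -
    have "(\<Sum>j\<in>grid d n. (w j)\<^sup>2) = (\<Sum>b\<in>{0..<n ^ d}. (w (e b))\<^sup>2)"
      by (rule sum.reindex_bij_betw[OF e, symmetric])
    also have "\<dots> = (\<Sum>b\<in>{0..<n ^ d}. (v b)\<^sup>2)" by (intro sum.cong refl) (simp only: w_e)
    finally show ?thesis by (simp only: lessThan_atLeast0)
  qed
  have "r * (\<Sum>j\<in>grid d n. (w j)\<^sup>2) \<le> (\<Sum>q\<in>grid d n. (\<Sum>j\<in>grid d n. colloc_entry d n \<eta> q j * w j)\<^sup>2)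
    \<and> (\<Sum>q\<in>grid d n. (\<Sum>j\<in>grid d n. colloc_entry d n \<eta> q j * w j)\<^sup>2) \<le> R * (\<Sum>j\<in>grid d n. (w j)\<^sup>2)"
    unfolding r_def R_def S_eq E_def[symmetric]
  proof (intro conjI colloc_norm_bounds[where \<eta> = "\<lambda>q. \<eta> (z q)" and g = "\<lambda>k q. grad d \<eta> (z q) k"])
  qed (use E T \<mu> zo pos E_pos T0 entry in \<open>auto intro: less_imp_le\<close>)
  then show "r * (\<Sum>b<n ^ d. (v b)\<^sup>2) \<le> (\<Sum>q\<in>grid d n. (\<Sum>b<n ^ d. colloc_entry d n \<eta> q (e b) * v b)\<^sup>2)"
    "(\<Sum>q\<in>grid d n. (\<Sum>b<n ^ d. colloc_entry d n \<eta> q (e b) * v b)\<^sup>2) \<le> R * (\<Sum>b<n ^ d. (v b)\<^sup>2)"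
    unfolding row w_norm by auto
  show "real (n ^ d) * (colloc_entry d n \<eta> q (e b))\<^sup>2 \<le> 2 ^ d * R" if "q \<in> grid d n" "b < n ^ d" for q b
  proof -
    have "e b \<in> grid d n" using bij_betwE[OF e] that(2) by simp
    from entry[OF that(1) this] show ?thesis
      unfolding R_def S_eq E_def[symmetric]
      by (rule colloc_entry_bound[rotated 2]) (use E T zo that(1) in auto)
  qed
qed

lemma norm2_sq_mat_mult:
  "norm2_sq (mat m N f *\<^sub>v v) = (\<Sum>i<m. (\<Sum>b<N. f (i, b) * v $ b)\<^sup>2)" if "v \<in> carrier_vec N"
  unfolding norm2_sq_def using that
  by (auto intro!: sum.cong simp: scalar_prod_def lessThan_atLeast0)

text \<open>
  Both sides are quadratic, so it suffices to control vectors in the unit ball. The expected form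
  \<open>F\<close> lies between \<open>c\<close> and 1 times the square of the norm; a deviation of \<open>\<epsilon>\<close> is harmless as long
  as \<open>1 - \<delta> \<le> c - \<epsilon>\<close>.
\<close>

lemma RIP_of_small_deviation:
  fixes x :: "nat \<Rightarrow> nat \<Rightarrow> real"
  assumes \<delta>: "0 < \<delta>" "\<delta> < 1" and c: "1 - \<delta> \<le> c - \<epsilon>" "\<epsilon> \<le> \<delta>"
    and F: "\<And>v. c * (\<Sum>j<N. (v j)\<^sup>2) \<le> F v" "\<And>v. F v \<le> (\<Sum>j<N. (v j)\<^sup>2)"
    and F_scale: "\<And>a v. F (\<lambda>j. a * v j) = a\<^sup>2 * F v"
    and dev: "\<And>v. v \<in> sparse_ball N s \<Longrightarrow> \<bar>(\<Sum>i<m. (lin N (x i) v)\<^sup>2) / m - F v\<bar> \<le> \<epsilon>"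
  shows "RIP s \<delta> (mat m N (\<lambda>(i, b). x i b / sqrt m))"
  unfolding RIP_def
proof (intro conjI ballI impI \<delta>)
  fix v :: "real Matrix.vec"
  assume "v \<in> carrier_vec (dim_col (mat m N (\<lambda>(i, b). x i b / sqrt m)))" and sparse: "norm0 v \<le> s"
  then have v: "v \<in> carrier_vec N" by simp
  define V where "V = norm2_sq v"
  define P where "P u = (\<Sum>i<m. (lin N (x i) u)\<^sup>2) / m" for u
  have V: "V = (\<Sum>j<N. (v $ j)\<^sup>2)" using v by (simp add: V_def norm2_sq_def)
  have V0: "V \<ge> 0" by (simp add: V sum_nonneg)
  have image: "norm2_sq (mat m N (\<lambda>(i, b). x i b / sqrt m) *\<^sub>v v) = P (\<lambda>j. v $ j)"
    unfolding norm2_sq_mat_mult[OF v]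
    by (simp add: P_def lin_def power_divide sum_divide_distrib[symmetric])
  have P_scale: "P (\<lambda>j. a * u j) = a\<^sup>2 * P u" for a u
  proof -
    have "lin N y (\<lambda>j. a * u j) = a * lin N y u" for y
      by (simp add: lin_def sum_distrib_left mult_ac)
    then show ?thesis by (simp add: P_def power_mult_distrib sum_distrib_left[symmetric])
  qed
  have close: "\<bar>P (\<lambda>j. v $ j) - F (\<lambda>j. v $ j)\<bar> \<le> \<epsilon> * V"
  proof (cases "V = 0")
    case True
    then have "v $ j = 0" if "j < N" for j
      using that unfolding V by (simp add: sum_nonneg_eq_0_iff)
    then have "P (\<lambda>j. v $ j) = 0" by (simp add: P_def lin_def)
    moreover have "F (\<lambda>j. v $ j) = 0" using F[of "\<lambda>j. v $ j"] True unfolding V[symmetric] by simp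
    ultimately show ?thesis using True by simp
  next
    case False
    then have Vp: "V > 0" using V0 by simp
    define u where "u j = (1 / sqrt V) * v $ j" for j
    have vu: "(\<lambda>j. v $ j) = (\<lambda>j. sqrt V * u j)" using Vp by (simp add: u_def)
    have "u \<in> sparse_ball N s"
    proof -
      have "(\<Sum>j<N. (u j)\<^sup>2) = V / V"
        unfolding u_def power_mult_distrib sum_distrib_left[symmetric] V[symmetric] using Vp by (simp add: power_divide)
      moreover have "{j. j < N \<and> u j \<noteq> 0} = {i. i < dim_vec v \<and> v $ i \<noteq> 0}" using v Vp by (auto simp: u_def)
      ultimately show ?thesis using sparse Vp by (simp add: sparse_ball_def norm0_def)
    qed
    from dev[OF this] have "\<bar>P u - F u\<bar> \<le> \<epsilon>" by (simp add: P_def)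
    then have "V * \<bar>P u - F u\<bar> \<le> V * \<epsilon>" using V0 by (rule mult_left_mono)
    moreover have "P (\<lambda>j. v $ j) - F (\<lambda>j. v $ j) = V * (P u - F u)"
      unfolding vu P_scale F_scale using V0 by (simp add: right_diff_distrib)
    ultimately show ?thesis using V0 by (simp add: abs_mult mult.commute)
  qed
  have "(1 - \<delta>) * V \<le> (c - \<epsilon>) * V" using c V0 by (intro mult_right_mono) auto
  also have "\<dots> \<le> P (\<lambda>j. v $ j)" using close F(1)[of "\<lambda>j. v $ j"] unfolding V[symmetric] left_diff_distrib by linarith
  finally show "(1 - \<delta>) * norm2_sq v \<le> norm2_sq (mat m N (\<lambda>(i, b). x i b / sqrt m) *\<^sub>v v)"
    unfolding image V_def .
  have "P (\<lambda>j. v $ j) \<le> V + \<epsilon> * V" using close F(2)[of "\<lambda>j. v $ j"] unfolding V[symmetric] by linarith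
  also have "\<dots> \<le> V + \<delta> * V" using c V0 by (intro add_left_mono mult_right_mono) auto
  finally show "norm2_sq (mat m N (\<lambda>(i, b). x i b / sqrt m) *\<^sub>v v) \<le> (1 + \<delta>) * norm2_sq v"
    unfolding image V_def by (simp add: distrib_right)
qed

lemma draws_eq: "draws d n m = pmf_of_set ({..<m} \<rightarrow>\<^sub>E grid d n)" if "n \<ge> 1"
proof -
  have "card (grid d n) > 0" unfolding card_grid using that by simp
  then have "grid d n \<noteq> {}" by force
  then have "draws d n m = pmf_of_set (PiE_dflt {..<m} undefined (\<lambda>_. grid d n))"
    unfolding draws_def by (intro Pi_pmf_of_set) auto
  also have "PiE_dflt {..<m} undefined (\<lambda>_. grid d n) = {..<m} \<rightarrow>\<^sub>E grid d n"
    by (simp add: PiE_dflt_def PiE_def Pi_def extensional_def set_eq_iff) blast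
  finally show ?thesis .
qed

lemma prob_draws_ge:
  fixes p :: real
  assumes n: "n \<ge> 1" and good: "\<And>\<tau>. \<tau> \<in> {..<m} \<rightarrow>\<^sub>E grid d n \<Longrightarrow> \<not> Z \<tau> \<Longrightarrow> \<tau> \<in> good"
    and bad: "real (card {\<tau>\<in>{..<m} \<rightarrow>\<^sub>E grid d n. Z \<tau>}) \<le> p * card ({..<m} \<rightarrow>\<^sub>E grid d n)"
  shows "measure_pmf.prob (draws d n m) good \<ge> 1 - p"
proof -
  define \<Omega> where "\<Omega> = {..<m} \<rightarrow>\<^sub>E grid d n"
  have fin: "finite \<Omega>" unfolding \<Omega>_def by (intro finite_PiE) auto
  have "card (grid d n) > 0" unfolding card_grid using n by simp
  then have cp: "card \<Omega> > 0" unfolding \<Omega>_def by (simp add: card_PiE)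
  then have ne: "\<Omega> \<noteq> {}" by force
  have "\<Omega> - good \<subseteq> {\<tau>\<in>\<Omega>. Z \<tau>}" using good by (auto simp: \<Omega>_def)
  then have "card (\<Omega> - good) \<le> card {\<tau>\<in>\<Omega>. Z \<tau>}" using fin by (intro card_mono) auto
  then have "real (card (\<Omega> - good)) \<le> p * card \<Omega>" using bad unfolding \<Omega>_def by linarith
  moreover have "card \<Omega> = card (\<Omega> \<inter> good) + card (\<Omega> - good)"
    using fin by (metis card_Int_Diff)
  ultimately have "(1 - p) * card \<Omega> \<le> real (card (\<Omega> \<inter> good))" by (simp add: left_diff_distrib)
  then have "1 - p \<le> real (card (\<Omega> \<inter> good)) / card \<Omega>" using cp by (simp add: pos_le_divide_eq)
  also have "\<dots> = measure_pmf.prob (draws d n m) good"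
    unfolding draws_eq[OF n] \<Omega>_def[symmetric] by (simp add: measure_pmf_of_set[OF ne fin])
  finally show ?thesis .
qed

theorem theorem4:
  "\<exists>C::real. C > 0 \<and>
     (\<forall>(d::nat) (n::nat) (s::nat) (\<eta> :: (nat \<Rightarrow> real) \<Rightarrow> real) (e :: nat \<Rightarrow> nat \<Rightarrow> nat).
        d \<ge> 1 \<longrightarrow> n \<ge> 1 \<longrightarrow> s \<ge> 1 \<longrightarrow> s \<le> n ^ d \<longrightarrow>
        bij_betw e {0..<n ^ d} (grid d n) \<longrightarrow>
        C1_closed_cube d \<eta> \<longrightarrow>
        cube_min d \<eta> > 0 \<longrightarrow>
        Linf_norm d \<eta> * (\<Sum>k=1..d. Linf_norm d (\<lambda>z. grad d \<eta> z k)) < pi / 2 * (cube_min d \<eta>)\<^sup>2 \<longrightarrow>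
        (let N = n ^ d;
             B = full_colloc_mat d n e \<eta>;
             r = (cube_min d \<eta>)\<^sup>2
                 - 2 / pi * Linf_norm d \<eta> * (\<Sum>k=1..d. Linf_norm d (\<lambda>z. grad d \<eta> z k));
             R = (Linf_norm d \<eta> + 1 / pi * (\<Sum>k=1..d. Linf_norm d (\<lambda>z. grad d \<eta> z k)))\<^sup>2
         in r \<le> lambda_min (B\<^sup>T * B) \<and>
            lambda_min (B\<^sup>T * B) \<le> lambda_max (B\<^sup>T * B) \<and>
            lambda_max (B\<^sup>T * B) \<le> R \<and>
            (\<forall>(\<delta>::real) (m::nat). 1 - r / R < \<delta> \<longrightarrow> \<delta> < 1 \<longrightarrow> m \<ge> 1 \<longrightarrow>
               (let Ct = C * 2 ^ d * (1 / (\<delta> - (1 - r / R))\<^sup>2)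
                in real m \<ge> Ct * real s * (ln (real s)) ^ 3 * ln (real N) \<longrightarrow>
                   real s \<ge> Ct * ln (real N) \<longrightarrow>
                   measure_pmf.prob (draws d n m)
                     {\<tau>. RIP s \<delta> ((1 / sqrt R) \<cdot>\<^sub>m compressive_colloc_mat d n e \<eta> m \<tau>)}
                   \<ge> 1 - real N powr (- ((ln (real s)) ^ 3))))))"
proof (rule exI[of _ 10000000000], intro conjI allI impI)
  fix d n s :: nat and \<eta> :: "(nat \<Rightarrow> real) \<Rightarrow> real" and e :: "nat \<Rightarrow> nat \<Rightarrow> nat"
  assume d: "d \<ge> 1" and n: "n \<ge> 1" and s: "s \<ge> 1" "s \<le> n ^ d" and e: "bij_betw e {0..<n ^ d} (grid d n)"
    and C1: "C1_closed_cube d \<eta>" and pos: "cube_min d \<eta> > 0"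
    and small: "Linf_norm d \<eta> * (\<Sum>k=1..d. Linf_norm d (\<lambda>z. grad d \<eta> z k)) < pi / 2 * (cube_min d \<eta>)\<^sup>2"
  define N where "N = n ^ d"
  define B where "B = full_colloc_mat d n e \<eta>"
  define S where "S = (\<Sum>k=1..d. Linf_norm d (\<lambda>z. grad d \<eta> z k))"
  define r where "r = (cube_min d \<eta>)\<^sup>2 - 2 / pi * Linf_norm d \<eta> * S"
  define R where "R = (Linf_norm d \<eta> + 1 / pi * S)\<^sup>2"
  define G where "G = grid d n"
  define b where "b q j = colloc_entry d n \<eta> q (e j)" for q j
  note bounds = colloc_system_bounds[OF d n e C1 pos, folded S_def, folded r_def R_def N_def G_def, folded b_def]
  have N0: "N > 0" using n by (simp add: N_def)
  have R0: "R > 0" by (rule bounds(4))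
  have image: "norm2_sq (B *\<^sub>v v) = (\<Sum>q\<in>G. (\<Sum>j<N. b q j * v $ j)\<^sup>2)" if v: "v \<in> carrier_vec N" for v
  proof -
    have "norm2_sq (B *\<^sub>v v) = (\<Sum>i\<in>{0..<N}. (\<Sum>j<N. b (e i) j * v $ j)\<^sup>2)"
      using norm2_sq_mat_mult[OF v] unfolding B_def full_colloc_mat_def N_def[symmetric] b_def
      by (simp add: lessThan_atLeast0)
    also have "\<dots> = (\<Sum>q\<in>G. (\<Sum>j<N. b q j * v $ j)\<^sup>2)"
      using e unfolding N_def[symmetric] G_def[symmetric] by (rule sum.reindex_bij_betw)
    finally show ?thesis .
  qed
  have B: "B \<in> carrier_mat N N" by (simp add: B_def full_colloc_mat_def N_def)
  have V: "norm2_sq v = (\<Sum>j<N. (v $ j)\<^sup>2)" if "v \<in> carrier_vec N" for v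
    using that by (simp add: norm2_sq_def)
  have lower: "r * norm2_sq v \<le> norm2_sq (B *\<^sub>v v)" if "v \<in> carrier_vec N" for v
    unfolding image[OF that] V[OF that] by (rule bounds(1))
  have upper: "norm2_sq (B *\<^sub>v v) \<le> R * norm2_sq v" if "v \<in> carrier_vec N" for v
    unfolding image[OF that] V[OF that] by (rule bounds(2))
  have spec: "r \<le> lambda_min (B\<^sup>T * B)" "lambda_min (B\<^sup>T * B) \<le> lambda_max (B\<^sup>T * B)" "lambda_max (B\<^sup>T * B) \<le> R"
    by (rule gram_spectrum_bounds[where r = r and R = R, OF B N0]; fact lower upper)+
  have rR: "r \<le> R" using spec by linarith
  have prob: "measure_pmf.prob (draws d n m) {\<tau>. RIP s \<delta> ((1 / sqrt R) \<cdot>\<^sub>m compressive_colloc_mat d n e \<eta> m \<tau>)}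
        \<ge> 1 - real N powr (- ((ln (real s)) ^ 3))"
    if \<delta>: "1 - r / R < \<delta>" "\<delta> < 1" and m: "m \<ge> 1"
      and m_large: "real m \<ge> 10000000000 * 2 ^ d * (1 / (\<delta> - (1 - r / R))\<^sup>2) * real s * (ln (real s)) ^ 3 * ln (real N)"
      and s_large: "real s \<ge> 10000000000 * 2 ^ d * (1 / (\<delta> - (1 - r / R))\<^sup>2) * ln (real N)"
    for \<delta> :: real and m :: nat
  proof (cases "s = 1")
    \<comment> \<open>For \<open>s = 1\<close> the asserted lower bound of the probability is 0.\<close>
    case True
    then show ?thesis using N0 by simp
  next
    case False
    then have s2: "s \<ge> 2" using s(1) by simp
    then have N2: "N \<ge> 2" using s(2) by (simp add: N_def)
    define \<epsilon> where "\<epsilon> = \<delta> - (1 - r / R)"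
    have ratio: "r / R \<le> 1" using rR R0 by simp
    have \<epsilon>: "0 < \<epsilon>" "\<epsilon> \<le> 1" using \<delta> ratio by (auto simp: \<epsilon>_def)
    define K where "K = sqrt (2 ^ d)"
    have K: "K \<ge> 1" "K\<^sup>2 = 2 ^ d" by (simp_all add: K_def)
    define X where "X q j = sqrt (real N / R) * b q j" for q j
    define F where "F v = (\<Sum>q\<in>G. (lin N (X q) v)\<^sup>2) / card G" for v
    have G: "finite G" "card G = N" by (simp_all add: G_def card_grid N_def)
    have X_bound: "\<bar>X q j\<bar> \<le> K" if "q \<in> G" "j < N" for q j
    proof -
      have "(X q j)\<^sup>2 = real N * (b q j)\<^sup>2 / R" using R0 by (simp add: X_def power_mult_distrib)
      also have "\<dots> \<le> 2 ^ d" using bounds(3)[OF that] R0 by (simp add: divide_le_eq)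
      finally have "\<bar>X q j\<bar>\<^sup>2 \<le> K\<^sup>2" by (simp add: K)
      then show ?thesis using K by (intro power2_le_imp_le[of "\<bar>X q j\<bar>"]) auto
    qed
    have F_eq: "F v = (\<Sum>q\<in>G. (\<Sum>j<N. b q j * v j)\<^sup>2) / R" for v
    proof -
      have lin_X: "lin N (X q) v = sqrt (real N / R) * (\<Sum>j<N. b q j * v j)" for q
        by (simp add: lin_def X_def sum_distrib_left mult_ac)
      have "F v = (real N / R) * (\<Sum>q\<in>G. (\<Sum>j<N. b q j * v j)\<^sup>2) / real N"
        unfolding F_def lin_X power_mult_distrib sum_distrib_left[symmetric] G(2) using R0 by simp
      then show ?thesis using N0 by simp
    qed
    have F_upper: "F v \<le> (\<Sum>j<N. (v j)\<^sup>2)" for v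
      unfolding F_eq using bounds(2)[of v] R0 by (simp add: pos_divide_le_eq mult.commute)
    have F_lower: "r / R * (\<Sum>j<N. (v j)\<^sup>2) \<le> F v" for v
      unfolding F_eq using bounds(1)[of v] R0 by (simp add: divide_right_mono)
    have F_scale: "F (\<lambda>j. a * v j) = a\<^sup>2 * F v" for a v
    proof -
      have row: "(\<Sum>j<N. b q j * (a * v j)) = a * (\<Sum>j<N. b q j * v j)" for q
        by (simp add: sum_distrib_left mult_ac)
      show ?thesis unfolding F_eq row power_mult_distrib sum_distrib_left[symmetric] by simp
    qed
    have Ct: "10000000000 * 2 ^ d * (1 / \<epsilon>\<^sup>2) = 10000000000 * K\<^sup>2 / \<epsilon>\<^sup>2" by (simp add: K)
    have G_ne: "G \<noteq> {}" using G N0 by auto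
    have bad: "real (card {\<tau>\<in>{..<m} \<rightarrow>\<^sub>E G. \<exists>v\<in>sparse_ball N s. \<bar>(\<Sum>i<m. (lin N (X (\<tau> i)) v)\<^sup>2) / m - F v\<bar> > \<epsilon>})
        \<le> real N powr (- ((ln (real s)) ^ 3)) * card ({..<m} \<rightarrow>\<^sub>E G)"
      unfolding F_def
    proof (rule sparse_uniform_deviation[OF G(1) G_ne X_bound _ \<epsilon> K(1) N2 s2 Ct])
      show "(\<Sum>q\<in>G. (lin N (X q) v)\<^sup>2) / card G \<le> (\<Sum>j<N. (v j)\<^sup>2)" for v
        using F_upper[of v] by (simp add: F_def)
    qed (use m_large s_large in \<open>simp_all add: \<epsilon>_def\<close>)
    have mat: "(1 / sqrt R) \<cdot>\<^sub>m compressive_colloc_mat d n e \<eta> m \<tau> = mat m N (\<lambda>(i, j). X (\<tau> i) j / sqrt m)" for \<tau>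
      using R0 by (intro eq_matI) (auto simp: compressive_colloc_mat_def X_def b_def N_def real_sqrt_divide)
    show ?thesis
    proof (rule prob_draws_ge[OF n _ bad[unfolded G_def]])
      fix \<tau> assume "\<not> (\<exists>v\<in>sparse_ball N s. \<bar>(\<Sum>i<m. (lin N (X (\<tau> i)) v)\<^sup>2) / m - F v\<bar> > \<epsilon>)"
      then have dev: "\<bar>(\<Sum>i<m. (lin N (X (\<tau> i)) v)\<^sup>2) / m - F v\<bar> \<le> \<epsilon>" if "v \<in> sparse_ball N s" for v
        using that by (auto simp: not_less)
      have "RIP s \<delta> (mat m N (\<lambda>(i, j). X (\<tau> i) j / sqrt m))"
        by (rule RIP_of_small_deviation[where c = "r / R" and \<epsilon> = \<epsilon> and F = F, OF _ _ _ _ F_lower F_upper F_scale dev])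
           (use \<delta> ratio in \<open>auto simp: \<epsilon>_def\<close>)
      then show "\<tau> \<in> {\<tau>. RIP s \<delta> ((1 / sqrt R) \<cdot>\<^sub>m compressive_colloc_mat d n e \<eta> m \<tau>)}"
        by (simp add: mat)
    qed
  qed
  show "let N = n ^ d;
             B = full_colloc_mat d n e \<eta>;
             r = (cube_min d \<eta>)\<^sup>2
                 - 2 / pi * Linf_norm d \<eta> * (\<Sum>k=1..d. Linf_norm d (\<lambda>z. grad d \<eta> z k));
             R = (Linf_norm d \<eta> + 1 / pi * (\<Sum>k=1..d. Linf_norm d (\<lambda>z. grad d \<eta> z k)))\<^sup>2
         in r \<le> lambda_min (B\<^sup>T * B) \<and>
            lambda_min (B\<^sup>T * B) \<le> lambda_max (B\<^sup>T * B) \<and>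
            lambda_max (B\<^sup>T * B) \<le> R \<and>
            (\<forall>(\<delta>::real) (m::nat). 1 - r / R < \<delta> \<longrightarrow> \<delta> < 1 \<longrightarrow> m \<ge> 1 \<longrightarrow>
               (let Ct = 10000000000 * 2 ^ d * (1 / (\<delta> - (1 - r / R))\<^sup>2)
                in real m \<ge> Ct * real s * (ln (real s)) ^ 3 * ln (real N) \<longrightarrow>
                   real s \<ge> Ct * ln (real N) \<longrightarrow>
                   measure_pmf.prob (draws d n m)
                     {\<tau>. RIP s \<delta> ((1 / sqrt R) \<cdot>\<^sub>m compressive_colloc_mat d n e \<eta> m \<tau>)}
                   \<ge> 1 - real N powr (- ((ln (real s)) ^ 3))))"
    unfolding Let_def S_def[symmetric] r_def[symmetric] R_def[symmetric] N_def[symmetric] B_def[symmetric]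
    using spec prob by blast
qed simp

end
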